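(* Suppose that the coefficients $b,\sigma$ satisfy Assumptions 1, 2, 3 and 4, and let $h^\sharp:=h^*\wedge h^{**}$ (assumptions and $h^*,h^{**}$ as in the context). Then for any step size $h\in(0,h^\sharp)$: (1) The Euler-Maruyama scheme with step size $h$ admits a unique invariant measure $\hat\pi_h$. Moreover, the numerical solution converges exponentially fast to $\hat\pi_h$ in the Wasserstein distance along the grid $\{kh:k\in\mathbb N\}$: for every initial value $\hat X_0=x\in\mathbb R^d$ there are constants $C,\xi>0$, independent of $k$, such that $\mathcal W_2(\mathcal L_{\hat X_{kh}},\hat\pi_h)\le Ce^{-\xi kh}$ for all $k\ge0$. (2) There is a constant $C>0$, independent of $h$, such that $$\mathcal W_2(\hat\pi_h,\pi)\le C\,h^{1/2},$$ where $\pi$ is the unique invariant measure of the McKean-Vlasov SDE $\mathrm dX_t=b(X_t,\mathcal L_{X_t})\,\mathrm dt+\sigma(X_t,\mathcal L_{X_t})\,\mathrm dW_t$.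
   Context: Notation: $\mathcal P_2=\mathcal P_2(\mathbb R^d)$ is the set of probability measures on $\mathbb R^d$ with finite second moment; $\mu(|\cdot|^2):=\int|x|^2\mu(\mathrm dx)$; $\mathcal W_2$ is the 2-Wasserstein distance; $\|\cdot\|_{\mathrm{HS}}$ is the Hilbert-Schmidt norm; $\mathcal L_\xi$ is the law of $\xi$. $W$ is a standard $d$-dimensional Brownian motion on a complete filtered probability space $(\Omega,\mathcal F,(\mathcal F_t),\mathbb P)$. The coefficients are $b:\mathbb R^d\times\mathcal P_2\to\mathbb R^d$ and $\sigma:\mathbb R^d\times\mathcal P_2\to\mathbb R^{d\times d}$. Assumption 1: $b$ and $\sigma$ are continuous on $\mathbb R^d\times\mathcal P_2$. Assumption 2: there are constants $\alpha>\beta\ge0$, $\gamma>\kappa\ge0$, $\rho>0$ such that for all $x,y\in\mathbb R^d$, $\mu,\nu\in\mathcal P_2$, $$2\langle b(x,\mu)-b(y,\nu),x-y\rangle+\|\sigma(x,\mu)-\sigma(y,\nu)\|_{\mathrm{HS}}^2\le-\alpha|x-y|^2+\beta\,\mathcal W_2(\mu,\nu)^2,$$ $$2\langle b(x,\mu),x\rangle+(1+\rho)\|\sigma(x,\mu)\|_{\mathrm{HS}}^2\le-\gamma|x|^2+\kappa\big(1+\rho+\mu(|\cdot|^2)\big).$$ Assumption 3: there are positive constants $c_0,a,\bar b$ such that for all $x,y\in\mathbb R^d$, $\mu,\nu\in\mathcal P_2$, $$|b(x,\mu)|^2\vee\|\sigma(x,\mu)\|_{\mathrm{HS}}^2\le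 c_0\big(1+|x|^2+\mu(|\cdot|^2)\big),$$ $$|b(x,\mu)-b(y,\nu)|^2\vee\|\sigma(x,\mu)-\sigma(y,\nu)\|_{\mathrm{HS}}^2\le a|x-y|^2+\bar b\,\mathcal W_2(\mu,\nu)^2.$$ Assumption 4: $a+\bar b<\alpha-\beta$. Euler-Maruyama scheme with step size $h\in(0,1)$: given $\hat X_0$, for $k\ge0$, $$\hat X_{(k+1)h}=\hat X_{kh}+h\,b(\hat X_{kh},\mathcal L_{\hat X_{kh}})+\sigma(\hat X_{kh},\mathcal L_{\hat X_{kh}})\,(W_{(k+1)h}-W_{kh}).$$ Step-size thresholds: $h^*\in(0,1)$ is chosen small enough that $\gamma-\kappa-2c_0h^*>0$ and $1-(\gamma-\kappa)h+2c_0h^2\in(0,1)$ for all $h\in(0,h^* )$; $h^{**}\in(0,1)$ is chosen small enough that $1-(\alpha-\beta)h+(a+\bar b)h^2\in(0,1)$ for all $h\in(0,h^{**})$. Invariant measures: a probability measure $\pi\in\mathcal P_2$ is invariant for the SDE if the solution with initial law $\pi$ satisfies $\pi(B)=\int\mathbb P_t(x,B)\,\pi(\mathrm dx)$ for all Borel $B$ and $t\ge0$, where $\mathbb P_t(x,\cdot)$ is the transition kernel of that process, i.e. $\mathcal L_{X_0}=\pi$ implies $\mathcal L_{X_t}=\pi$ for all $t\ge0$. Likewise $\hat\pi_h\in\mathcal P_2$ is invariant for the scheme if $\mathcal L_{\hat X_0}=\hat\pi_h$ implies $\mathcal L_{\hat X_{kh}}=\hat\pi_h$ for all $k\ge0$.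 It is known that if $b$ and $\sigma$ satisfy Assumptions 1, 2, 3 and 4, then the SDE has a unique invariant measure $\pi$. *)

theory Defs
  imports "HOL-Probability.Probability"
begin

section \<open>The Wasserstein space of order two\<close>

definition P2 :: "'a::euclidean_space measure set" where
  "P2 = {\<mu>. prob_space \<mu> \<and> sets \<mu> = sets borel \<and> integrable \<mu> (\<lambda>x. (norm x)\<^sup>2)}"

definition second_moment :: "'a::euclidean_space measure \<Rightarrow> real" where
  "second_moment \<mu> = (\<integral>x. (norm x)\<^sup>2 \<partial>\<mu>)"

definition couplings ::
    "'a::euclidean_space measure \<Rightarrow> 'a measure \<Rightarrow> ('a \<times> 'a) measure set" where
  "couplings \<mu> \<nu> = {\<gamma>. prob_space \<gamma> \<and> sets \<gamma> = sets borel \<and>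
     distr \<gamma> borel fst = \<mu> \<and> distr \<gamma> borel snd = \<nu>}"

text \<open>
  Intended for \<open>\<mu>, \<nu> \<in> P2\<close>: then the set of couplings is nonempty and every coupling has
  finite cost, so neither the Bochner integral nor the real infimum takes a default value.
\<close>
definition W2 :: "'a::euclidean_space measure \<Rightarrow> 'a measure \<Rightarrow> real" where
  "W2 \<mu> \<nu> = sqrt (INF \<gamma>\<in>couplings \<mu> \<nu>. \<integral>p. (norm (fst p - snd p))\<^sup>2 \<partial>\<gamma>)"


section \<open>Assumptions on the coefficients\<close>

text \<open>
  The library norm on matrices is the Hilbert-Schmidt norm, not the operator norm.
\<close>
lemma norm_matrix_eq_HS:
  fixes A :: "real^'n^'m"
  shows "norm A = sqrt (\<Sum>i\<in>UNIV. \<Sum>j\<in>UNIV. (A $ i $ j)\<^sup>2)"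
  by (simp add: norm_vec_def L2_set_def real_sqrt_pow2 sum_nonneg)

text \<open>
  Coefficients are total functions of a measure argument; all conditions constrain them on
  \<open>P2\<close> only, with the topology of \<open>W2\<close>.
\<close>
definition continuous_coeff ::
    "('a::euclidean_space \<Rightarrow> 'a measure \<Rightarrow> 'b::real_normed_vector) \<Rightarrow> bool" where
  "continuous_coeff f \<longleftrightarrow>
     (\<forall>x. \<forall>\<mu>\<in>P2. \<forall>\<epsilon>>0. \<exists>\<delta>>0. \<forall>y. \<forall>\<nu>\<in>P2.
        norm (y - x) < \<delta> \<longrightarrow> W2 \<nu> \<mu> < \<delta> \<longrightarrow> norm (f y \<nu> - f x \<mu>) < \<epsilon>)"

definition assumption1 ::
    "(real^'d \<Rightarrow> (real^'d) measure \<Rightarrow> real^'d) \<Rightarrow>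
     (real^'d \<Rightarrow> (real^'d) measure \<Rightarrow> real^'d^'d) \<Rightarrow> bool" where
  "assumption1 b \<sigma> \<longleftrightarrow> continuous_coeff b \<and> continuous_coeff \<sigma>"

definition assumption2 ::
    "(real^'d \<Rightarrow> (real^'d) measure \<Rightarrow> real^'d) \<Rightarrow>
     (real^'d \<Rightarrow> (real^'d) measure \<Rightarrow> real^'d^'d) \<Rightarrow>
     real \<Rightarrow> real \<Rightarrow> real \<Rightarrow> real \<Rightarrow> real \<Rightarrow> bool" where
  "assumption2 b \<sigma> \<alpha> \<beta> \<gamma> \<kappa> \<rho> \<longleftrightarrow>
     \<alpha> > \<beta> \<and> \<beta> \<ge> 0 \<and> \<gamma> > \<kappa> \<and> \<kappa> \<ge> 0 \<and> \<rho> > 0 \<and>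
     (\<forall>x y. \<forall>\<mu>\<in>P2. \<forall>\<nu>\<in>P2.
        2 * ((b x \<mu> - b y \<nu>) \<bullet> (x - y)) + (norm (\<sigma> x \<mu> - \<sigma> y \<nu>))\<^sup>2
          \<le> - \<alpha> * (norm (x - y))\<^sup>2 + \<beta> * (W2 \<mu> \<nu>)\<^sup>2) \<and>
     (\<forall>x. \<forall>\<mu>\<in>P2.
        2 * (b x \<mu> \<bullet> x) + (1 + \<rho>) * (norm (\<sigma> x \<mu>))\<^sup>2
          \<le> - \<gamma> * (norm x)\<^sup>2 + \<kappa> * (1 + \<rho> + second_moment \<mu>))"

definition assumption3 ::
    "(real^'d \<Rightarrow> (real^'d) measure \<Rightarrow> real^'d) \<Rightarrow>
     (real^'d \<Rightarrow> (real^'d) measure \<Rightarrow> real^'d^'d) \<Rightarrow>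
     real \<Rightarrow> real \<Rightarrow> real \<Rightarrow> bool" where
  "assumption3 b \<sigma> c0 a bbar \<longleftrightarrow>
     c0 > 0 \<and> a > 0 \<and> bbar > 0 \<and>
     (\<forall>x. \<forall>\<mu>\<in>P2.
        max ((norm (b x \<mu>))\<^sup>2) ((norm (\<sigma> x \<mu>))\<^sup>2)
          \<le> c0 * (1 + (norm x)\<^sup>2 + second_moment \<mu>)) \<and>
     (\<forall>x y. \<forall>\<mu>\<in>P2. \<forall>\<nu>\<in>P2.
        max ((norm (b x \<mu> - b y \<nu>))\<^sup>2) ((norm (\<sigma> x \<mu> - \<sigma> y \<nu>))\<^sup>2)
          \<le> a * (norm (x - y))\<^sup>2 + bbar * (W2 \<mu> \<nu>)\<^sup>2)"

definition assumption4 :: "real \<Rightarrow> real \<Rightarrow> real \<Rightarrow> real \<Rightarrow> bool" where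
  "assumption4 \<alpha> \<beta> a bbar \<longleftrightarrow> a + bbar < \<alpha> - \<beta>"


section \<open>Filtered probability space and Brownian motion\<close>

text \<open>
  Time is indexed by the nonnegative reals; the values of \<open>F\<close> and of processes at negative
  times are irrelevant throughout.  Condition \<open>complete\<close> says that \<open>M\<close> is complete and that
  all null sets belong to \<open>F 0\<close>.
\<close>
locale complete_filtered_prob_space = prob_space M for M :: "'w measure" +
  fixes F :: "real \<Rightarrow> 'w measure"
  assumes subalg: "\<And>t. 0 \<le> t \<Longrightarrow> subalgebra M (F t)"
    and F_mono: "\<And>s t. 0 \<le> s \<Longrightarrow> s \<le> t \<Longrightarrow> sets (F s) \<subseteq> sets (F t)"
    and complete: "\<And>N A. N \<in> null_sets M \<Longrightarrow> A \<subseteq> N \<Longrightarrow> A \<in> sets (F 0)"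

text \<open>The centred normal law on \<open>real^'d\<close> with covariance matrix \<open>v\<close> times the identity.\<close>
definition isotropic_normal :: "real \<Rightarrow> (real^'d) measure" where
  "isotropic_normal v =
     density lborel (\<lambda>x. ennreal (\<Prod>i\<in>UNIV. normal_density 0 (sqrt v) (x $ i)))"

locale brownian_motion = complete_filtered_prob_space M F
  for M :: "'w measure" and F :: "real \<Rightarrow> 'w measure" +
  fixes W :: "real \<Rightarrow> 'w \<Rightarrow> real^'d"
  assumes adapted: "\<And>t. 0 \<le> t \<Longrightarrow> W t \<in> borel_measurable (F t)"
    and start: "AE \<omega> in M. W 0 \<omega> = 0"
    and continuous_paths: "AE \<omega> in M. continuous_on {0..} (\<lambda>t. W t \<omega>)"
    and normal_increments: "\<And>s t. 0 \<le> s \<Longrightarrow> s < t \<Longrightarrow>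
          distr M borel (\<lambda>\<omega>. W t \<omega> - W s \<omega>) = isotropic_normal (t - s)"
    and independent_increments: "\<And>s t. 0 \<le> s \<Longrightarrow> s < t \<Longrightarrow>
          indep_set (sets (F s))
            {(\<lambda>\<omega>. W t \<omega> - W s \<omega>) -` B \<inter> space M | B. B \<in> sets borel}"

text \<open>
  Initial laws are realised by \<open>F 0\<close>-measurable random variables on the given space, so
  speaking of the solution started from an arbitrary law in \<open>P2\<close> presupposes that \<open>F 0\<close>
  carries every such law.  (If \<open>F 0\<close> were trivial, every non-Dirac law would satisfy the
  implication defining invariance vacuously.)
\<close>
definition supports_initial_laws ::
    "'w measure \<Rightarrow> (real \<Rightarrow> 'w measure) \<Rightarrow> 'a::euclidean_space itself \<Rightarrow> bool" where
  "supports_initial_laws M F _ \<longleftrightarrow>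
     (\<forall>\<mu>\<in>(P2 :: 'a measure set). \<exists>\<xi>\<in>borel_measurable (F 0). distr M borel \<xi> = \<mu>)"


section \<open>The Ito integral\<close>

definition progressively_measurable ::
    "(real \<Rightarrow> 'w measure) \<Rightarrow> (real \<Rightarrow> 'w \<Rightarrow> 'b::topological_space) \<Rightarrow> bool" where
  "progressively_measurable F H \<longleftrightarrow>
     (\<forall>t\<ge>0. (\<lambda>(s, \<omega>). H s \<omega>) \<in>
        borel_measurable (restrict_space borel {0..t} \<Otimes>\<^sub>M F t))"

text \<open>
  A simple integrand on \<open>[0, T]\<close> is given by a number \<open>m\<close> of steps, nodes \<open>\<tau> 0, \<dots>, \<tau> m\<close> and
  bounded \<open>F (\<tau> i)\<close>-measurable matrices \<open>A i\<close>; it takes the value \<open>A i\<close> on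
  \<open>{\<tau> i <.. \<tau> (Suc i)}\<close>.
\<close>
definition simple_integrand ::
    "(real \<Rightarrow> 'w measure) \<Rightarrow> real \<Rightarrow> nat \<Rightarrow> (nat \<Rightarrow> real) \<Rightarrow>
     (nat \<Rightarrow> 'w \<Rightarrow> real^'d^'d) \<Rightarrow> bool" where
  "simple_integrand F T m \<tau> A \<longleftrightarrow>
     0 \<le> \<tau> 0 \<and> (\<forall>i<m. \<tau> i \<le> \<tau> (Suc i)) \<and> \<tau> m \<le> T \<and>
     (\<forall>i<m. A i \<in> borel_measurable (F (\<tau> i)) \<and> (\<exists>K. \<forall>\<omega>\<in>space (F (\<tau> i)). norm (A i \<omega>) \<le> K))"

definition simple_value ::
    "nat \<Rightarrow> (nat \<Rightarrow> real) \<Rightarrow> (nat \<Rightarrow> 'w \<Rightarrow> real^'d^'d) \<Rightarrow> real \<Rightarrow> 'w \<Rightarrow> real^'d^'d" where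
  "simple_value m \<tau> A s \<omega> = (\<Sum>i<m. indicator {\<tau> i <.. \<tau> (Suc i)} s *\<^sub>R A i \<omega>)"

definition simple_integral ::
    "(real \<Rightarrow> 'w \<Rightarrow> real^'d) \<Rightarrow> nat \<Rightarrow> (nat \<Rightarrow> real) \<Rightarrow>
     (nat \<Rightarrow> 'w \<Rightarrow> real^'d^'d) \<Rightarrow> 'w \<Rightarrow> real^'d" where
  "simple_integral W m \<tau> A \<omega> = (\<Sum>i<m. A i \<omega> *v (W (\<tau> (Suc i)) \<omega> - W (\<tau> i) \<omega>))"

text \<open>
  \<open>I\<close> is a version of the integral of \<open>H\<close> against \<open>W\<close> over \<open>[0, T]\<close>: the mean-square limit of
  the integrals of simple integrands converging to \<open>H\<close> in \<open>L\<^sup>2([0, T] \<times> \<Omega>)\<close>.  By the isometry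
  \<open>I\<close> is determined almost surely.
\<close>
definition has_ito_integral ::
    "'w measure \<Rightarrow> (real \<Rightarrow> 'w measure) \<Rightarrow> (real \<Rightarrow> 'w \<Rightarrow> real^'d) \<Rightarrow>
     (real \<Rightarrow> 'w \<Rightarrow> real^'d^'d) \<Rightarrow> real \<Rightarrow> ('w \<Rightarrow> real^'d) \<Rightarrow> bool" where
  "has_ito_integral M F W H T I \<longleftrightarrow>
     progressively_measurable F H \<and> I \<in> borel_measurable M \<and>
     (\<exists>m \<tau> A.
        (\<forall>n. simple_integrand F T (m n) (\<tau> n) (A n)) \<and>
        (\<lambda>n. \<integral>\<^sup>+s\<in>{0..T}. (\<integral>\<^sup>+\<omega>. ennreal ((norm (H s \<omega> - simple_value (m n) (\<tau> n) (A n) s \<omega>))\<^sup>2) \<partial>M)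
               \<partial>lborel) \<longlonglongrightarrow> 0 \<and>
        (\<lambda>n. \<integral>\<^sup>+\<omega>. ennreal ((norm (I \<omega> - simple_integral W (m n) (\<tau> n) (A n) \<omega>))\<^sup>2) \<partial>M) \<longlonglongrightarrow> 0)"


section \<open>The McKean-Vlasov equation and its invariant measures\<close>

abbreviation law :: "'w measure \<Rightarrow> ('w \<Rightarrow> 'a::euclidean_space) \<Rightarrow> 'a measure" where
  "law M X \<equiv> distr M borel X"

text \<open>
  The equation is required almost surely for each fixed time; as all terms have continuous
  versions, this is the same as requiring it almost surely for all times simultaneously.
\<close>
definition mv_solution ::
    "'w measure \<Rightarrow> (real \<Rightarrow> 'w measure) \<Rightarrow> (real \<Rightarrow> 'w \<Rightarrow> real^'d) \<Rightarrow>
     (real^'d \<Rightarrow> (real^'d) measure \<Rightarrow> real^'d) \<Rightarrow>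
     (real^'d \<Rightarrow> (real^'d) measure \<Rightarrow> real^'d^'d) \<Rightarrow>
     (real \<Rightarrow> 'w \<Rightarrow> real^'d) \<Rightarrow> bool" where
  "mv_solution M F W b \<sigma> X \<longleftrightarrow>
     (\<forall>t\<ge>0. X t \<in> borel_measurable (F t)) \<and>
     (\<forall>\<omega>\<in>space M. continuous_on {0..} (\<lambda>t. X t \<omega>)) \<and>
     (\<forall>t\<ge>0. law M (X t) \<in> P2) \<and>
     progressively_measurable F (\<lambda>s \<omega>. b (X s \<omega>) (law M (X s))) \<and>
     progressively_measurable F (\<lambda>s \<omega>. \<sigma> (X s \<omega>) (law M (X s))) \<and>
     (\<forall>t\<ge>0. (\<integral>\<^sup>+s\<in>{0..t}. (\<integral>\<^sup>+\<omega>. ennreal (norm (b (X s \<omega>) (law M (X s))) +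
               (norm (\<sigma> (X s \<omega>) (law M (X s))))\<^sup>2) \<partial>M) \<partial>lborel) < \<infinity>) \<and>
     (\<forall>t\<ge>0. \<exists>I. has_ito_integral M F W (\<lambda>s \<omega>. \<sigma> (X s \<omega>) (law M (X s))) t I \<and>
        (AE \<omega> in M. X t \<omega> =
           X 0 \<omega> + (LINT s:{0..t}|lborel. b (X s \<omega>) (law M (X s))) + I \<omega>))"

text \<open>
  The existential conjunct records that there is a solution with initial law \<open>\<pi>\<close>, so that
  invariance is never vacuous.
\<close>
definition mv_invariant ::
    "'w measure \<Rightarrow> (real \<Rightarrow> 'w measure) \<Rightarrow> (real \<Rightarrow> 'w \<Rightarrow> real^'d) \<Rightarrow>
     (real^'d \<Rightarrow> (real^'d) measure \<Rightarrow> real^'d) \<Rightarrow>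
     (real^'d \<Rightarrow> (real^'d) measure \<Rightarrow> real^'d^'d) \<Rightarrow>
     (real^'d) measure \<Rightarrow> bool" where
  "mv_invariant M F W b \<sigma> \<pi> \<longleftrightarrow> \<pi> \<in> P2 \<and>
     (\<exists>X. mv_solution M F W b \<sigma> X \<and> law M (X 0) = \<pi>) \<and>
     (\<forall>X. mv_solution M F W b \<sigma> X \<longrightarrow> law M (X 0) = \<pi> \<longrightarrow> (\<forall>t\<ge>0. law M (X t) = \<pi>))"


section \<open>The Euler-Maruyama scheme and its invariant measures\<close>

text \<open>\<open>euler M W b \<sigma> h X0 k\<close> is the numerical solution at time \<open>k * h\<close>.\<close>
primrec euler ::
    "'w measure \<Rightarrow> (real \<Rightarrow> 'w \<Rightarrow> real^'d) \<Rightarrow>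
     (real^'d \<Rightarrow> (real^'d) measure \<Rightarrow> real^'d) \<Rightarrow>
     (real^'d \<Rightarrow> (real^'d) measure \<Rightarrow> real^'d^'d) \<Rightarrow>
     real \<Rightarrow> ('w \<Rightarrow> real^'d) \<Rightarrow> nat \<Rightarrow> 'w \<Rightarrow> real^'d" where
  "euler M W b \<sigma> h X0 0 = X0"
| "euler M W b \<sigma> h X0 (Suc k) =
     (\<lambda>\<omega>. euler M W b \<sigma> h X0 k \<omega>
        + h *\<^sub>R b (euler M W b \<sigma> h X0 k \<omega>) (law M (euler M W b \<sigma> h X0 k))
        + \<sigma> (euler M W b \<sigma> h X0 k \<omega>) (law M (euler M W b \<sigma> h X0 k))
            *v (W (real (Suc k) * h) \<omega> - W (real k * h) \<omega>))"

definition euler_invariant ::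
    "'w measure \<Rightarrow> (real \<Rightarrow> 'w measure) \<Rightarrow> (real \<Rightarrow> 'w \<Rightarrow> real^'d) \<Rightarrow>
     (real^'d \<Rightarrow> (real^'d) measure \<Rightarrow> real^'d) \<Rightarrow>
     (real^'d \<Rightarrow> (real^'d) measure \<Rightarrow> real^'d^'d) \<Rightarrow>
     real \<Rightarrow> (real^'d) measure \<Rightarrow> bool" where
  "euler_invariant M F W b \<sigma> h \<pi> \<longleftrightarrow> \<pi> \<in> P2 \<and>
     (\<exists>X0\<in>borel_measurable (F 0). law M X0 = \<pi>) \<and>
     (\<forall>X0\<in>borel_measurable (F 0). law M X0 = \<pi> \<longrightarrow>
        (\<forall>k. law M (euler M W b \<sigma> h X0 k) = \<pi>))"

definition admissible_hstar :: "real \<Rightarrow> real \<Rightarrow> real \<Rightarrow> real \<Rightarrow> bool" where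
  "admissible_hstar \<gamma> \<kappa> c0 hs \<longleftrightarrow> hs \<in> {0<..<1} \<and> \<gamma> - \<kappa> - 2 * c0 * hs > 0 \<and>
     (\<forall>h\<in>{0<..<hs}. 1 - (\<gamma> - \<kappa>) * h + 2 * c0 * h\<^sup>2 \<in> {0<..<1})"

definition admissible_hstarstar :: "real \<Rightarrow> real \<Rightarrow> real \<Rightarrow> real \<Rightarrow> real \<Rightarrow> bool" where
  "admissible_hstarstar \<alpha> \<beta> a bbar hss \<longleftrightarrow> hss \<in> {0<..<1} \<and>
     (\<forall>h\<in>{0<..<hss}. 1 - (\<alpha> - \<beta>) * h + (a + bbar) * h\<^sup>2 \<in> {0<..<1})"

end

theory Submission
  imports Defs
begin

text \<open>
  Under synchronous coupling one Euler step contracts the mean square distance of two random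
  variables by the factor \<open>1 - (\<alpha> - \<beta>) * h + (a + bbar) * h\<^sup>2\<close>, since the Wasserstein distance
  of their laws is bounded by that same mean square distance.  Iterated along the noise read
  backwards in time, this makes the scheme started at \<open>0\<close> a Cauchy sequence in mean square, and
  the law of its limit is invariant.  Uniqueness and exponential convergence follow by running the
  scheme forwards from two initial values with the same noise.

  For the rate, the stationary solution of the equation and the stationary scheme are driven by the
  same Brownian motion.  Only the part of the local error that is orthogonal to the past is as large
  as order \<open>h\<close> in mean square norm, so the squared error \<open>e\<close> satisfies
  \<open>e (Suc k) \<le> (1 - c * h) * e k + K * h\<^sup>2\<close> and is eventually of order \<open>h\<close>.  The processes
  are realised on one probability space throughout, so neither optimal couplings nor the triangle
  inequality for the Wasserstein distance are needed.
\<close>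

section \<open>Square integrable random variables and isotropic normal laws\<close>

text \<open>Two obstacles shape the proof. The coefficients depend on the law of the state, so the
  map from one law to the next is nonlinear, and convergence of the laws must accompany that of the
  iterates. Run forwards, the iterates converge only in law; reading an i.i.d. noise sequence
  backwards makes the convergence almost sure, at the price of an auxiliary probability space. The
  law found there is carried to the given space because the law of a step depends on the state only
  through its law. The Ito integral is given at each fixed time separately, as a mean square limit
  of simple integrals, and the approximations at two times are unrelated. The isometry bound and the
  orthogonality to the past are therefore proved for step processes and passed to the limit. Without
  orthogonality, about 1 / h local errors of norm h would add up to order 1. Assumption 4 provides
  the margin \<open>\<alpha> - \<beta> - (a + bbar)\<close>: as h < 1, it bounds the contraction
  rate per unit of time from below uniformly in h, and so the constant of the rate does not depend
  on h.\<close>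

lemma lborel_integral_prod:
  fixes f :: "'a::euclidean_space \<Rightarrow> real \<Rightarrow> real"
  assumes f: "\<And>b. b \<in> Basis \<Longrightarrow> integrable lborel (f b)"
  shows "integrable lborel (\<lambda>x::'a. \<Prod>b\<in>Basis. f b (x \<bullet> b))" (is ?int)
    and "(\<integral>x. (\<Prod>b\<in>Basis. f b (x \<bullet> b)) \<partial>(lborel :: 'a measure)) = (\<Prod>b\<in>Basis. \<integral>x. f b x \<partial>lborel)" (is ?eq)
proof -
  interpret product_sigma_finite "\<lambda>_::'a. lborel :: real measure"
    by standard
  have [measurable]: "\<And>b. b \<in> Basis \<Longrightarrow> f b \<in> borel_measurable borel"
    using borel_measurable_integrable[OF f] by simp
  have coord: "(\<Prod>b\<in>Basis. f b ((\<Sum>c\<in>Basis. x c *\<^sub>R c) \<bullet> b)) = (\<Prod>b\<in>Basis. f b (x b))" for x :: "'a \<Rightarrow> real"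
    by (intro prod.cong) (auto simp: inner_sum_left inner_Basis if_distrib cong: if_cong)
  have meas: "(\<lambda>x::'a. \<Prod>b\<in>Basis. f b (x \<bullet> b)) \<in> borel_measurable borel"
    by measurable
  have sum_meas: "(\<lambda>x. \<Sum>b\<in>Basis. x b *\<^sub>R b) \<in> (\<Pi>\<^sub>M b\<in>(Basis::'a set). lborel) \<rightarrow>\<^sub>M (borel :: 'a measure)"
    by measurable
  show ?int
    by (subst lborel_eq, subst integrable_distr_eq[OF sum_meas meas])
      (simp add: coord product_integrable_prod[OF finite_Basis f])
  show ?eq
    by (subst lborel_eq, subst integral_distr[OF sum_meas meas])
      (simp add: coord product_integral_prod[OF finite_Basis f])
qed

lemma prod_Basis_vec:
  fixes x :: "real^'d"
  shows "(\<Prod>b\<in>Basis. f (axis_index b) (x \<bullet> b)) = (\<Prod>i\<in>UNIV. f i (x $ i))"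
proof -
  have "(Basis :: (real^'d) set) = range (\<lambda>i. axis i 1)"
    by (auto simp: Basis_vec_def)
  moreover have "inj (\<lambda>i::'d. axis i (1::real))"
    by (simp add: inj_on_def axis_eq_axis)
  ultimately show ?thesis
    by (subst \<open>Basis = _\<close>, subst prod.reindex) (auto simp: axis_index_axis inner_axis)
qed

lemma lborel_vec_integral_prod:
  fixes f :: "'d::finite \<Rightarrow> real \<Rightarrow> real"
  assumes f: "\<And>i. integrable lborel (f i)"
  shows "integrable lborel (\<lambda>x::real^'d. \<Prod>i\<in>UNIV. f i (x $ i))"
    and "(\<integral>x. (\<Prod>i\<in>UNIV. f i (x $ i)) \<partial>(lborel :: (real^'d) measure)) = (\<Prod>i\<in>UNIV. \<integral>x. f i x \<partial>lborel)"
proof -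
  note lborel_integral_prod[of "\<lambda>b::real^'d. f (axis_index b)", OF f]
  note * = this[unfolded prod_Basis_vec]
  show "integrable lborel (\<lambda>x::real^'d. \<Prod>i\<in>UNIV. f i (x $ i))"
    by (rule *(1))
  have "(\<Prod>b\<in>(Basis::(real^'d) set). \<integral>x. f (axis_index b) x \<partial>lborel)
      = (\<Prod>i\<in>UNIV. \<integral>x. f i x \<partial>lborel)"
    using prod_Basis_vec[of "\<lambda>i _. \<integral>x. f i x \<partial>lborel" "0::real^'d"] by simp
  then show "(\<integral>x. (\<Prod>i\<in>UNIV. f i (x $ i)) \<partial>(lborel :: (real^'d) measure)) = (\<Prod>i\<in>UNIV. \<integral>x. f i x \<partial>lborel)"
    using *(2) by simp
qed

section \<open>Moments of the isotropic normal law\<close>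

lemma isotropic_normal_integral_prod:
  fixes f :: "'d::finite \<Rightarrow> real \<Rightarrow> real"
  assumes f: "\<And>i. integrable lborel (\<lambda>x. normal_density 0 (sqrt v) x * f i x)"
    and [measurable]: "\<And>i. f i \<in> borel_measurable borel"
  shows "integrable (isotropic_normal v) (\<lambda>x::real^'d. \<Prod>i\<in>UNIV. f i (x $ i))"
    and "(\<integral>x. (\<Prod>i\<in>UNIV. f i (x $ i)) \<partial>(isotropic_normal v :: (real^'d) measure))
       = (\<Prod>i\<in>UNIV. \<integral>x. normal_density 0 (sqrt v) x * f i x \<partial>lborel)"
proof -
  have m: "(\<lambda>x::real^'d. \<Prod>i\<in>UNIV. normal_density 0 (sqrt v) (x $ i)) \<in> borel_measurable lborel"
    "(\<lambda>x::real^'d. \<Prod>i\<in>UNIV. f i (x $ i)) \<in> borel_measurable lborel"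
    unfolding normal_density_def by measurable
  have nn: "AE x::real^'d in lborel. 0 \<le> (\<Prod>i\<in>UNIV. normal_density 0 (sqrt v) (x $ i))"
    by (intro AE_I2 prod_nonneg) auto
  note * = lborel_vec_integral_prod[OF f]
  show "integrable (isotropic_normal v) (\<lambda>x::real^'d. \<Prod>i\<in>UNIV. f i (x $ i))"
    unfolding isotropic_normal_def using m nn *(1)
    by (subst integrable_density) (auto simp: prod.distrib)
  show "(\<integral>x. (\<Prod>i\<in>UNIV. f i (x $ i)) \<partial>(isotropic_normal v :: (real^'d) measure))
       = (\<Prod>i\<in>UNIV. \<integral>x. normal_density 0 (sqrt v) x * f i x \<partial>lborel)"
    unfolding isotropic_normal_def using m nn *(2)
    by (subst integral_density) (auto simp: prod.distrib)
qed

lemma isotropic_normal_moments: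
  assumes v: "v > 0"
  shows "integrable (isotropic_normal v :: (real^'d) measure) (\<lambda>x. x $ i)"
    and "(\<integral>x. x $ i \<partial>(isotropic_normal v :: (real^'d) measure)) = 0"
    and "integrable (isotropic_normal v :: (real^'d) measure) (\<lambda>x. x $ i * x $ j)"
    and "(\<integral>x. x $ i * x $ j \<partial>(isotropic_normal v :: (real^'d) measure)) = (if i = j then v else 0)"
proof -
  have sv: "0 < sqrt v" using v by simp
  note M0 = integrable_normal_density[OF sv, of 0] integral_normal_density[OF sv, of 0]
  note M1 = integrable_normal_moment_nz_1[OF sv, of 0] integral_normal_moment_nz_1[OF sv, of 0]
  have M2: "has_bochner_integral lborel (\<lambda>x. normal_density 0 (sqrt v) x * x\<^sup>2) v"
    using normal_moment_even[OF sv, of 0 1] v by simp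
  note M2 = M2[THEN integrable.intros] M2[THEN has_bochner_integral_integral_eq]
  \<comment> \<open>One factor per coordinate, with product \<open>x $ i\<close>; the factor at
    \<open>i\<close> has mean 0 and annihilates the product of integrals.\<close>
  define f1 where "f1 k = (if k = i then (\<lambda>x. x) else (\<lambda>_. 1::real))" for k
  have f1: "integrable lborel (\<lambda>x. normal_density 0 (sqrt v) x * f1 k x)" for k
    using M0 M1 by (auto simp: f1_def)
  have m1: "f1 k \<in> borel_measurable borel" for k
    by (auto simp: f1_def)
  have p1: "(\<Prod>k\<in>UNIV. f1 k (x $ k)) = x $ i" for x :: "real^'d"
  proof -
    have "(\<Prod>k\<in>UNIV. f1 k (x $ k)) = (\<Prod>k\<in>UNIV. if k = i then x $ i else 1)"
      by (intro prod.cong) (auto simp: f1_def)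
    then show ?thesis by simp
  qed
  note I1 = isotropic_normal_integral_prod[where f=f1, OF f1 m1, unfolded p1]
  show "integrable (isotropic_normal v :: (real^'d) measure) (\<lambda>x. x $ i)"
    using I1(1) by simp
  have "(\<Prod>k\<in>UNIV. \<integral>x. normal_density 0 (sqrt v) x * f1 k x \<partial>lborel) = 0"
    using M1 by (intro prod_zero bexI[of _ i]) (auto simp: f1_def)
  then show "(\<integral>x. x $ i \<partial>(isotropic_normal v :: (real^'d) measure)) = 0"
    using I1(2) by simp
  \<comment> \<open>The same device for \<open>x $ i * x $ j\<close>. For \<open>i = j\<close> there
    is a single factor \<open>x\<^sup>2\<close>, of integral \<open>v\<close>; otherwise two factors
    of mean 0 occur.\<close>
  define f2 where "f2 k = (if k = i then (if k = j then (\<lambda>x. x\<^sup>2) else (\<lambda>x. x))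
      else if k = j then (\<lambda>x. x) else (\<lambda>_. 1::real))" for k
  have f2: "integrable lborel (\<lambda>x. normal_density 0 (sqrt v) x * f2 k x)" for k
    using M0 M1 M2 by (auto simp: f2_def)
  have m2: "f2 k \<in> borel_measurable borel" for k
    by (auto simp: f2_def)
  have p2: "(\<Prod>k\<in>UNIV. f2 k (x $ k)) = x $ i * x $ j" for x :: "real^'d"
  proof -
    have "(\<Prod>k\<in>UNIV. f2 k (x $ k)) = (\<Prod>k\<in>UNIV. (if k = i then x $ i else 1) * (if k = j then x $ j else 1))"
      by (intro prod.cong) (auto simp: f2_def power2_eq_square)
    then show ?thesis by (simp add: prod.distrib)
  qed
  note I2 = isotropic_normal_integral_prod[where f=f2, OF f2 m2, unfolded p2]
  show "integrable (isotropic_normal v :: (real^'d) measure) (\<lambda>x. x $ i * x $ j)"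
    using I2(1) by simp
  have "(\<Prod>k\<in>UNIV. \<integral>x. normal_density 0 (sqrt v) x * f2 k x \<partial>lborel) = (if i = j then v else 0)"
  proof (cases "i = j")
    case True
    have "(\<Prod>k\<in>UNIV. \<integral>x. normal_density 0 (sqrt v) x * f2 k x \<partial>lborel)
        = (\<Prod>k\<in>UNIV. if k = i then v else 1)"
      using M0 M2 True by (intro prod.cong) (auto simp: f2_def)
    then show ?thesis using True by simp
  next
    case False
    then show ?thesis
      using M1 by (auto simp: f2_def intro!: prod_zero bexI[of _ i])
  qed
  then show "(\<integral>x. x $ i * x $ j \<partial>(isotropic_normal v :: (real^'d) measure)) = (if i = j then v else 0)"
    using I2(2) by simp
qed

section \<open>Square integrable random variables\<close>

definition L2 :: "'a measure \<Rightarrow> ('a \<Rightarrow> 'b::euclidean_space) \<Rightarrow> bool" where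
  "L2 M f \<longleftrightarrow> f \<in> borel_measurable M \<and> integrable M (\<lambda>x. (norm (f x))\<^sup>2)"

lemma L2_measurable: "L2 M f \<Longrightarrow> f \<in> borel_measurable M"
  and L2_integrable_norm_sq: "L2 M f \<Longrightarrow> integrable M (\<lambda>x. (norm (f x))\<^sup>2)"
  by (auto simp: L2_def)

lemma norm_add_sq_le: "(norm (x + y))\<^sup>2 \<le> 2 * (norm x)\<^sup>2 + 2 * (norm (y::'a::real_inner))\<^sup>2"
proof -
  have "0 \<le> (norm (x - y))\<^sup>2" by simp
  then show ?thesis
    by (simp add: power2_norm_eq_inner inner_left_distrib inner_right_distrib inner_diff_left
        inner_diff_right inner_commute)
qed

lemma norm_diff_sq_le: "(norm (x - y))\<^sup>2 \<le> 2 * (norm x)\<^sup>2 + 2 * (norm (y::'a::real_inner))\<^sup>2"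
  using norm_add_sq_le[of x "-y"] by simp

text \<open>Expanding the nonnegative square of \<open>\<delta> *\<^sub>R x - y\<close> and dividing
  by \<open>\<delta>\<close> gives the bound. The free weight decides later how a cross term is
  shared between the contraction and the error.\<close>

lemma inner_le_weighted:
  assumes "\<delta> > 0"
  shows "2 * (x \<bullet> y) \<le> \<delta> * (norm x)\<^sup>2 + (norm (y::'a::real_inner))\<^sup>2 / \<delta>"
proof -
  have "0 \<le> (norm (\<delta> *\<^sub>R x - y))\<^sup>2 / \<delta>" using assms by simp
  also have "\<dots> = \<delta> * (norm x)\<^sup>2 - 2 * (x \<bullet> y) + (norm y)\<^sup>2 / \<delta>"
    using assms unfolding power2_norm_eq_inner
    by (simp add: inner_diff_left inner_diff_right inner_commute field_simps)
  finally show ?thesis by simp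
qed

lemma L2_bound:
  assumes f: "f \<in> borel_measurable M" and g: "integrable M g"
    and le: "\<And>x. x \<in> space M \<Longrightarrow> (norm (f x))\<^sup>2 \<le> g x"
  shows "L2 M f"
  unfolding L2_def
proof (intro conjI f)
  show "integrable M (\<lambda>x. (norm (f x))\<^sup>2)"
    using f by (intro Bochner_Integration.integrable_bound[OF g] AE_I2) (auto dest: le)
qed

lemma L2_add: "L2 M f \<Longrightarrow> L2 M g \<Longrightarrow> L2 M (\<lambda>x. f x + g x)"
  by (rule L2_bound[where g="\<lambda>x. 2 * (norm (f x))\<^sup>2 + 2 * (norm (g x))\<^sup>2"])
    (auto simp: L2_def norm_add_sq_le)

lemma L2_diff: "L2 M f \<Longrightarrow> L2 M g \<Longrightarrow> L2 M (\<lambda>x. f x - g x)"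
  by (rule L2_bound[where g="\<lambda>x. 2 * (norm (f x))\<^sup>2 + 2 * (norm (g x))\<^sup>2"])
    (auto simp: L2_def norm_diff_sq_le)

lemma L2_scaleR: "L2 M f \<Longrightarrow> L2 M (\<lambda>x. c *\<^sub>R f x)"
  by (auto simp: L2_def power_mult_distrib)

lemma L2_uminus: "L2 M f \<Longrightarrow> L2 M (\<lambda>x. - f x)"
  using L2_scaleR[of M f "-1"] by simp

lemma L2_const: "finite_measure M \<Longrightarrow> L2 M (\<lambda>x. c)"
  by (simp add: L2_def finite_measure.integrable_const)

lemma L2_inner:
  assumes "L2 M f" "L2 M g"
  shows "integrable M (\<lambda>x. f x \<bullet> g x)"
proof (rule Bochner_Integration.integrable_bound)
  show "integrable M (\<lambda>x. (norm (f x))\<^sup>2 + (norm (g x))\<^sup>2)"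
    using assms by (auto simp: L2_def)
  show "(\<lambda>x. f x \<bullet> g x) \<in> borel_measurable M"
    using assms by (auto simp: L2_def)
  have "\<bar>x \<bullet> y\<bar> \<le> (norm x)\<^sup>2 + (norm y)\<^sup>2" for x y :: 'b
    using inner_le_weighted[of 1 x y] inner_le_weighted[of 1 "-x" y] by simp
  then show "AE x in M. norm (f x \<bullet> g x) \<le> norm ((norm (f x))\<^sup>2 + (norm (g x))\<^sup>2)"
    by simp
qed

lemma L2_component:
  fixes f :: "'a \<Rightarrow> 'b::euclidean_space"
  assumes f: "L2 M f"
  shows "L2 M (\<lambda>x. f x \<bullet> c)"
proof (rule L2_bound)
  show "(\<lambda>x. f x \<bullet> c) \<in> borel_measurable M" using f by (auto simp: L2_def)
  show "integrable M (\<lambda>x. (norm c)\<^sup>2 * (norm (f x))\<^sup>2)" using f by (auto simp: L2_def)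
  show "(norm (f x \<bullet> c))\<^sup>2 \<le> (norm c)\<^sup>2 * (norm (f x))\<^sup>2" for x
  proof -
    have "\<bar>f x \<bullet> c\<bar>\<^sup>2 \<le> (norm (f x) * norm c)\<^sup>2"
      by (intro power_mono Cauchy_Schwarz_ineq2) auto
    then show ?thesis by (simp add: power_mult_distrib mult.commute)
  qed
qed

lemma L2_nth: "L2 M f \<Longrightarrow> L2 M (\<lambda>x. f x $ i)" for f :: "'a \<Rightarrow> real^'d"
  using L2_component[of M f "axis i 1"] by (simp add: inner_axis)

lemma L2_nth_nth: "L2 M f \<Longrightarrow> L2 M (\<lambda>x. f x $ i $ j)" for f :: "'a \<Rightarrow> real^'d^'e"
  using L2_component[of M f "axis i (axis j 1)"] by (simp add: inner_axis)

lemma L2_mult: "L2 M f \<Longrightarrow> L2 M g \<Longrightarrow> integrable M (\<lambda>x. f x * g x)" for f :: "'a \<Rightarrow> real"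
  using L2_inner[of M f g] by simp

lemma L2_vecI:
  fixes f :: "'a \<Rightarrow> real^'d"
  assumes "\<And>i. L2 M (\<lambda>x. f x $ i)"
  shows "L2 M f"
  unfolding L2_def
proof
  show "f \<in> borel_measurable M"
    by (subst borel_measurable_euclidean_space) (use assms in \<open>auto simp: L2_def Basis_vec_def inner_axis\<close>)
  have "(norm (f x))\<^sup>2 = (\<Sum>i\<in>UNIV. (f x $ i)\<^sup>2)" for x
    by (simp add: norm_vec_def L2_set_def sum_nonneg)
  then show "integrable M (\<lambda>x. (norm (f x))\<^sup>2)"
    using assms by (auto simp: L2_def)
qed

lemma L2_nn_integral:
  "L2 M f \<Longrightarrow> (\<integral>\<^sup>+x. ennreal ((norm (f x))\<^sup>2) \<partial>M) = ennreal (\<integral>x. (norm (f x))\<^sup>2 \<partial>M)"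
  by (intro nn_integral_eq_integral) (auto simp: L2_def)

lemma L2_of_nn_integral:
  assumes "f \<in> borel_measurable M" "(\<integral>\<^sup>+x. ennreal ((norm (f x))\<^sup>2) \<partial>M) < \<infinity>"
  shows "L2 M f"
  using assms by (auto simp: L2_def integrable_iff_bounded)

lemma L2_distr:
  assumes "X \<in> M \<rightarrow>\<^sub>M N" "f \<in> borel_measurable N"
  shows "L2 (distr M N X) f \<longleftrightarrow> L2 M (\<lambda>x. f (X x))"
  using assms by (auto simp: L2_def integrable_distr_eq)

section \<open>Laws, couplings and upper bounds for the Wasserstein distance\<close>

lemma (in prob_space) law_in_P2: "L2 M X \<Longrightarrow> distr M borel X \<in> P2"
  by (auto simp: P2_def L2_def prob_space_distr integrable_distr_eq)

lemma law_P2_L2: "X \<in> borel_measurable M \<Longrightarrow> distr M borel X \<in> P2 \<Longrightarrow> L2 M X"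
  by (auto simp: P2_def L2_def integrable_distr_eq)

lemma second_moment_law: "X \<in> borel_measurable M \<Longrightarrow>
    second_moment (distr M borel X) = (\<integral>\<omega>. (norm (X \<omega>))\<^sup>2 \<partial>M)"
  by (auto simp: second_moment_def integral_distr)

text \<open>Squaring undoes the root only for a nonnegative infimum, and an infimum over an empty
  set of reals has no known sign; hence the nonemptiness hypothesis.\<close>

lemma W2_sq:
  assumes "couplings \<mu> \<nu> \<noteq> {}"
  shows "(W2 \<mu> \<nu>)\<^sup>2 = (INF \<gamma>\<in>couplings \<mu> \<nu>. \<integral>p. (norm (fst p - snd p))\<^sup>2 \<partial>\<gamma>)"
proof -
  have "0 \<le> (INF \<gamma>\<in>couplings \<mu> \<nu>. \<integral>p. (norm (fst p - snd p))\<^sup>2 \<partial>\<gamma>)"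
    using assms by (intro cINF_greatest) auto
  then show ?thesis by (simp add: W2_def)
qed

lemma (in prob_space) joint_law_coupling:
  assumes [measurable]: "X \<in> borel_measurable M" "Y \<in> borel_measurable M"
  shows "distr M borel (\<lambda>\<omega>. (X \<omega>, Y \<omega>)) \<in> couplings (distr M borel X) (distr M borel Y)"
  unfolding couplings_def
  by (auto simp: prob_space_distr distr_distr comp_def borel_measurable_continuous_onI continuous_on_fst continuous_on_snd continuous_on_id)

text \<open>The joint law is one candidate in the infimum. Every estimate of \<open>W2\<close> below
  comes from this: in Assumptions 2 and 3 the distance occurs only in upper bounds with nonnegative
  coefficients, so bounds from above are enough.\<close>

lemma (in prob_space) W2_law_le:
  fixes X Y :: "'a \<Rightarrow> 'b::euclidean_space"
  assumes [measurable]: "X \<in> borel_measurable M" "Y \<in> borel_measurable M"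
  shows "(W2 (distr M borel X) (distr M borel Y))\<^sup>2 \<le> (\<integral>\<omega>. (norm (X \<omega> - Y \<omega>))\<^sup>2 \<partial>M)"
proof -
  note c = joint_law_coupling[OF assms]
  then have ne: "couplings (distr M borel X) (distr M borel Y) \<noteq> {}" by auto
  have m: "(\<lambda>p. (norm (fst p - snd p :: 'b))\<^sup>2) \<in> borel_measurable borel"
    by (intro borel_measurable_continuous_onI continuous_intros)
  have "(W2 (distr M borel X) (distr M borel Y))\<^sup>2
      \<le> (\<integral>p. (norm (fst p - snd p))\<^sup>2 \<partial>distr M borel (\<lambda>\<omega>. (X \<omega>, Y \<omega>)))"
    unfolding W2_sq[OF ne] by (intro cINF_lower[OF _ c] bdd_belowI2[of _ 0]) auto
  also have "\<dots> = (\<integral>\<omega>. (norm (X \<omega> - Y \<omega>))\<^sup>2 \<partial>M)"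
    using m by (subst integral_distr) auto
  finally show ?thesis .
qed

lemma W2_same: assumes "\<mu> \<in> P2" shows "W2 \<mu> \<mu> = 0"
proof -
  interpret prob_space \<mu> using assms by (auto simp: P2_def)
  have s: "sets \<mu> = sets borel" using assms by (auto simp: P2_def)
  then have "distr \<mu> borel (\<lambda>x. x) = \<mu>" by (metis distr_id2)
  moreover have "(\<lambda>x. x) \<in> borel_measurable \<mu>" using s by (simp cong: measurable_cong_sets)
  \<comment> \<open>The identity on \<open>\<mu>\<close> itself, paired with itself, has cost
    0.\<close>
  ultimately show ?thesis using W2_law_le[of "\<lambda>x. x" "\<lambda>x. x"] by simp
qed


section \<open>Independent Gaussian noise and one Euler step\<close>

lemma L2_sum:
  assumes "finite_measure M" "\<And>i. i \<in> I \<Longrightarrow> L2 M (f i)"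
  shows "L2 M (\<lambda>x. \<Sum>i\<in>I. f i x)"
  using assms(2)
  by (induction I rule: infinite_finite_induct) (auto intro!: L2_add L2_const assms(1))

text \<open>Applied at a fixed law, where the Wasserstein term of the Lipschitz bound vanishes, this
  makes the coefficients continuous and hence Borel functions of the state.\<close>

lemma continuous_of_sq_lipschitz:
  fixes f :: "'a::real_normed_vector \<Rightarrow> 'b::real_normed_vector"
  assumes "\<And>x y. (norm (f x - f y))\<^sup>2 \<le> K * (norm (x - y))\<^sup>2" and K: "K \<ge> 0"
  shows "continuous_on UNIV f"
proof (rule lipschitz_on_continuous_on[where L="sqrt K"], rule lipschitz_onI)
  fix x y
  have "(norm (f x - f y))\<^sup>2 \<le> (sqrt K * norm (x - y))\<^sup>2"
    using assms by (simp add: power_mult_distrib)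
  then show "dist (f x) (f y) \<le> sqrt K * dist x y"
    using power2_le_imp_le K by (auto simp: dist_norm)
qed (use K in auto)

lemma continuous_on_matrix_vector_mult:
  fixes A :: "'a::topological_space \<Rightarrow> real^'n^'m"
  assumes "continuous_on S A" "continuous_on S x"
  shows "continuous_on S (\<lambda>t. A t *v x t)"
  unfolding matrix_vector_mult_def
  by (intro continuous_intros continuous_on_component assms)

lemma borel_measurable_matrix_vector_mult:
  fixes A :: "'a \<Rightarrow> real^'n^'m"
  assumes "A \<in> borel_measurable N" "x \<in> borel_measurable N"
  shows "(\<lambda>\<omega>. A \<omega> *v x \<omega>) \<in> borel_measurable N"
proof -
  have "(\<lambda>p. fst p *v snd p) \<in> borel_measurable (borel :: ((real^'n^'m) \<times> (real^'n)) measure)"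
    by (intro borel_measurable_continuous_onI continuous_on_matrix_vector_mult continuous_intros)
  then show ?thesis
    using measurable_compose[OF measurable_Pair[OF assms], of "\<lambda>p. fst p *v snd p" borel]
    by (simp add: borel_prod)
qed

lemma tendsto_matrix_vector_mult:
  fixes A :: "'a \<Rightarrow> real^'n^'m"
  assumes "(A \<longlongrightarrow> B) F" "(x \<longlongrightarrow> y) F"
  shows "((\<lambda>t. A t *v x t) \<longlongrightarrow> B *v y) F"
  unfolding matrix_vector_mult_def
  by (intro tendsto_intros tendsto_vec_lambda tendsto_vec_nth assms)

lemma borel_measurable_entry:
  fixes f :: "'a \<Rightarrow> ('b::real_normed_vector)^'n"
  assumes "f \<in> borel_measurable N"
  shows "(\<lambda>x. f x $ i) \<in> borel_measurable N"
proof (rule measurable_compose[OF assms])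
  show "(\<lambda>y::'b^'n. y $ i) \<in> borel_measurable borel"
    by (intro borel_measurable_continuous_onI continuous_on_component continuous_on_id)
qed

text \<open>\<open>G\<close> is the past and \<open>\<xi>\<close> the noise of one step. Brownian
  increments and the first coordinate of an i.i.d. sequence are both instances, so the one-step
  estimates serve the given space and the auxiliary one alike.\<close>

locale gaussian_noise = prob_space M for M :: "'w measure" +
  fixes G :: "'w measure" and \<xi> :: "'w \<Rightarrow> real^'d" and v :: real
  assumes sub: "subalgebra M G"
    and \<xi>_meas [measurable]: "\<xi> \<in> borel_measurable M"
    and \<xi>_law: "distr M borel \<xi> = isotropic_normal v"
    and v_pos: "v > 0"
    and indep: "\<And>A B. A \<in> sets G \<Longrightarrow> B \<in> sets borel \<Longrightarrow>
        prob (A \<inter> (\<xi> -` B \<inter> space M)) = prob A * prob (\<xi> -` B \<inter> space M)"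
begin

lemma G_measurable: "f \<in> measurable G N \<Longrightarrow> f \<in> measurable M N"
  using sub by (rule measurable_from_subalg)

text \<open>Both generated sigma-algebras lie inside families known to be independent,
  \<open>sets G\<close> and the preimages under \<open>\<xi>\<close>. These are sigma-algebras
  already, so monotonicity suffices.\<close>

lemma indep_var_noise:
  assumes g: "g \<in> measurable G N" and f: "f \<in> measurable borel N'"
  shows "indep_var N g N' (\<lambda>\<omega>. f (\<xi> \<omega>))"
proof -
  have "{g -` A \<inter> space M |A. A \<in> sets N} \<subseteq> sets G"
    using g sub by (auto simp: subalgebra_def dest: measurable_sets)
  then have 1: "sigma_sets (space M) {g -` A \<inter> space M |A. A \<in> sets N} \<subseteq> sets G"
    using sub by (metis (no_types, lifting) sets.sigma_sets_subset subalgebra_def)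
  have "(\<lambda>\<omega>. f (\<xi> \<omega>)) \<in> measurable (vimage_algebra (space M) \<xi> borel) N'"
    by (rule measurable_compose[OF measurable_vimage_algebra1 f]) auto
  then have "{(\<lambda>\<omega>. f (\<xi> \<omega>)) -` A \<inter> space M |A. A \<in> sets N'}
      \<subseteq> sets (vimage_algebra (space M) \<xi> borel)"
    by (auto dest: measurable_sets)
  then have "sigma_sets (space M) {(\<lambda>\<omega>. f (\<xi> \<omega>)) -` A \<inter> space M |A. A \<in> sets N'}
      \<subseteq> sets (vimage_algebra (space M) \<xi> borel)"
    by (metis (no_types, lifting) sets.sigma_sets_subset space_vimage_algebra)
  then have 2: "sigma_sets (space M) {(\<lambda>\<omega>. f (\<xi> \<omega>)) -` A \<inter> space M |A. A \<in> sets N'}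
      \<subseteq> {\<xi> -` A \<inter> space M |A. A \<in> sets borel}"
    by (subst (asm) sets_vimage_algebra2) auto
  have "sets G \<subseteq> events" "{\<xi> -` A \<inter> space M |A. A \<in> sets borel} \<subseteq> events"
    using sub by (auto simp: subalgebra_def)
  then have "indep_set (sets G) {\<xi> -` A \<inter> space M |A. A \<in> sets borel}"
    unfolding indep_sets2_eq using indep by auto
  then have "indep_set (sigma_sets (space M) {g -` A \<inter> space M |A. A \<in> sets N})
      (sigma_sets (space M) {(\<lambda>\<omega>. f (\<xi> \<omega>)) -` A \<inter> space M |A. A \<in> sets N'})"
    unfolding indep_set_def by (rule indep_sets_mono_sets) (use 1 2 in \<open>auto split: bool.split\<close>)
  then show ?thesis
    unfolding indep_var_eq
    using measurable_compose[OF \<xi>_meas f] G_measurable[OF g] by simp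
qed

lemma noise_factor:
  fixes g :: "'w \<Rightarrow> real" and f :: "real^'d \<Rightarrow> real"
  assumes g: "g \<in> borel_measurable G" and gi: "integrable M g"
    and f: "f \<in> borel_measurable borel" and fi: "integrable (isotropic_normal v) f"
  shows "integrable M (\<lambda>\<omega>. g \<omega> * f (\<xi> \<omega>))"
    and "(\<integral>\<omega>. g \<omega> * f (\<xi> \<omega>) \<partial>M) = (\<integral>\<omega>. g \<omega> \<partial>M) * (\<integral>x. f x \<partial>isotropic_normal v)"
proof -
  note iv = indep_var_noise[OF g f]
  have fi': "integrable M (\<lambda>\<omega>. f (\<xi> \<omega>))"
    using fi f unfolding \<xi>_law[symmetric] by (subst (asm) integrable_distr_eq) auto
  show "integrable M (\<lambda>\<omega>. g \<omega> * f (\<xi> \<omega>))"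
    by (rule indep_var_integrable[OF iv gi fi'])
  show "(\<integral>\<omega>. g \<omega> * f (\<xi> \<omega>) \<partial>M) = (\<integral>\<omega>. g \<omega> \<partial>M) * (\<integral>x. f x \<partial>isotropic_normal v)"
    using indep_var_lebesgue_integral[OF iv gi fi'] f
    unfolding \<xi>_law[symmetric] by (subst integral_distr) auto
qed

text \<open>The square of an entry of \<open>A\<close> times a noise coordinate is an integrable
  function of the past times a function of the noise. By independence second moments of
  \<open>A\<close> are enough, where a Hoelder estimate would ask for higher ones.\<close>

lemma matvec_L2:
  fixes A :: "'w \<Rightarrow> real^'d^'d"
  assumes A: "L2 M A" "A \<in> borel_measurable G"
  shows "L2 M (\<lambda>\<omega>. A \<omega> *v \<xi> \<omega>)"
proof (rule L2_vecI)
  fix i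
  have AG: "(\<lambda>\<omega>. A \<omega> $ i $ j) \<in> borel_measurable G" for j
    using A(2) by (intro borel_measurable_entry)
  have "L2 M (\<lambda>\<omega>. A \<omega> $ i $ j * \<xi> \<omega> $ j)" for j
    unfolding L2_def
  proof
    show "(\<lambda>\<omega>. A \<omega> $ i $ j * \<xi> \<omega> $ j) \<in> borel_measurable M"
      by (intro borel_measurable_times G_measurable[OF AG] borel_measurable_entry \<xi>_meas)
    have m: "(\<lambda>\<omega>. (A \<omega> $ i $ j)\<^sup>2) \<in> borel_measurable G"
      using AG by measurable
    have "integrable M (\<lambda>\<omega>. (A \<omega> $ i $ j)\<^sup>2)"
      using L2_nth_nth[OF A(1)] by (auto simp: L2_def)
    from noise_factor(1)[OF m this _ isotropic_normal_moments(3)[OF v_pos, of j j]]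
    show "integrable M (\<lambda>\<omega>. (norm (A \<omega> $ i $ j * \<xi> \<omega> $ j))\<^sup>2)"
      by (simp add: power_mult_distrib power2_eq_square mult_ac)
  qed
  then have "L2 M (\<lambda>\<omega>. \<Sum>j\<in>UNIV. A \<omega> $ i $ j * \<xi> \<omega> $ j)"
    by (intro L2_sum finite_measure_axioms)
  then show "L2 M (\<lambda>\<omega>. (A \<omega> *v \<xi> \<omega>) $ i)"
    by (simp add: matrix_vector_mult_def)
qed

text \<open>After expansion into entries the covariance of the noise leaves only the terms with
  \<open>j = k\<close>, which form the Hilbert-Schmidt inner product. The bilinear form is what the
  isometry for overlapping intervals uses later.\<close>

lemma noise_inner:
  fixes A B :: "'w \<Rightarrow> real^'d^'d"
  assumes A: "L2 M A" "A \<in> borel_measurable G" and B: "L2 M B" "B \<in> borel_measurable G"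
  shows "(\<integral>\<omega>. (A \<omega> *v \<xi> \<omega>) \<bullet> (B \<omega> *v \<xi> \<omega>) \<partial>M) = v * (\<integral>\<omega>. A \<omega> \<bullet> B \<omega> \<partial>M)"
proof -
  have AG: "(\<lambda>\<omega>. A \<omega> $ i $ j * B \<omega> $ i $ k) \<in> borel_measurable G" for i j k
    using A(2) B(2) by (intro borel_measurable_times borel_measurable_entry)
  have AB: "integrable M (\<lambda>\<omega>. A \<omega> $ i $ j * B \<omega> $ i $ k)" for i j k
    by (intro L2_mult L2_nth_nth A B)
  note nf = noise_factor[OF AG AB, of "\<lambda>x. x $ j * x $ k" for j k,
      OF _ isotropic_normal_moments(3)[OF v_pos], unfolded isotropic_normal_moments(4)[OF v_pos]]
  have "(\<integral>\<omega>. (A \<omega> *v \<xi> \<omega>) \<bullet> (B \<omega> *v \<xi> \<omega>) \<partial>M)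
      = (\<integral>\<omega>. (\<Sum>i\<in>UNIV. \<Sum>j\<in>UNIV. \<Sum>k\<in>UNIV. (A \<omega> $ i $ j * B \<omega> $ i $ k) * (\<xi> \<omega> $ j * \<xi> \<omega> $ k)) \<partial>M)"
    by (intro Bochner_Integration.integral_cong)
      (auto simp: inner_vec_def matrix_vector_mult_def sum_product algebra_simps)
  also have "\<dots> = (\<Sum>i\<in>UNIV. \<Sum>j\<in>UNIV. \<Sum>k\<in>UNIV. (\<integral>\<omega>. A \<omega> $ i $ j * B \<omega> $ i $ k \<partial>M) * (if j = k then v else 0))"
    using nf by simp
  also have "\<dots> = v * (\<Sum>i\<in>UNIV. \<Sum>j\<in>UNIV. (\<integral>\<omega>. A \<omega> $ i $ j * B \<omega> $ i $ j \<partial>M))"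
    by (simp add: sum_distrib_left mult.commute if_distrib cong: if_cong)
  also have "(\<Sum>i\<in>UNIV. \<Sum>j\<in>UNIV. (\<integral>\<omega>. A \<omega> $ i $ j * B \<omega> $ i $ j \<partial>M)) = (\<integral>\<omega>. A \<omega> \<bullet> B \<omega> \<partial>M)"
    using AB by (simp add: inner_vec_def)
  finally show ?thesis .
qed

lemma noise_orthogonal:
  fixes U :: "'w \<Rightarrow> real^'d" and A :: "'w \<Rightarrow> real^'d^'d"
  assumes U: "L2 M U" "U \<in> borel_measurable G" and A: "L2 M A" "A \<in> borel_measurable G"
  shows "(\<integral>\<omega>. U \<omega> \<bullet> (A \<omega> *v \<xi> \<omega>) \<partial>M) = 0"
proof -
  have AG: "(\<lambda>\<omega>. U \<omega> $ i * A \<omega> $ i $ j) \<in> borel_measurable G" for i j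
    using U(2) A(2) by (intro borel_measurable_times borel_measurable_entry)
  have UA: "integrable M (\<lambda>\<omega>. U \<omega> $ i * A \<omega> $ i $ j)" for i j
    by (intro L2_mult L2_nth_nth L2_nth U A)
  note nf = noise_factor[OF AG UA, of "\<lambda>x. x $ j" for j,
      OF _ isotropic_normal_moments(1)[OF v_pos], unfolded isotropic_normal_moments(2)[OF v_pos]]
  have "(\<integral>\<omega>. U \<omega> \<bullet> (A \<omega> *v \<xi> \<omega>) \<partial>M)
      = (\<integral>\<omega>. (\<Sum>i\<in>UNIV. \<Sum>j\<in>UNIV. (U \<omega> $ i * A \<omega> $ i $ j) * \<xi> \<omega> $ j) \<partial>M)"
    by (intro Bochner_Integration.integral_cong)
      (auto simp: inner_vec_def matrix_vector_mult_def sum_distrib_left algebra_simps)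
  also have "\<dots> = 0"
    using nf by simp
  finally show ?thesis .
qed

text \<open>Pythagoras: the cross term vanishes because the noise is centred and independent of
  \<open>U\<close> and \<open>A\<close>.\<close>

lemma norm_sq_add_noise:
  fixes U :: "'w \<Rightarrow> real^'d" and A :: "'w \<Rightarrow> real^'d^'d"
  assumes U: "L2 M U" "U \<in> borel_measurable G" and A: "L2 M A" "A \<in> borel_measurable G"
  shows "(\<integral>\<omega>. (norm (U \<omega> + A \<omega> *v \<xi> \<omega>))\<^sup>2 \<partial>M)
       = (\<integral>\<omega>. (norm (U \<omega>))\<^sup>2 \<partial>M) + v * (\<integral>\<omega>. (norm (A \<omega>))\<^sup>2 \<partial>M)"
proof -
  note N = matvec_L2[OF A]
  have "(\<integral>\<omega>. (norm (U \<omega> + A \<omega> *v \<xi> \<omega>))\<^sup>2 \<partial>M)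
      = (\<integral>\<omega>. (norm (U \<omega>))\<^sup>2 + 2 * (U \<omega> \<bullet> (A \<omega> *v \<xi> \<omega>)) + (A \<omega> *v \<xi> \<omega>) \<bullet> (A \<omega> *v \<xi> \<omega>) \<partial>M)"
    by (intro Bochner_Integration.integral_cong)
      (auto simp: power2_norm_eq_inner inner_left_distrib inner_right_distrib inner_commute)
  also have "\<dots> = (\<integral>\<omega>. (norm (U \<omega>))\<^sup>2 \<partial>M) + v * (\<integral>\<omega>. A \<omega> \<bullet> A \<omega> \<partial>M)"
    using L2_inner[OF U(1) N] L2_inner[OF N N] L2_integrable_norm_sq[OF U(1)]
      noise_orthogonal[OF U A] noise_inner[OF A A] by simp
  finally show ?thesis by (simp add: power2_norm_eq_inner)
qed

text \<open>By independence the joint law of state and noise is a product, so the law of a step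
  depends on the state only through its law and not on the underlying space. This carries a fixed
  law from one probability space to another.\<close>

lemma distr_noise:
  fixes X :: "'w \<Rightarrow> real^'d"
  assumes X: "X \<in> borel_measurable G" and f: "f \<in> borel_measurable (borel \<Otimes>\<^sub>M borel)"
  shows "distr M borel (\<lambda>\<omega>. f (X \<omega>, \<xi> \<omega>)) = distr (distr M borel X \<Otimes>\<^sub>M isotropic_normal v) borel f"
proof -
  have "distr M borel X \<Otimes>\<^sub>M isotropic_normal v = distr M (borel \<Otimes>\<^sub>M borel) (\<lambda>\<omega>. (X \<omega>, \<xi> \<omega>))"
    using indep_var_noise[OF X, of "\<lambda>x. x" borel] unfolding indep_var_distribution_eq \<xi>_law by simp
  moreover have "(\<lambda>\<omega>. (X \<omega>, \<xi> \<omega>)) \<in> M \<rightarrow>\<^sub>M borel \<Otimes>\<^sub>M borel"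
    using G_measurable[OF X] by measurable
  ultimately show ?thesis
    using f by (simp add: distr_distr comp_def)
qed

end

text \<open>The law is a separate argument: for a fixed law in \<open>P2\<close> the step is a
  continuous function of state and noise, which makes product laws and pathwise limits
  accessible.\<close>

definition euler_step ::
    "(real^'d \<Rightarrow> (real^'d) measure \<Rightarrow> real^'d) \<Rightarrow> (real^'d \<Rightarrow> (real^'d) measure \<Rightarrow> real^'d^'d) \<Rightarrow>
     real \<Rightarrow> (real^'d) measure \<Rightarrow> real^'d \<Rightarrow> real^'d \<Rightarrow> real^'d" where
  "euler_step b \<sigma> h \<mu> x z = x + h *\<^sub>R b x \<mu> + \<sigma> x \<mu> *v z"

section \<open>Coefficient bounds and pointwise estimates for one step\<close>

locale mv_coefficients =
  fixes b :: "real^'d \<Rightarrow> (real^'d) measure \<Rightarrow> real^'d"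
    and \<sigma> :: "real^'d \<Rightarrow> (real^'d) measure \<Rightarrow> real^'d^'d"
    and \<alpha> \<beta> \<gamma> \<kappa> \<rho> c0 a bbar :: real
  assumes a2: "assumption2 b \<sigma> \<alpha> \<beta> \<gamma> \<kappa> \<rho>"
    and a3: "assumption3 b \<sigma> c0 a bbar"
begin

lemma parameters: "\<alpha> > \<beta>" "\<beta> \<ge> 0" "\<gamma> > \<kappa>" "\<kappa> \<ge> 0" "\<rho> > 0" "c0 > 0" "a > 0" "bbar > 0"
  using a2 a3 by (auto simp: assumption2_def assumption3_def)

lemma monotone:
  "\<mu> \<in> P2 \<Longrightarrow> \<nu> \<in> P2 \<Longrightarrow> 2 * ((b x \<mu> - b y \<nu>) \<bullet> (x - y)) + (norm (\<sigma> x \<mu> - \<sigma> y \<nu>))\<^sup>2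
          \<le> - \<alpha> * (norm (x - y))\<^sup>2 + \<beta> * (W2 \<mu> \<nu>)\<^sup>2"
  and dissipative: "\<mu> \<in> P2 \<Longrightarrow> 2 * (b x \<mu> \<bullet> x) + (1 + \<rho>) * (norm (\<sigma> x \<mu>))\<^sup>2
          \<le> - \<gamma> * (norm x)\<^sup>2 + \<kappa> * (1 + \<rho> + second_moment \<mu>)"
  using a2 by (auto simp: assumption2_def)

lemma growth:
  assumes "\<mu> \<in> P2"
  shows "(norm (b x \<mu>))\<^sup>2 \<le> c0 * (1 + (norm x)\<^sup>2 + second_moment \<mu>)"
    and "(norm (\<sigma> x \<mu>))\<^sup>2 \<le> c0 * (1 + (norm x)\<^sup>2 + second_moment \<mu>)"
  using a3 assms by (auto simp: assumption3_def)

lemma lipschitz: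
  assumes "\<mu> \<in> P2" "\<nu> \<in> P2"
  shows "(norm (b x \<mu> - b y \<nu>))\<^sup>2 \<le> a * (norm (x - y))\<^sup>2 + bbar * (W2 \<mu> \<nu>)\<^sup>2"
    and "(norm (\<sigma> x \<mu> - \<sigma> y \<nu>))\<^sup>2 \<le> a * (norm (x - y))\<^sup>2 + bbar * (W2 \<mu> \<nu>)\<^sup>2"
  using a3 assms by (auto simp: assumption3_def)

lemma continuous_coefficients:
  assumes "\<mu> \<in> P2"
  shows "continuous_on UNIV (\<lambda>x. b x \<mu>)" "continuous_on UNIV (\<lambda>x. \<sigma> x \<mu>)"
  using lipschitz[OF assms assms] parameters
  by (auto intro!: continuous_of_sq_lipschitz[where K=a] simp: W2_same[OF assms])

lemma measurable_coefficients:
  assumes "\<mu> \<in> P2"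
  shows "(\<lambda>x. b x \<mu>) \<in> borel_measurable borel" "(\<lambda>x. \<sigma> x \<mu>) \<in> borel_measurable borel"
  using continuous_coefficients[OF assms] by (auto intro: borel_measurable_continuous_onI)

lemma L2_coefficients:
  assumes "prob_space M" and X: "L2 M X" and \<mu>: "\<mu> \<in> P2"
  shows "L2 M (\<lambda>\<omega>. b (X \<omega>) \<mu>)" "L2 M (\<lambda>\<omega>. \<sigma> (X \<omega>) \<mu>)"
proof -
  interpret prob_space M by fact
  have "integrable M (\<lambda>\<omega>. c0 * (1 + (norm (X \<omega>))\<^sup>2 + second_moment \<mu>))"
    using X by (auto simp: L2_def)
  note * = L2_bound[OF _ this]
  show "L2 M (\<lambda>\<omega>. b (X \<omega>) \<mu>)" "L2 M (\<lambda>\<omega>. \<sigma> (X \<omega>) \<mu>)"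
    by (rule *[OF measurable_compose[OF L2_measurable[OF X] measurable_coefficients(1)[OF \<mu>]]
          growth(1)[OF \<mu>]])
      (rule *[OF measurable_compose[OF L2_measurable[OF X] measurable_coefficients(2)[OF \<mu>]]
          growth(2)[OF \<mu>]])
qed

lemma measurable_euler_step:
  assumes "\<mu> \<in> P2"
  shows "(\<lambda>(x, z). euler_step b \<sigma> h \<mu> x z) \<in> borel_measurable (borel \<Otimes>\<^sub>M borel)"
proof -
  have "continuous_on UNIV (\<lambda>p. euler_step b \<sigma> h \<mu> (fst p) (snd p))"
    unfolding euler_step_def
    by (intro continuous_intros continuous_on_compose2[OF continuous_coefficients(1)[OF assms]]
        continuous_on_compose2[OF continuous_coefficients(2)[OF assms]]
        continuous_on_matrix_vector_mult) auto
  then show ?thesis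
    unfolding borel_prod case_prod_beta by (rule borel_measurable_continuous_onI)
qed

text \<open>The summand \<open>h * (norm (\<sigma> x \<mu> - \<sigma> y \<nu>))\<^sup>2\<close>
  anticipates the variance of the noise part. With the cross term of the squared drift step it forms
  \<open>h\<close> times the left side of the monotonicity condition; only the squared drift
  difference, of weight \<open>h\<^sup>2\<close>, is left to the Lipschitz bound.\<close>

lemma drift_step_contraction:
  assumes P: "\<mu> \<in> P2" "\<nu> \<in> P2" and h: "h > 0"
  shows "(norm ((x + h *\<^sub>R b x \<mu>) - (y + h *\<^sub>R b y \<nu>)))\<^sup>2 + h * (norm (\<sigma> x \<mu> - \<sigma> y \<nu>))\<^sup>2
      \<le> (1 - \<alpha> * h + a * h\<^sup>2) * (norm (x - y))\<^sup>2 + (\<beta> * h + bbar * h\<^sup>2) * (W2 \<mu> \<nu>)\<^sup>2"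
proof -
  have "(norm ((x + h *\<^sub>R b x \<mu>) - (y + h *\<^sub>R b y \<nu>)))\<^sup>2
      = (norm ((x - y) + h *\<^sub>R (b x \<mu> - b y \<nu>)))\<^sup>2"
    by (simp add: algebra_simps)
  also have "\<dots> = (norm (x - y))\<^sup>2 + h * (2 * ((b x \<mu> - b y \<nu>) \<bullet> (x - y))) + h\<^sup>2 * (norm (b x \<mu> - b y \<nu>))\<^sup>2"
    unfolding power2_norm_eq_inner by (simp add: inner_left_distrib inner_right_distrib inner_commute
        power2_eq_square)
  finally have "(norm ((x + h *\<^sub>R b x \<mu>) - (y + h *\<^sub>R b y \<nu>)))\<^sup>2 + h * (norm (\<sigma> x \<mu> - \<sigma> y \<nu>))\<^sup>2
     = (norm (x - y))\<^sup>2 + h * (2 * ((b x \<mu> - b y \<nu>) \<bullet> (x - y)) + (norm (\<sigma> x \<mu> - \<sigma> y \<nu>))\<^sup>2)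
       + h\<^sup>2 * (norm (b x \<mu> - b y \<nu>))\<^sup>2"
    by (simp add: algebra_simps)
  also have "\<dots> \<le> (norm (x - y))\<^sup>2 + h * (- \<alpha> * (norm (x - y))\<^sup>2 + \<beta> * (W2 \<mu> \<nu>)\<^sup>2)
      + h\<^sup>2 * (a * (norm (x - y))\<^sup>2 + bbar * (W2 \<mu> \<nu>)\<^sup>2)"
    by (intro add_mono order_refl mult_left_mono monotone[OF P] lipschitz[OF P]) (use h in auto)
  finally show ?thesis by (simp add: algebra_simps)
qed

lemma drift_step_moment:
  assumes P: "\<mu> \<in> P2" and h: "h > 0"
  shows "(norm (x + h *\<^sub>R b x \<mu>))\<^sup>2 + h * (norm (\<sigma> x \<mu>))\<^sup>2
      \<le> (1 - \<gamma> * h + c0 * h\<^sup>2) * (norm x)\<^sup>2 + (\<kappa> * h + c0 * h\<^sup>2) * second_moment \<mu>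
        + (\<kappa> * (1 + \<rho>) * h + c0 * h\<^sup>2)"
proof -
  have "(norm (x + h *\<^sub>R b x \<mu>))\<^sup>2 = (norm x)\<^sup>2 + h * (2 * (b x \<mu> \<bullet> x)) + h\<^sup>2 * (norm (b x \<mu>))\<^sup>2"
    unfolding power2_norm_eq_inner by (simp add: inner_left_distrib inner_right_distrib inner_commute
        power2_eq_square)
  then have "(norm (x + h *\<^sub>R b x \<mu>))\<^sup>2 + h * (norm (\<sigma> x \<mu>))\<^sup>2
     = (norm x)\<^sup>2 + h * (2 * (b x \<mu> \<bullet> x) + (norm (\<sigma> x \<mu>))\<^sup>2) + h\<^sup>2 * (norm (b x \<mu>))\<^sup>2"
    by (simp add: algebra_simps)
  \<comment> \<open>Dissipativity bounds the noise with weight \<open>1 + \<rho>\<close>, so the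
    noise term is first enlarged to that weight.\<close>
  also have "\<dots> \<le> (norm x)\<^sup>2 + h * (2 * (b x \<mu> \<bullet> x) + (1 + \<rho>) * (norm (\<sigma> x \<mu>))\<^sup>2) + h\<^sup>2 * (norm (b x \<mu>))\<^sup>2"
    using h parameters by (intro add_mono order_refl mult_left_mono) (auto simp: algebra_simps)
  also have "\<dots> \<le> (norm x)\<^sup>2 + h * (- \<gamma> * (norm x)\<^sup>2 + \<kappa> * (1 + \<rho> + second_moment \<mu>))
      + h\<^sup>2 * (c0 * (1 + (norm x)\<^sup>2 + second_moment \<mu>))"
    by (intro add_mono order_refl mult_left_mono dissipative[OF P] growth[OF P]) (use h in auto)
  finally show ?thesis by (simp add: algebra_simps)
qed

end

text \<open>The variance of the noise is the step size: \<open>h\<close> stands in the place of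
  \<open>v\<close>.\<close>

locale mv_noise = mv_coefficients b \<sigma> \<alpha> \<beta> \<gamma> \<kappa> \<rho> c0 a bbar + gaussian_noise M G \<xi> h
  for b :: "real^'d \<Rightarrow> (real^'d) measure \<Rightarrow> real^'d"
    and \<sigma> :: "real^'d \<Rightarrow> (real^'d) measure \<Rightarrow> real^'d^'d"
    and \<alpha> \<beta> \<gamma> \<kappa> \<rho> c0 a bbar
    and M :: "'w measure" and G :: "'w measure" and \<xi> :: "'w \<Rightarrow> real^'d" and h :: real
begin

lemma coefficients_G:
  assumes X: "X \<in> borel_measurable G" and \<mu>: "\<mu> \<in> P2"
  shows "(\<lambda>\<omega>. b (X \<omega>) \<mu>) \<in> borel_measurable G" "(\<lambda>\<omega>. \<sigma> (X \<omega>) \<mu>) \<in> borel_measurable G"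
  using measurable_compose[OF X] measurable_coefficients[OF \<mu>] by auto

lemma drift_step_L2:
  assumes X: "L2 M X" and \<mu>: "\<mu> \<in> P2"
  shows "L2 M (\<lambda>\<omega>. X \<omega> + h *\<^sub>R b (X \<omega>) \<mu>)"
  by (intro L2_add L2_scaleR X L2_coefficients[OF prob_space_axioms X \<mu>])

lemma drift_step_G:
  assumes X: "X \<in> borel_measurable G" and \<mu>: "\<mu> \<in> P2"
  shows "(\<lambda>\<omega>. X \<omega> + h *\<^sub>R b (X \<omega>) \<mu>) \<in> borel_measurable G"
  using X coefficients_G[OF X \<mu>] by measurable

lemma euler_step_L2:
  assumes X: "L2 M X" "X \<in> borel_measurable G" and \<mu>: "\<mu> \<in> P2"
  shows "L2 M (\<lambda>\<omega>. euler_step b \<sigma> h \<mu> (X \<omega>) (\<xi> \<omega>))"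
  unfolding euler_step_def
  by (intro L2_add[OF drift_step_L2[OF X(1) \<mu>]] matvec_L2 L2_coefficients[OF prob_space_axioms X(1) \<mu>]
      coefficients_G X \<mu>)

text \<open>Integrating the pointwise contraction leaves a Wasserstein term, and the pair of
  \<open>X\<close> and \<open>Y\<close> is itself a coupling of the two laws. Drift and noise parts
  stay apart in the statement because the local error analysis treats them separately;
  \<open>euler_step_dist\<close> is the same bound in terms of \<open>euler_step\<close>.\<close>

lemma euler_step_contraction:
  assumes X: "L2 M X" "X \<in> borel_measurable G" and Y: "L2 M Y" "Y \<in> borel_measurable G"
  defines "\<mu> \<equiv> distr M borel X" and "\<nu> \<equiv> distr M borel Y"
  shows "(\<integral>\<omega>. (norm ((X \<omega> + h *\<^sub>R b (X \<omega>) \<mu>) - (Y \<omega> + h *\<^sub>R b (Y \<omega>) \<nu>)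
             + (\<sigma> (X \<omega>) \<mu> - \<sigma> (Y \<omega>) \<nu>) *v \<xi> \<omega>))\<^sup>2 \<partial>M)
       \<le> (1 - (\<alpha> - \<beta>) * h + (a + bbar) * h\<^sup>2) * (\<integral>\<omega>. (norm (X \<omega> - Y \<omega>))\<^sup>2 \<partial>M)"
    (is "_ \<le> ?q * ?E")
proof -
  have P: "\<mu> \<in> P2" "\<nu> \<in> P2" using X Y by (auto simp: \<mu>_def \<nu>_def law_in_P2)
  define U where "U \<omega> = (X \<omega> + h *\<^sub>R b (X \<omega>) \<mu>) - (Y \<omega> + h *\<^sub>R b (Y \<omega>) \<nu>)" for \<omega>
  define A where "A \<omega> = \<sigma> (X \<omega>) \<mu> - \<sigma> (Y \<omega>) \<nu>" for \<omega>
  have U: "L2 M U" "U \<in> borel_measurable G"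
    unfolding U_def using drift_step_L2[OF X(1) P(1)] drift_step_L2[OF Y(1) P(2)]
      drift_step_G[OF X(2) P(1)] drift_step_G[OF Y(2) P(2)]
    by (auto intro!: L2_diff borel_measurable_diff)
  have A: "L2 M A" "A \<in> borel_measurable G"
    unfolding A_def using L2_coefficients[OF prob_space_axioms X(1) P(1)]
      L2_coefficients[OF prob_space_axioms Y(1) P(2)] coefficients_G[OF X(2) P(1)] coefficients_G[OF Y(2) P(2)]
    by (auto intro!: L2_diff borel_measurable_diff)
  have W: "(W2 \<mu> \<nu>)\<^sup>2 \<le> ?E"
    unfolding \<mu>_def \<nu>_def using X(1) Y(1) by (intro W2_law_le) (auto simp: L2_def)
  have "(\<integral>\<omega>. (norm (U \<omega> + A \<omega> *v \<xi> \<omega>))\<^sup>2 \<partial>M)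
      = (\<integral>\<omega>. (norm (U \<omega>))\<^sup>2 + h * (norm (A \<omega>))\<^sup>2 \<partial>M)"
    unfolding norm_sq_add_noise[OF U A] using U A by (simp add: L2_def)
  also have "\<dots> \<le> (\<integral>\<omega>. (1 - \<alpha> * h + a * h\<^sup>2) * (norm (X \<omega> - Y \<omega>))\<^sup>2 + (\<beta> * h + bbar * h\<^sup>2) * (W2 \<mu> \<nu>)\<^sup>2 \<partial>M)"
    using U A L2_diff[OF X(1) Y(1)] unfolding U_def A_def
    by (intro integral_mono drift_step_contraction[OF P v_pos]) (auto simp: L2_def)
  also have "\<dots> = (1 - \<alpha> * h + a * h\<^sup>2) * ?E + (\<beta> * h + bbar * h\<^sup>2) * (W2 \<mu> \<nu>)\<^sup>2"
    using L2_diff[OF X(1) Y(1)] by (simp add: L2_def prob_space)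
  \<comment> \<open>Here \<open>\<beta>\<close> and \<open>bbar\<close> join \<open>\<alpha>\<close>
    and \<open>a\<close>: the coefficient of the Wasserstein term is nonnegative.\<close>
  also have "\<dots> \<le> (1 - \<alpha> * h + a * h\<^sup>2) * ?E + (\<beta> * h + bbar * h\<^sup>2) * ?E"
    using parameters v_pos by (intro add_left_mono mult_left_mono W) auto
  finally show ?thesis by (simp add: U_def A_def algebra_simps)
qed

lemma euler_step_dist:
  assumes X: "L2 M X" "X \<in> borel_measurable G" and Y: "L2 M Y" "Y \<in> borel_measurable G"
  defines "\<mu> \<equiv> distr M borel X" and "\<nu> \<equiv> distr M borel Y"
  shows "(\<integral>\<omega>. (norm (euler_step b \<sigma> h \<mu> (X \<omega>) (\<xi> \<omega>) - euler_step b \<sigma> h \<nu> (Y \<omega>) (\<xi> \<omega>)))\<^sup>2 \<partial>M)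
       \<le> (1 - (\<alpha> - \<beta>) * h + (a + bbar) * h\<^sup>2) * (\<integral>\<omega>. (norm (X \<omega> - Y \<omega>))\<^sup>2 \<partial>M)"
  using euler_step_contraction[OF X Y]
  by (simp add: euler_step_def \<mu>_def \<nu>_def matrix_vector_mult_diff_rdistrib algebra_simps)

text \<open>After integration the second moment of the law is that of \<open>X\<close>. So
  \<open>\<kappa>\<close> is set against \<open>\<gamma>\<close>, and the two growth terms
  \<open>c0 * h\<^sup>2\<close> add up to the \<open>2 * c0 * h\<^sup>2\<close> by which the first
  step-size threshold is chosen.\<close>

lemma euler_step_moment:
  assumes X: "L2 M X" "X \<in> borel_measurable G"
  defines "\<mu> \<equiv> distr M borel X"
  shows "(\<integral>\<omega>. (norm (euler_step b \<sigma> h \<mu> (X \<omega>) (\<xi> \<omega>)))\<^sup>2 \<partial>M)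
       \<le> (1 - (\<gamma> - \<kappa>) * h + 2 * c0 * h\<^sup>2) * (\<integral>\<omega>. (norm (X \<omega>))\<^sup>2 \<partial>M) + (\<kappa> * (1 + \<rho>) * h + c0 * h\<^sup>2)"
proof -
  have P: "\<mu> \<in> P2" using X by (auto simp: \<mu>_def law_in_P2)
  have m: "second_moment \<mu> = (\<integral>\<omega>. (norm (X \<omega>))\<^sup>2 \<partial>M)"
    unfolding \<mu>_def using X by (simp add: second_moment_law L2_def)
  note U = drift_step_L2[OF X(1) P] drift_step_G[OF X(2) P]
  note A = L2_coefficients(2)[OF prob_space_axioms X(1) P] coefficients_G(2)[OF X(2) P]
  have "(\<integral>\<omega>. (norm (euler_step b \<sigma> h \<mu> (X \<omega>) (\<xi> \<omega>)))\<^sup>2 \<partial>M)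
      = (\<integral>\<omega>. (norm (X \<omega> + h *\<^sub>R b (X \<omega>) \<mu>))\<^sup>2 + h * (norm (\<sigma> (X \<omega>) \<mu>))\<^sup>2 \<partial>M)"
    unfolding euler_step_def norm_sq_add_noise[OF U A] using U A by (simp add: L2_def)
  also have "\<dots> \<le> (\<integral>\<omega>. (1 - \<gamma> * h + c0 * h\<^sup>2) * (norm (X \<omega>))\<^sup>2 + (\<kappa> * h + c0 * h\<^sup>2) * second_moment \<mu>
        + (\<kappa> * (1 + \<rho>) * h + c0 * h\<^sup>2) \<partial>M)"
    using U A X(1) by (intro integral_mono drift_step_moment[OF P v_pos]) (auto simp: L2_def)
  also have "\<dots> = (1 - \<gamma> * h + c0 * h\<^sup>2) * (\<integral>\<omega>. (norm (X \<omega>))\<^sup>2 \<partial>M) + (\<kappa> * h + c0 * h\<^sup>2) * second_moment \<mu>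
        + (\<kappa> * (1 + \<rho>) * h + c0 * h\<^sup>2)"
    using X(1) by (simp add: L2_def prob_space)
  finally show ?thesis unfolding m by (simp add: algebra_simps)
qed

end


section \<open>Existence of an invariant law\<close>

lemma (in prob_space) expectation_norm_le:
  fixes f :: "'a \<Rightarrow> 'b::euclidean_space"
  assumes f: "L2 M f"
  shows "integrable M (\<lambda>\<omega>. norm (f \<omega>))"
    and "(\<integral>\<omega>. norm (f \<omega>) \<partial>M) \<le> sqrt (\<integral>\<omega>. (norm (f \<omega>))\<^sup>2 \<partial>M)"
proof -
  have m: "(\<lambda>\<omega>. norm (f \<omega>)) \<in> borel_measurable M" using f by (auto simp: L2_def)
  show i: "integrable M (\<lambda>\<omega>. norm (f \<omega>))"
    using square_integrable_imp_integrable[OF m] f by (auto simp: L2_def)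
  \<comment> \<open>Nonnegativity of the variance is the instance of Cauchy-Schwarz needed
    here.\<close>
  have "0 \<le> variance (\<lambda>\<omega>. norm (f \<omega>))" by (rule variance_positive)
  also have "\<dots> = (\<integral>\<omega>. (norm (f \<omega>))\<^sup>2 \<partial>M) - (\<integral>\<omega>. norm (f \<omega>) \<partial>M)\<^sup>2"
    using f i by (intro variance_eq) (auto simp: L2_def)
  finally show "(\<integral>\<omega>. norm (f \<omega>) \<partial>M) \<le> sqrt (\<integral>\<omega>. (norm (f \<omega>))\<^sup>2 \<partial>M)"
    by (intro real_le_rsqrt) simp
qed

lemma borel_measure_eqI_closed:
  fixes \<mu> \<nu> :: "'a::topological_space measure"
  assumes "finite_measure \<mu>" "sets \<mu> = sets borel" "sets \<nu> = sets borel"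
    and eq: "\<And>C. closed C \<Longrightarrow> emeasure \<mu> C = emeasure \<nu> C"
  shows "\<mu> = \<nu>"
proof (rule measure_eqI_generator_eq[where E="Collect closed" and \<Omega>=UNIV and A="\<lambda>_. UNIV"])
  interpret finite_measure \<mu> by fact
  show "sets \<mu> = sigma_sets UNIV (Collect closed)" "sets \<nu> = sigma_sets UNIV (Collect closed)"
    using assms by (auto simp: borel_eq_closed)
  show "emeasure \<mu> UNIV \<noteq> \<infinity>" for i :: nat by simp
qed (auto simp: Int_stable_def eq)

text \<open>This replaces the passage from Wasserstein distance 0 to equality, which would call for
  an optimal coupling. The integral of a bounded Lipschitz function over \<open>X n\<close> or
  \<open>Y n\<close> does not depend on \<open>n\<close>, while the difference of the two is
  controlled by the mean distance; such functions determine the measure of every closed set.\<close>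

lemma (in prob_space) laws_eq_of_L2_dist_tendsto_0:
  fixes X Y :: "nat \<Rightarrow> 'a \<Rightarrow> 'b::euclidean_space"
  assumes X: "\<And>n. L2 M (X n)" "\<And>n. distr M borel (X n) = \<mu>"
    and Y: "\<And>n. L2 M (Y n)" "\<And>n. distr M borel (Y n) = \<nu>"
    and lim: "(\<lambda>n. \<integral>\<omega>. (norm (X n \<omega> - Y n \<omega>))\<^sup>2 \<partial>M) \<longlonglongrightarrow> 0"
  shows "\<mu> = \<nu>"
proof -
  have [measurable]: "X n \<in> borel_measurable M" "Y n \<in> borel_measurable M" for n
    using X Y by (auto simp: L2_def)
  have s: "sets \<mu> = sets borel" "sets \<nu> = sets borel" using X(2)[of 0] Y(2)[of 0] by auto
  interpret \<mu>: prob_space \<mu> using prob_space_distr[of "X 0" borel] X(2)[of 0] by simp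
  interpret \<nu>: prob_space \<nu> using prob_space_distr[of "Y 0" borel] Y(2)[of 0] by simp
  have lip: "(\<integral>x. f x \<partial>\<mu>) = (\<integral>x. f x \<partial>\<nu>)"
    if f: "\<And>x y. \<bar>f x - f y\<bar> \<le> L * norm (x - y)" "\<And>x. \<bar>f x\<bar> \<le> 1" and L: "L \<ge> 0" for f :: "'b \<Rightarrow> real" and L
  proof -
    have "continuous_on UNIV f"
      using L f(1) by (intro lipschitz_on_continuous_on[where L=L] lipschitz_onI) (auto simp: dist_norm)
    then have m [measurable]: "f \<in> borel_measurable borel" by (rule borel_measurable_continuous_onI)
    have i: "integrable M (\<lambda>\<omega>. f (X n \<omega>))" "integrable M (\<lambda>\<omega>. f (Y n \<omega>))" for n
      using f(2) by (auto intro!: integrable_const_bound[where B=1])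
    have "\<bar>(\<integral>x. f x \<partial>\<mu>) - (\<integral>x. f x \<partial>\<nu>)\<bar> \<le> L * sqrt (\<integral>\<omega>. (norm (X n \<omega> - Y n \<omega>))\<^sup>2 \<partial>M)" for n
    proof -
      note d = expectation_norm_le[OF L2_diff[OF X(1) Y(1)]]
      have "(\<integral>x. f x \<partial>\<mu>) - (\<integral>x. f x \<partial>\<nu>) = (\<integral>\<omega>. f (X n \<omega>) - f (Y n \<omega>) \<partial>M)"
        unfolding X(2)[of n, symmetric] Y(2)[of n, symmetric] using i
        by (simp add: integral_distr)
      also have "\<bar>\<dots>\<bar> \<le> (\<integral>\<omega>. \<bar>f (X n \<omega>) - f (Y n \<omega>)\<bar> \<partial>M)"
        by (rule integral_abs_bound)
      also have "\<dots> \<le> (\<integral>\<omega>. L * norm (X n \<omega> - Y n \<omega>) \<partial>M)"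
        using i d(1) f(1) by (intro integral_mono) auto
      also have "\<dots> \<le> L * sqrt (\<integral>\<omega>. (norm (X n \<omega> - Y n \<omega>))\<^sup>2 \<partial>M)"
        using d(2)[of n] L by (simp add: mult_left_mono)
      finally show ?thesis .
    qed
    moreover have "(\<lambda>n. L * sqrt (\<integral>\<omega>. (norm (X n \<omega> - Y n \<omega>))\<^sup>2 \<partial>M)) \<longlonglongrightarrow> L * sqrt 0"
      by (intro tendsto_intros lim)
    ultimately have "\<bar>(\<integral>x. f x \<partial>\<mu>) - (\<integral>x. f x \<partial>\<nu>)\<bar> \<le> L * sqrt 0"
      by (intro LIMSEQ_le_const[of _ "L * sqrt 0"]) auto
    then show ?thesis by simp
  qed
  show ?thesis
  proof (rule borel_measure_eqI_closed[OF \<mu>.finite_measure_axioms s])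
    fix C :: "'b set" assume C: "closed C"
    show "emeasure \<mu> C = emeasure \<nu> C"
    \<comment> \<open>\<open>infdist\<close> to the empty set is 0 by convention, so the functions
      \<open>f m\<close> below would be constantly 1; hence the separate case.\<close>
    proof (cases "C = {}")
      case False
      \<comment> \<open>Equal to 1 on \<open>C\<close>, Lipschitz with constant \<open>m\<close>
        and, as \<open>C\<close> is closed, eventually 0 at each point outside.\<close>
      define f where "f m x = max 0 (1 - real m * infdist x C)" for m x
      have f01: "0 \<le> f m x" "f m x \<le> 1" for m x
        by (auto simp: f_def infdist_nonneg)
      have fm: "f m \<in> borel_measurable borel" for m
        unfolding f_def by (intro borel_measurable_continuous_onI continuous_intros)
      have flip: "\<bar>f m x - f m y\<bar> \<le> real m * norm (x - y)" for m x y
      proof -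
        have "\<bar>infdist x C - infdist y C\<bar> \<le> dist x y"
          using infdist_triangle[of x C y] infdist_triangle[of y C x] by (auto simp: dist_commute)
        then have "real m * \<bar>infdist x C - infdist y C\<bar> \<le> real m * norm (x - y)"
          by (intro mult_left_mono) (auto simp: dist_norm)
        moreover have "\<bar>f m x - f m y\<bar> \<le> \<bar>real m * infdist x C - real m * infdist y C\<bar>"
          unfolding f_def by linarith
        ultimately show ?thesis
          by (simp add: abs_mult right_diff_distrib[symmetric])
      qed
      have flim: "(\<lambda>m. f m x) \<longlonglongrightarrow> indicator C x" for x
      proof (cases "x \<in> C")
        case False
        then have "infdist x C > 0"
          using C \<open>C \<noteq> {}\<close> by (metis in_closed_iff_infdist_zero infdist_nonneg less_eq_real_def)
        then obtain m0 where m0: "real m0 * infdist x C > 1"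
          using ex_less_of_nat_mult by blast
        have "f m x = 0" if "m \<ge> m0" for m
        proof -
          have "real m0 * infdist x C \<le> real m * infdist x C"
            using that by (intro mult_right_mono) (auto simp: infdist_nonneg)
          then show ?thesis using m0 by (simp add: f_def)
        qed
        then have "eventually (\<lambda>m. f m x = 0) sequentially"
          by (auto simp: eventually_sequentially)
        then show ?thesis using False by (auto intro: tendsto_eventually)
      qed (simp add: f_def)
      have conv: "(\<lambda>m. \<integral>x. f m x \<partial>\<rho>) \<longlonglongrightarrow> measure \<rho> C" if \<rho>: "prob_space \<rho>" "sets \<rho> = sets borel" for \<rho>
      proof -
        interpret \<rho>: prob_space \<rho> by fact
        have "(\<lambda>m. \<integral>x. f m x \<partial>\<rho>) \<longlonglongrightarrow> (\<integral>x. indicator C x \<partial>\<rho>)"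
          using fm C f01
          by (intro integral_dominated_convergence[where w="\<lambda>_. 1"] AE_I2 flim)
            (auto simp: measurable_cong_sets[OF \<rho>(2) refl])
        then show ?thesis using C \<rho>(2) sets_eq_imp_space_eq[OF \<rho>(2)] by simp
      qed
      have "(\<integral>x. f m x \<partial>\<mu>) = (\<integral>x. f m x \<partial>\<nu>)" for m
        using f01[of m] by (intro lip[OF flip]) (auto simp: abs_le_iff intro: order_trans[of _ 0])
      then have "measure \<mu> C = measure \<nu> C"
        using conv[OF \<mu>.prob_space_axioms s(1)] conv[OF \<nu>.prob_space_axioms s(2)]
        by (auto intro: LIMSEQ_unique)
      then show ?thesis by (simp add: \<mu>.emeasure_eq_measure \<nu>.emeasure_eq_measure)
    qed simp
  qed
qed

text \<open>The geometric rate makes the expected increments summable, so the whole sequence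
  converges almost surely and not merely a subsequence. Pathwise convergence is needed to pass to
  the limit inside the Euler recursion.\<close>

lemma (in prob_space) L2_limit_of_geometric_cauchy:
  fixes Z :: "nat \<Rightarrow> 'a \<Rightarrow> 'b::euclidean_space"
  assumes Z: "\<And>n. L2 M (Z n)" and q: "0 < q" "q < 1"
    and cauchy: "\<And>n m. (\<integral>\<omega>. (norm (Z (n + m) \<omega> - Z n \<omega>))\<^sup>2 \<partial>M) \<le> K * q ^ n"
  obtains Y where "L2 M Y" "AE \<omega> in M. (\<lambda>n. Z n \<omega>) \<longlonglongrightarrow> Y \<omega>"
    "\<And>n. (\<integral>\<omega>. (norm (Z n \<omega> - Y \<omega>))\<^sup>2 \<partial>M) \<le> K * q ^ n"
proof -
  have Zm [measurable]: "Z n \<in> borel_measurable M" for n using Z by (auto simp: L2_def)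
  define Y where "Y \<omega> = lim (\<lambda>n. Z n \<omega>)" for \<omega>
  have Ym [measurable]: "Y \<in> borel_measurable M" unfolding Y_def by measurable
  have K: "K \<ge> 0" using order_trans[OF integral_nonneg_AE cauchy[of 0 0]] by simp
  have "(\<integral>\<^sup>+\<omega>. (\<Sum>n. ennreal (norm (Z (Suc n) \<omega> - Z n \<omega>))) \<partial>M)
      = (\<Sum>n. \<integral>\<^sup>+\<omega>. ennreal (norm (Z (Suc n) \<omega> - Z n \<omega>)) \<partial>M)"
    by (intro nn_integral_suminf) auto
  \<comment> \<open>Passing from the mean square to the mean replaces \<open>q\<close> by
    \<open>sqrt q\<close>, which is still below 1.\<close>
  also have "\<dots> \<le> (\<Sum>n. ennreal (sqrt K * sqrt q ^ n))"
  proof (intro suminf_le allI)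
    fix n
    note d = expectation_norm_le[OF L2_diff[OF Z[of "Suc n"] Z[of n]]]
    have "(\<integral>\<^sup>+\<omega>. ennreal (norm (Z (Suc n) \<omega> - Z n \<omega>)) \<partial>M)
        = ennreal (\<integral>\<omega>. norm (Z (Suc n) \<omega> - Z n \<omega>) \<partial>M)"
      using d(1) by (intro nn_integral_eq_integral) auto
    also have "\<dots> \<le> ennreal (sqrt (K * q ^ n))"
      using d(2) cauchy[of n 1] by (intro ennreal_leI order_trans[OF d(2)] real_sqrt_le_mono) simp
    finally show "(\<integral>\<^sup>+\<omega>. ennreal (norm (Z (Suc n) \<omega> - Z n \<omega>)) \<partial>M) \<le> ennreal (sqrt K * sqrt q ^ n)"
      by (simp add: real_sqrt_mult real_sqrt_power)
  qed auto
  also have "\<dots> = ennreal (\<Sum>n. sqrt K * sqrt q ^ n)"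
    using q K by (intro suminf_ennreal2 summable_mult summable_geometric) (auto simp: real_sqrt_lt_1_iff)
  also have "\<dots> < \<infinity>" by simp
  finally have "AE \<omega> in M. (\<Sum>n. ennreal (norm (Z (Suc n) \<omega> - Z n \<omega>))) \<noteq> \<infinity>"
    by (intro nn_integral_PInf_AE) auto
  then have conv: "AE \<omega> in M. (\<lambda>n. Z n \<omega>) \<longlonglongrightarrow> Y \<omega>"
  proof eventually_elim
    case (elim \<omega>)
    then have "summable (\<lambda>n. norm (Z (Suc n) \<omega> - Z n \<omega>))"
      by (intro summable_suminf_not_top) auto
    then have "summable (\<lambda>n. Z (Suc n) \<omega> - Z n \<omega>)" by (rule summable_norm_cancel)
    then have "(\<lambda>n. \<Sum>i<n. Z (Suc i) \<omega> - Z i \<omega>) \<longlonglongrightarrow> (\<Sum>i. Z (Suc i) \<omega> - Z i \<omega>)"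
      by (rule summable_LIMSEQ)
    then have "(\<lambda>n. (Z n \<omega> - Z 0 \<omega>) + Z 0 \<omega>) \<longlonglongrightarrow> (\<Sum>i. Z (Suc i) \<omega> - Z i \<omega>) + Z 0 \<omega>"
      unfolding sum_lessThan_telescope[of "\<lambda>i. Z i \<omega>"] by (intro tendsto_add tendsto_const)
    then show ?case
      unfolding Y_def by (simp add: convergent_LIMSEQ_iff[symmetric] convergentI)
  qed
  \<comment> \<open>Fatou's lemma in \<open>m\<close>, for fixed \<open>n\<close>, hands the Cauchy
    estimate over to the limit.\<close>
  have fatou: "(\<integral>\<^sup>+\<omega>. ennreal ((norm (Z n \<omega> - Y \<omega>))\<^sup>2) \<partial>M) \<le> ennreal (K * q ^ n)" for n
  proof -
    have "(\<integral>\<^sup>+\<omega>. ennreal ((norm (Z n \<omega> - Y \<omega>))\<^sup>2) \<partial>M)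
        = (\<integral>\<^sup>+\<omega>. liminf (\<lambda>m. ennreal ((norm (Z (n + m) \<omega> - Z n \<omega>))\<^sup>2)) \<partial>M)"
    proof (intro nn_integral_cong_AE)
      show "AE \<omega> in M. ennreal ((norm (Z n \<omega> - Y \<omega>))\<^sup>2) = liminf (\<lambda>m. ennreal ((norm (Z (n + m) \<omega> - Z n \<omega>))\<^sup>2))"
        using conv
      proof eventually_elim
        case (elim \<omega>)
        have "(\<lambda>m. Z (n + m) \<omega>) \<longlonglongrightarrow> Y \<omega>"
          using LIMSEQ_ignore_initial_segment[OF elim, of n] by (simp add: add.commute)
        then have "(\<lambda>m. ennreal ((norm (Z (n + m) \<omega> - Z n \<omega>))\<^sup>2)) \<longlonglongrightarrow> ennreal ((norm (Y \<omega> - Z n \<omega>))\<^sup>2)"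
          by (intro tendsto_intros)
        then show ?case
          by (subst lim_imp_Liminf) (auto simp: norm_minus_commute)
      qed
    qed
    also have "\<dots> \<le> liminf (\<lambda>m. \<integral>\<^sup>+\<omega>. ennreal ((norm (Z (n + m) \<omega> - Z n \<omega>))\<^sup>2) \<partial>M)"
      by (intro nn_integral_liminf) auto
    also have "\<dots> \<le> liminf (\<lambda>m. ennreal (K * q ^ n))"
      using cauchy by (intro Liminf_mono always_eventually allI)
        (simp add: L2_nn_integral[OF L2_diff[OF Z Z]] ennreal_leI)
    finally show ?thesis by (simp add: Liminf_const)
  qed
  have L: "L2 M (\<lambda>\<omega>. Z n \<omega> - Y \<omega>)" for n
    using fatou[of n] by (intro L2_of_nn_integral) (auto intro: le_less_trans)
  have "L2 M Y" using L2_diff[OF Z[of 0] L[of 0]] by simp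
  moreover have "(\<integral>\<omega>. (norm (Z n \<omega> - Y \<omega>))\<^sup>2 \<partial>M) \<le> K * q ^ n" for n
    using fatou[of n] K q unfolding L2_nn_integral[OF L] by (subst (asm) ennreal_le_iff) auto
  ultimately show thesis using conv that by blast
qed

text \<open>
  The coordinate \<open>\<omega> 0\<close> is the noise of the last step, so that passing from \<open>n\<close> to \<open>Suc n\<close> steps
  inserts a step at the beginning and the iterates converge.
\<close>
primrec backward_euler ::
    "(real^'d \<Rightarrow> (real^'d) measure \<Rightarrow> real^'d) \<Rightarrow> (real^'d \<Rightarrow> (real^'d) measure \<Rightarrow> real^'d^'d) \<Rightarrow>
     real \<Rightarrow> (nat \<Rightarrow> real^'d) measure \<Rightarrow> nat \<Rightarrow> (nat \<Rightarrow> real^'d) \<Rightarrow> real^'d" where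
  "backward_euler b \<sigma> h S 0 = (\<lambda>\<omega>. 0)"
| "backward_euler b \<sigma> h S (Suc n) = (\<lambda>\<omega>. euler_step b \<sigma> h (law S (backward_euler b \<sigma> h S n))
      (backward_euler b \<sigma> h S n (\<lambda>i. \<omega> (Suc i))) (\<omega> 0))"

text \<open>The law map of the scheme, nonlinear because \<open>\<mu>\<close> is both the law of the
  state and the argument of the coefficients. Phrased with a product measure it refers to no
  probability space, so that a fixed point found on one space can be used on another.\<close>

definition step_law ::
    "(real^'d \<Rightarrow> (real^'d) measure \<Rightarrow> real^'d) \<Rightarrow> (real^'d \<Rightarrow> (real^'d) measure \<Rightarrow> real^'d^'d) \<Rightarrow>
     real \<Rightarrow> (real^'d) measure \<Rightarrow> (real^'d) measure" where
  "step_law b \<sigma> h \<mu> = distr (\<mu> \<Otimes>\<^sub>M isotropic_normal h) borel (\<lambda>(x, z). euler_step b \<sigma> h \<mu> x z)"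

lemma sets_isotropic_normal [simp]: "sets (isotropic_normal v) = sets borel"
  by (simp add: isotropic_normal_def)

lemma space_isotropic_normal [simp]: "space (isotropic_normal v) = UNIV"
  by (simp add: isotropic_normal_def)

text \<open>Prepending an independent coordinate to an i.i.d. sequence gives an i.i.d. sequence
  again (\<open>PiM_iter\<close>). Under this map an event of the shifted sequence and an event of
  coordinate 0 become the two sides of a rectangle. This yields independence and, with one side
  full, both marginals.\<close>

lemma sequence_shift:
  fixes N :: "'a measure"
  assumes "prob_space N"
  defines "S \<equiv> \<Pi>\<^sub>M i\<in>(UNIV::nat set). N" and "\<theta> \<equiv> (\<lambda>\<omega> i. \<omega> (Suc i))"
  shows "\<theta> \<in> measurable S S" and "prob_space S" and "distr S S \<theta> = S"
    and "distr S N (\<lambda>\<omega>. \<omega> 0) = N"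
    and "\<And>A B. A \<in> sets S \<Longrightarrow> B \<in> sets N \<Longrightarrow>
        measure S ((\<theta> -` A \<inter> space S) \<inter> ((\<lambda>\<omega>. \<omega> 0) -` B \<inter> space S))
      = measure S (\<theta> -` A \<inter> space S) * measure S ((\<lambda>\<omega>. \<omega> 0) -` B \<inter> space S)"
proof -
  interpret N: prob_space N by fact
  interpret P: product_prob_space "\<lambda>_. N" "UNIV :: nat set" ..
  interpret Q: sequence_space N ..
  interpret S: prob_space S unfolding S_def by (rule P.prob_space_axioms)
  show "prob_space S" by (rule S.prob_space_axioms)
  have c [measurable]: "(\<lambda>\<omega>. \<omega> i) \<in> measurable S N" for i
    unfolding S_def by measurable
  show \<theta> [measurable]: "\<theta> \<in> measurable S S"
    unfolding \<theta>_def S_def by (rule measurable_PiM_single') (auto simp: space_PiM PiE_iff)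
  have it: "distr (N \<Otimes>\<^sub>M S) S (\<lambda>(s, \<omega>). case_nat s \<omega>) = S"
    using Q.PiM_iter by (simp add: S_def)
  have cm: "(\<lambda>(s, \<omega>). case_nat s \<omega>) \<in> measurable (N \<Otimes>\<^sub>M S) S"
    unfolding S_def by measurable
  have joint: "measure S ((\<theta> -` A \<inter> space S) \<inter> ((\<lambda>\<omega>. \<omega> 0) -` B \<inter> space S)) = measure N B * measure S A"
    if A: "A \<in> sets S" and B: "B \<in> sets N" for A B
  proof -
    let ?E = "(\<theta> -` A \<inter> space S) \<inter> ((\<lambda>\<omega>. \<omega> 0) -` B \<inter> space S)"
    have E: "?E \<in> sets S" using A B by measurable
    have AB: "x \<in> space S" "y \<in> space N" if "x \<in> A" "y \<in> B" for x y
      using that sets.sets_into_space[OF A] sets.sets_into_space[OF B] by auto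
    have "case_nat s \<omega> \<in> space S" if "s \<in> space N" "\<omega> \<in> space S" for s \<omega>
      using measurable_space[OF cm, of "(s, \<omega>)"] that by (simp add: space_pair_measure)
    with AB have "(\<lambda>(s, \<omega>). case_nat s \<omega>) -` ?E \<inter> space (N \<Otimes>\<^sub>M S) = B \<times> A"
      by (fastforce simp: \<theta>_def space_pair_measure)
    then have "emeasure S ?E = emeasure (N \<Otimes>\<^sub>M S) (B \<times> A)"
      using emeasure_distr[OF cm, of ?E] E unfolding it by simp
    also have "\<dots> = emeasure N B * emeasure S A"
      by (rule S.emeasure_pair_measure_Times[OF B A])
    finally show ?thesis
      by (simp add: S.emeasure_eq_measure N.emeasure_eq_measure ennreal_mult'[symmetric])
  qed
  have mA: "measure S (\<theta> -` A \<inter> space S) = measure S A" if A: "A \<in> sets S" for A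
  proof -
    have "(\<theta> -` A \<inter> space S) \<inter> ((\<lambda>\<omega>. \<omega> 0) -` space N \<inter> space S) = \<theta> -` A \<inter> space S"
      using measurable_space[OF c] by auto
    then show ?thesis using joint[OF A, of "space N"] N.prob_space by simp
  qed
  have mB: "measure S ((\<lambda>\<omega>. \<omega> 0) -` B \<inter> space S) = measure N B" if B: "B \<in> sets N" for B
  proof -
    have "(\<theta> -` space S \<inter> space S) \<inter> ((\<lambda>\<omega>. \<omega> 0) -` B \<inter> space S) = (\<lambda>\<omega>. \<omega> 0) -` B \<inter> space S"
      using measurable_space[OF \<theta>] by auto
    then show ?thesis using joint[OF _ B, of "space S"] S.prob_space by simp
  qed
  show "distr S S \<theta> = S"
    by (rule measure_eqI) (auto simp: emeasure_distr S.emeasure_eq_measure mA)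
  show "distr S N (\<lambda>\<omega>. \<omega> 0) = N"
    by (rule measure_eqI) (auto simp: emeasure_distr S.emeasure_eq_measure N.emeasure_eq_measure mB)
  show "measure S ((\<theta> -` A \<inter> space S) \<inter> ((\<lambda>\<omega>. \<omega> 0) -` B \<inter> space S))
      = measure S (\<theta> -` A \<inter> space S) * measure S ((\<lambda>\<omega>. \<omega> 0) -` B \<inter> space S)"
    if "A \<in> sets S" "B \<in> sets N" for A B
    using joint[OF that] mA[OF that(1)] mB[OF that(2)] by simp
qed

context mv_coefficients
begin

text \<open>The iterates after \<open>n + m\<close> and after \<open>n\<close> steps share their
  last \<open>n\<close> steps. Bounding the outcome of the \<open>m\<close> extra initial steps is
  the task of \<open>p\<close>; damping their effect through the shared steps is the task of
  \<open>q\<close>.\<close>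

lemma ex_step_law_fixpoint:
  fixes h :: real
  defines "q \<equiv> 1 - (\<alpha> - \<beta>) * h + (a + bbar) * h\<^sup>2"
    and "p \<equiv> 1 - (\<gamma> - \<kappa>) * h + 2 * c0 * h\<^sup>2"
  assumes N: "prob_space (isotropic_normal h :: (real^'d) measure)" and h: "h > 0"
    and q: "0 < q" "q < 1" and p: "0 < p" "p < 1"
  shows "\<exists>\<pi>\<in>P2. step_law b \<sigma> h \<pi> = \<pi>"
proof -
  define N where "N = (isotropic_normal h :: (real^'d) measure)"
  define S where "S = (\<Pi>\<^sub>M i\<in>(UNIV::nat set). N)"
  define \<theta> :: "(nat \<Rightarrow> real^'d) \<Rightarrow> nat \<Rightarrow> real^'d" where "\<theta> = (\<lambda>\<omega> i. \<omega> (Suc i))"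
  \<comment> \<open>The past of the last step: all coordinates but
    \<open>\<omega> 0\<close>.\<close>
  define G where "G = vimage_algebra (space S) \<theta> S"
  note shift = sequence_shift[OF assms(3), folded N_def, folded S_def, folded \<theta>_def]
  interpret S: prob_space S by (rule shift)
  have sN: "sets N = sets borel" by (simp add: N_def)
  have c: "(\<lambda>\<omega>. \<omega> 0) \<in> measurable S N" unfolding S_def by measurable
  then have c': "(\<lambda>\<omega>. \<omega> 0) \<in> borel_measurable S"
    using measurable_cong_sets[OF refl sN] by blast
  have \<theta>: "\<theta> \<in> measurable S S" by (rule shift)
  have \<theta>s: "\<theta> \<in> space S \<rightarrow> space S" using \<theta> by (auto dest: measurable_space)
  have sG: "sets G = {\<theta> -` A \<inter> space S | A. A \<in> sets S}"
    unfolding G_def by (rule sets_vimage_algebra2[OF \<theta>s])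
  have \<theta>G: "\<theta> \<in> measurable G S"
    unfolding G_def by (rule measurable_vimage_algebra1[OF \<theta>s])
  interpret mv_noise b \<sigma> \<alpha> \<beta> \<gamma> \<kappa> \<rho> c0 a bbar S G "\<lambda>\<omega>. \<omega> 0" h
  proof
    show "subalgebra S G"
      unfolding subalgebra_def sG using \<theta> by (auto simp: G_def)
    show "(\<lambda>\<omega>. \<omega> 0) \<in> borel_measurable S" by (rule c')
    have "distr S borel (\<lambda>\<omega>. \<omega> 0) = distr S N (\<lambda>\<omega>. \<omega> 0)"
      by (rule distr_cong) (auto simp: sN)
    then show "distr S borel (\<lambda>\<omega>. \<omega> 0) = isotropic_normal h"
      using shift(4) by (simp add: N_def)
    show "S.prob (A \<inter> ((\<lambda>\<omega>. \<omega> 0) -` B \<inter> space S)) = S.prob A * S.prob ((\<lambda>\<omega>. \<omega> 0) -` B \<inter> space S)"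
      if "A \<in> sets G" "B \<in> sets borel" for A B
      using that shift(5) unfolding sG sN[symmetric] by auto
  qed (rule h)
  define Z where "Z = backward_euler b \<sigma> h S"
  have Z0: "Z 0 = (\<lambda>\<omega>. 0)" and ZS: "Z (Suc n) = (\<lambda>\<omega>. euler_step b \<sigma> h (law S (Z n)) (Z n (\<theta> \<omega>)) (\<omega> 0))" for n
    by (simp_all add: Z_def \<theta>_def)
  \<comment> \<open>The shift preserves \<open>S\<close>, so a shifted variable keeps its law and
    moments, and it belongs to the past \<open>G\<close>.\<close>
  have shifted: "L2 S (\<lambda>\<omega>. f (\<theta> \<omega>))" "(\<lambda>\<omega>. f (\<theta> \<omega>)) \<in> borel_measurable G"
    "law S (\<lambda>\<omega>. f (\<theta> \<omega>)) = law S f"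
    if "L2 S f" for f :: "(nat \<Rightarrow> real^'d) \<Rightarrow> real^'d"
  proof -
    have f: "f \<in> borel_measurable S" using that by (simp add: L2_def)
    show "L2 S (\<lambda>\<omega>. f (\<theta> \<omega>))"
      using L2_distr[OF \<theta> f] that by (simp add: shift(3))
    show "(\<lambda>\<omega>. f (\<theta> \<omega>)) \<in> borel_measurable G" by (rule measurable_compose[OF \<theta>G f])
    show "law S (\<lambda>\<omega>. f (\<theta> \<omega>)) = law S f"
      using distr_distr[OF f \<theta>] by (simp add: comp_def shift(3))
  qed
  have ZL: "L2 S (Z n)" for n
  proof (induction n)
    case 0 show ?case unfolding Z0 by (intro L2_const S.finite_measure_axioms)
  next
    case (Suc n)
    show ?case unfolding ZS by (intro euler_step_L2 shifted[OF Suc] S.law_in_P2 Suc)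
  qed
  have E_shift: "(\<integral>\<omega>. g (\<theta> \<omega>) \<partial>S) = (\<integral>\<omega>. g \<omega> \<partial>S)" if "g \<in> borel_measurable S" for g :: "_ \<Rightarrow> real"
    using integral_distr[OF \<theta> that] by (simp add: shift(3))
  \<comment> \<open>The bound is the fixed point of the affine recursion with slope
    \<open>p\<close>, which starts below it at 0.\<close>
  have mom: "(\<integral>\<omega>. (norm (Z m \<omega>))\<^sup>2 \<partial>S) \<le> (\<kappa> * (1 + \<rho>) * h + c0 * h\<^sup>2) / (1 - p)" (is "_ \<le> ?K") for m
  proof (induction m)
    case 0 show ?case unfolding Z0 using parameters p h by simp
  next
    case (Suc m)
    have "(\<integral>\<omega>. (norm (Z (Suc m) \<omega>))\<^sup>2 \<partial>S)
        \<le> p * (\<integral>\<omega>. (norm (Z m (\<theta> \<omega>)))\<^sup>2 \<partial>S) + (\<kappa> * (1 + \<rho>) * h + c0 * h\<^sup>2)"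
      unfolding ZS p_def using euler_step_moment[OF shifted(1,2)[OF ZL[of m]]]
      by (simp add: shifted(3)[OF ZL])
    also have "(\<integral>\<omega>. (norm (Z m (\<theta> \<omega>)))\<^sup>2 \<partial>S) = (\<integral>\<omega>. (norm (Z m \<omega>))\<^sup>2 \<partial>S)"
      using ZL by (intro E_shift) (auto simp: L2_def)
    also have "p * (\<integral>\<omega>. (norm (Z m \<omega>))\<^sup>2 \<partial>S) \<le> p * ?K"
      using Suc p by (intro mult_left_mono) auto
    also have "p * ?K + (\<kappa> * (1 + \<rho>) * h + c0 * h\<^sup>2) = ?K"
      using p by (simp add: field_simps)
    finally show ?case by simp
  qed
  \<comment> \<open>For \<open>n = 0\<close> the distance to \<open>Z 0\<close>, which is 0, is a
    second moment. Each further \<open>n\<close> adds one contracting step in which both variables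
    share the noise \<open>\<omega> 0\<close>.\<close>
  have cauchy: "(\<integral>\<omega>. (norm (Z (n + m) \<omega> - Z n \<omega>))\<^sup>2 \<partial>S) \<le> ?K * q ^ n" for n m
  proof (induction n)
    case 0 show ?case using mom[of m] by (simp add: Z0)
  next
    case (Suc n)
    have "(\<integral>\<omega>. (norm (Z (Suc n + m) \<omega> - Z (Suc n) \<omega>))\<^sup>2 \<partial>S)
        \<le> q * (\<integral>\<omega>. (norm (Z (n + m) (\<theta> \<omega>) - Z n (\<theta> \<omega>)))\<^sup>2 \<partial>S)"
      unfolding q_def add_Suc ZS
      using euler_step_dist[OF shifted(1,2)[OF ZL[of "n + m"]] shifted(1,2)[OF ZL[of n]]]
      by (simp add: shifted(3)[OF ZL])
    also have "(\<integral>\<omega>. (norm (Z (n + m) (\<theta> \<omega>) - Z n (\<theta> \<omega>)))\<^sup>2 \<partial>S) = (\<integral>\<omega>. (norm (Z (n + m) \<omega> - Z n \<omega>))\<^sup>2 \<partial>S)"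
      using L2_diff[OF ZL[of "n + m"] ZL[of n]] by (intro E_shift) (auto simp: L2_def)
    also have "q * \<dots> \<le> q * (?K * q ^ n)"
      using Suc q by (intro mult_left_mono) auto
    finally show ?case by (simp add: mult_ac)
  qed
  obtain Y where Y: "L2 S Y" "AE \<omega> in S. (\<lambda>n. Z n \<omega>) \<longlonglongrightarrow> Y \<omega>"
    "\<And>n. (\<integral>\<omega>. (norm (Z n \<omega> - Y \<omega>))\<^sup>2 \<partial>S) \<le> ?K * q ^ n"
    using S.L2_limit_of_geometric_cauchy[OF ZL q cauchy] by blast
  define \<pi> where "\<pi> = law S Y"
  have \<pi>: "\<pi> \<in> P2" unfolding \<pi>_def by (rule S.law_in_P2[OF Y(1)])
  have \<mu>: "law S (Z n) \<in> P2" for n by (rule S.law_in_P2[OF ZL])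
  have W2lim: "(\<lambda>n. (W2 (law S (Z n)) \<pi>)\<^sup>2) \<longlonglongrightarrow> 0"
  proof (rule tendsto_sandwich[OF _ _ tendsto_const])
    show "\<forall>\<^sub>F n in sequentially. (W2 (law S (Z n)) \<pi>)\<^sup>2 \<le> ?K * q ^ n"
    proof (intro always_eventually allI)
      fix n
      have "(W2 (law S (Z n)) \<pi>)\<^sup>2 \<le> (\<integral>\<omega>. (norm (Z n \<omega> - Y \<omega>))\<^sup>2 \<partial>S)"
        unfolding \<pi>_def using ZL[of n] Y(1) by (intro S.W2_law_le) (auto simp: L2_def)
      with Y(3)[of n] show "(W2 (law S (Z n)) \<pi>)\<^sup>2 \<le> ?K * q ^ n" by simp
    qed
    show "(\<lambda>n. ?K * q ^ n) \<longlonglongrightarrow> 0"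
      using q by (intro tendsto_mult_right_zero LIMSEQ_realpow_zero) auto
  qed auto
  \<comment> \<open>State and law converge at once; the Lipschitz bound in both arguments turns this
    into convergence of the coefficients.\<close>
  have coeff_lim: "(\<lambda>n. f (z n) (law S (Z n))) \<longlonglongrightarrow> f y \<pi>"
    if f: "\<And>x y \<mu> \<nu>. \<mu> \<in> P2 \<Longrightarrow> \<nu> \<in> P2 \<Longrightarrow>
        (norm (f x \<mu> - f y \<nu>))\<^sup>2 \<le> a * (norm (x - y))\<^sup>2 + bbar * (W2 \<mu> \<nu>)\<^sup>2"
      and z: "z \<longlonglongrightarrow> y" for f :: "real^'d \<Rightarrow> (real^'d) measure \<Rightarrow> 'e::euclidean_space" and z y
  proof -
    have "(\<lambda>n. (norm (f (z n) (law S (Z n)) - f y \<pi>))\<^sup>2) \<longlonglongrightarrow> 0"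
    proof (rule tendsto_sandwich[OF _ _ tendsto_const])
      have "(\<lambda>n. a * (norm (z n - y))\<^sup>2 + bbar * (W2 (law S (Z n)) \<pi>)\<^sup>2) \<longlonglongrightarrow> a * (norm (y - y))\<^sup>2 + bbar * 0"
        by (intro tendsto_intros z W2lim)
      then show "(\<lambda>n. a * (norm (z n - y))\<^sup>2 + bbar * (W2 (law S (Z n)) \<pi>)\<^sup>2) \<longlonglongrightarrow> 0" by simp
    qed (auto intro!: always_eventually f \<mu> \<pi>)
    then have "(\<lambda>n. sqrt ((norm (f (z n) (law S (Z n)) - f y \<pi>))\<^sup>2)) \<longlonglongrightarrow> sqrt 0"
      by (rule tendsto_real_sqrt)
    then have "(\<lambda>n. f (z n) (law S (Z n)) - f y \<pi>) \<longlonglongrightarrow> 0"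
      by (simp add: tendsto_norm_zero_iff)
    then show ?thesis by (rule LIM_zero_cancel)
  qed
  \<comment> \<open>Almost sure convergence may be read at \<open>\<theta> \<omega>\<close> because
    the shift preserves \<open>S\<close>.\<close>
  have "AE \<omega> in S. (\<lambda>n. Z n (\<theta> \<omega>)) \<longlonglongrightarrow> Y (\<theta> \<omega>)"
    by (rule AE_distrD[OF \<theta>]) (unfold shift(3), rule Y(2))
  \<comment> \<open>The limit of the recursion: \<open>Y\<close> is one step from the shifted
    \<open>Y\<close>, which has the same law and is independent of
    \<open>\<omega> 0\<close>.\<close>
  then have fixpt: "AE \<omega> in S. Y \<omega> = euler_step b \<sigma> h \<pi> (Y (\<theta> \<omega>)) (\<omega> 0)"
    using Y(2)
  proof eventually_elim
    case (elim \<omega>)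
    note lim = coeff_lim[of b, OF lipschitz(1) elim(1)] coeff_lim[of \<sigma>, OF lipschitz(2) elim(1)]
    have "(\<lambda>n. Z (Suc n) \<omega>) \<longlonglongrightarrow> euler_step b \<sigma> h \<pi> (Y (\<theta> \<omega>)) (\<omega> 0)"
      unfolding ZS euler_step_def
      by (intro tendsto_add tendsto_scaleR tendsto_const elim(1) lim tendsto_matrix_vector_mult)
    moreover have "(\<lambda>n. Z (Suc n) \<omega>) \<longlonglongrightarrow> Y \<omega>"
      using elim(2) by (rule LIMSEQ_Suc)
    ultimately show ?case by (rule LIMSEQ_unique[symmetric])
  qed
  note sY = shifted[OF Y(1)]
  have "\<pi> = law S (\<lambda>\<omega>. euler_step b \<sigma> h \<pi> (Y (\<theta> \<omega>)) (\<omega> 0))"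
    unfolding \<pi>_def
    by (intro distr_cong_AE) (use fixpt \<pi>_def in \<open>auto intro!: L2_measurable Y euler_step_L2 sY S.law_in_P2\<close>)
  also have "\<dots> = step_law b \<sigma> h \<pi>"
    unfolding step_law_def using distr_noise[OF sY(2) measurable_euler_step[OF \<pi>, of h]]
    by (simp add: sY(3) \<pi>_def)
  finally have e: "\<pi> = step_law b \<sigma> h \<pi>" .
  show ?thesis by (rule bexI[where x=\<pi>]) (rule e[symmetric], rule \<pi>)
qed

end


section \<open>Contraction of the Euler scheme\<close>

context brownian_motion
begin

lemma increment_noise:
  assumes "0 \<le> s" "s < t"
  shows "gaussian_noise M (F s) (\<lambda>\<omega>. W t \<omega> - W s \<omega>) (t - s)"
proof
  show "subalgebra M (F s)" using assms by (intro subalg) auto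
  have "W t \<in> borel_measurable M" "W s \<in> borel_measurable M"
    using assms by (auto intro!: measurable_from_subalg[OF subalg adapted])
  then show "(\<lambda>\<omega>. W t \<omega> - W s \<omega>) \<in> borel_measurable M" by measurable
  show "law M (\<lambda>\<omega>. W t \<omega> - W s \<omega>) = isotropic_normal (t - s)"
    using assms by (rule normal_increments)
  show "prob (A \<inter> ((\<lambda>\<omega>. W t \<omega> - W s \<omega>) -` B \<inter> space M))
      = prob A * prob ((\<lambda>\<omega>. W t \<omega> - W s \<omega>) -` B \<inter> space M)"
    if "A \<in> sets (F s)" "B \<in> sets borel" for A B
    using that by (intro indep_setD[OF independent_increments[OF assms]]) auto
qed (use assms in auto)

lemma F_measurable_mono:
  assumes "0 \<le> s" "s \<le> t" "f \<in> measurable (F s) N"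
  shows "f \<in> measurable (F t) N"
  using F_mono[OF assms(1,2)] subalg[of s] subalg[of t] assms
  by (intro measurable_from_subalg[OF _ assms(3)]) (auto simp: subalgebra_def)

lemma F_measurable_M: "0 \<le> s \<Longrightarrow> f \<in> measurable (F s) N \<Longrightarrow> f \<in> measurable M N"
  by (rule measurable_from_subalg[OF subalg])

end

section \<open>The scheme driven by a Brownian motion\<close>

locale mv_brownian = mv_coefficients b \<sigma> \<alpha> \<beta> \<gamma> \<kappa> \<rho> c0 a bbar + brownian_motion M F W
  for b :: "real^'d \<Rightarrow> (real^'d) measure \<Rightarrow> real^'d"
    and \<sigma> :: "real^'d \<Rightarrow> (real^'d) measure \<Rightarrow> real^'d^'d"
    and \<alpha> \<beta> \<gamma> \<kappa> \<rho> c0 a bbar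
    and M :: "'w measure" and F :: "real \<Rightarrow> 'w measure" and W :: "real \<Rightarrow> 'w \<Rightarrow> real^'d"
begin

lemma mv_noise_increment:
  assumes "h > 0"
  shows "mv_noise b \<sigma> \<alpha> \<beta> \<gamma> \<kappa> \<rho> c0 a bbar M (F (real k * h))
      (\<lambda>\<omega>. W (real (Suc k) * h) \<omega> - W (real k * h) \<omega>) h"
proof (rule mv_noise.intro[OF mv_coefficients_axioms])
  have "gaussian_noise M (F (real k * h)) (\<lambda>\<omega>. W (real (Suc k) * h) \<omega> - W (real k * h) \<omega>)
      (real (Suc k) * h - real k * h)"
    using assms by (intro increment_noise) (auto simp: algebra_simps)
  then show "gaussian_noise M (F (real k * h)) (\<lambda>\<omega>. W (real (Suc k) * h) \<omega> - W (real k * h) \<omega>) h"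
    by (simp add: algebra_simps)
qed

lemma euler_Suc: "euler M W b \<sigma> h X (Suc k) = (\<lambda>\<omega>. euler_step b \<sigma> h (law M (euler M W b \<sigma> h X k))
    (euler M W b \<sigma> h X k \<omega>) (W (real (Suc k) * h) \<omega> - W (real k * h) \<omega>))"
  by (simp add: euler_step_def)

text \<open>Both claims share one induction: adaptedness provides the independence from the next
  increment by which the noise term is square integrable.\<close>

lemma euler_L2_adapted:
  assumes X: "L2 M X" "X \<in> borel_measurable (F 0)" and h: "h > 0"
  shows "L2 M (euler M W b \<sigma> h X k) \<and> euler M W b \<sigma> h X k \<in> borel_measurable (F (real k * h))"
proof (induction k)
  case 0 then show ?case using X by simp
next
  case (Suc k)
  define E where "E = euler M W b \<sigma> h X k"
  interpret N: mv_noise b \<sigma> \<alpha> \<beta> \<gamma> \<kappa> \<rho> c0 a bbar M "F (real k * h)"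
    "\<lambda>\<omega>. W (real (Suc k) * h) \<omega> - W (real k * h) \<omega>" h
    by (rule mv_noise_increment[OF h])
  have E: "L2 M E" "E \<in> borel_measurable (F (real k * h))" using Suc by (auto simp: E_def)
  note P = law_in_P2[OF E(1)]
  have "W (real (Suc k) * h) \<in> borel_measurable (F (real (Suc k) * h))"
    using h by (intro adapted) auto
  moreover have le: "real k * h \<le> real (Suc k) * h" "0 \<le> real k * h"
    using h by (auto simp: algebra_simps)
  moreover have "W (real k * h) \<in> borel_measurable (F (real (Suc k) * h))"
    by (rule F_measurable_mono[OF le(2,1) adapted[OF le(2)]])
  moreover have "E \<in> borel_measurable (F (real (Suc k) * h))"
    by (rule F_measurable_mono[OF le(2,1) E(2)])
  ultimately have "(\<lambda>\<omega>. (E \<omega>, W (real (Suc k) * h) \<omega> - W (real k * h) \<omega>))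
      \<in> F (real (Suc k) * h) \<rightarrow>\<^sub>M borel \<Otimes>\<^sub>M borel"
    by measurable
  from measurable_compose[OF this measurable_euler_step[OF P, of h]]
  have "(\<lambda>\<omega>. euler_step b \<sigma> h (law M E) (E \<omega>) (W (real (Suc k) * h) \<omega> - W (real k * h) \<omega>))
      \<in> borel_measurable (F (real (Suc k) * h))" by simp
  with N.euler_step_L2[OF E P] show ?case
    unfolding euler_Suc E_def by simp
qed

lemmas euler_L2 = euler_L2_adapted[THEN conjunct1]
  and euler_adapted = euler_L2_adapted[THEN conjunct2]

lemma euler_dist:
  assumes X: "L2 M X" "X \<in> borel_measurable (F 0)" and Y: "L2 M Y" "Y \<in> borel_measurable (F 0)"
    and h: "h > 0" and q: "0 \<le> 1 - (\<alpha> - \<beta>) * h + (a + bbar) * h\<^sup>2" (is "0 \<le> ?q")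
  shows "(\<integral>\<omega>. (norm (euler M W b \<sigma> h X k \<omega> - euler M W b \<sigma> h Y k \<omega>))\<^sup>2 \<partial>M)
      \<le> ?q ^ k * (\<integral>\<omega>. (norm (X \<omega> - Y \<omega>))\<^sup>2 \<partial>M)"
proof (induction k)
  case (Suc k)
  interpret N: mv_noise b \<sigma> \<alpha> \<beta> \<gamma> \<kappa> \<rho> c0 a bbar M "F (real k * h)"
    "\<lambda>\<omega>. W (real (Suc k) * h) \<omega> - W (real k * h) \<omega>" h
    by (rule mv_noise_increment[OF h])
  have "(\<integral>\<omega>. (norm (euler M W b \<sigma> h X (Suc k) \<omega> - euler M W b \<sigma> h Y (Suc k) \<omega>))\<^sup>2 \<partial>M)
      \<le> ?q * (\<integral>\<omega>. (norm (euler M W b \<sigma> h X k \<omega> - euler M W b \<sigma> h Y k \<omega>))\<^sup>2 \<partial>M)"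
    unfolding euler_Suc
    by (intro N.euler_step_dist euler_L2 euler_adapted X Y h)
  also have "\<dots> \<le> ?q * (?q ^ k * (\<integral>\<omega>. (norm (X \<omega> - Y \<omega>))\<^sup>2 \<partial>M))"
    using Suc q by (intro mult_left_mono) auto
  finally show ?case by simp
qed simp

text \<open>By \<open>distr_noise\<close> a step acts on laws as \<open>step_law\<close> on any
  probability space, so a fixed point found elsewhere stays fixed here.\<close>

lemma law_euler_fixpoint:
  assumes X: "L2 M X" "X \<in> borel_measurable (F 0)" and h: "h > 0"
    and \<pi>: "law M X = \<pi>" "step_law b \<sigma> h \<pi> = \<pi>"
  shows "law M (euler M W b \<sigma> h X k) = \<pi>"
proof (induction k)
  case (Suc k)
  interpret N: mv_noise b \<sigma> \<alpha> \<beta> \<gamma> \<kappa> \<rho> c0 a bbar M "F (real k * h)"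
    "\<lambda>\<omega>. W (real (Suc k) * h) \<omega> - W (real k * h) \<omega>" h
    by (rule mv_noise_increment[OF h])
  have P: "\<pi> \<in> P2" using law_in_P2[OF X(1)] \<pi>(1) by simp
  show ?case
    unfolding euler_Suc Suc
    using N.distr_noise[OF euler_adapted[OF X h] measurable_euler_step[OF P, of h], unfolded Suc]
    by (simp add: \<pi>(2)[unfolded step_law_def])
qed (simp add: \<pi>)

theorem ex1_euler_invariant:
  assumes supp: "supports_initial_laws M F TYPE(real^'d)" and h: "h > 0"
  defines "q \<equiv> 1 - (\<alpha> - \<beta>) * h + (a + bbar) * h\<^sup>2"
    and "p \<equiv> 1 - (\<gamma> - \<kappa>) * h + 2 * c0 * h\<^sup>2"
  assumes q: "0 < q" "q < 1" and p: "0 < p" "p < 1"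
  shows "\<exists>\<pi>. euler_invariant M F W b \<sigma> h \<pi> \<and>
      (\<forall>\<nu>. euler_invariant M F W b \<sigma> h \<nu> \<longrightarrow> \<nu> = \<pi>) \<and>
      (\<forall>x. \<exists>C>0. \<exists>\<xi>>0. \<forall>k::nat.
         W2 (law M (euler M W b \<sigma> h (\<lambda>\<omega>. x) k)) \<pi> \<le> C * exp (- \<xi> * (real k * h)))"
proof -
  \<comment> \<open>The Brownian increment over \<open>[0, h]\<close> has this law, so its total
    mass is 1.\<close>
  have "prob_space (isotropic_normal (h - 0) :: (real^'d) measure)"
    using h normal_increments[of 0 h] increment_noise[of 0 h]
    by (metis gaussian_noise.\<xi>_meas order.refl prob_space_distr)
  then have N: "prob_space (isotropic_normal h :: (real^'d) measure)" by simp
  obtain \<pi> where \<pi>: "\<pi> \<in> P2" "step_law b \<sigma> h \<pi> = \<pi>"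
    using ex_step_law_fixpoint[OF N h] q p by (auto simp: q_def p_def)
  \<comment> \<open>The law found on the sequence space is realised on the given one; this is what
    the support condition on \<open>F 0\<close> provides.\<close>
  obtain V where V: "V \<in> borel_measurable (F 0)" "law M V = \<pi>"
    using supp \<pi>(1) by (auto simp: supports_initial_laws_def)
  have L2I: "L2 M X" if "X \<in> borel_measurable (F 0)" "law M X \<in> P2" for X :: "'w \<Rightarrow> real^'d"
    using that by (intro law_P2_L2 F_measurable_M[of 0]) auto
  have VL: "L2 M V" using V \<pi> by (intro L2I) auto
  have inv: "euler_invariant M F W b \<sigma> h \<pi>"
    unfolding euler_invariant_def using \<pi> V h by (auto intro!: law_euler_fixpoint L2I)
  have uniq: "\<nu> = \<pi>" if \<nu>: "euler_invariant M F W b \<sigma> h \<nu>" for \<nu>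
  proof -
    obtain U where U: "U \<in> borel_measurable (F 0)" "law M U = \<nu>"
      and l: "\<And>k. law M (euler M W b \<sigma> h U k) = \<nu>" and "\<nu> \<in> P2"
      using \<nu> by (auto simp: euler_invariant_def)
    have UL: "L2 M U" using U \<open>\<nu> \<in> P2\<close> by (intro L2I) auto
    \<comment> \<open>Both schemes keep their laws while the shared noise drives their distance to
      0.\<close>
    show ?thesis
    proof (rule laws_eq_of_L2_dist_tendsto_0)
      show "(\<lambda>k. \<integral>\<omega>. (norm (euler M W b \<sigma> h U k \<omega> - euler M W b \<sigma> h V k \<omega>))\<^sup>2 \<partial>M) \<longlonglongrightarrow> 0"
      proof (rule tendsto_sandwich[OF _ _ tendsto_const])
        show "(\<lambda>k. q ^ k * (\<integral>\<omega>. (norm (U \<omega> - V \<omega>))\<^sup>2 \<partial>M)) \<longlonglongrightarrow> 0"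
          using q by (intro tendsto_mult_left_zero LIMSEQ_realpow_zero) auto
        show "\<forall>\<^sub>F k in sequentially. (\<integral>\<omega>. (norm (euler M W b \<sigma> h U k \<omega> - euler M W b \<sigma> h V k \<omega>))\<^sup>2 \<partial>M)
            \<le> q ^ k * (\<integral>\<omega>. (norm (U \<omega> - V \<omega>))\<^sup>2 \<partial>M)"
          unfolding q_def using q by (intro always_eventually allI euler_dist UL U VL V h) (auto simp: q_def)
      qed auto
    qed (auto intro!: euler_L2 UL U VL V h l law_euler_fixpoint \<pi>)
  qed
  have conv: "\<exists>C>0. \<exists>\<xi>>0. \<forall>k::nat.
         W2 (law M (euler M W b \<sigma> h (\<lambda>\<omega>. x) k)) \<pi> \<le> C * exp (- \<xi> * (real k * h))" for x
  proof -
    define K where "K = (\<integral>\<omega>. (norm (x - V \<omega>))\<^sup>2 \<partial>M)"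
    \<comment> \<open>The contraction acts on squared distances, so \<open>exp (- \<xi> * h)\<close>
      is to be \<open>sqrt q\<close>.\<close>
    define \<xi> where "\<xi> = - ln q / (2 * h)"
    have K: "K \<ge> 0" by (simp add: K_def)
    have "\<xi> > 0" using q h by (simp add: \<xi>_def divide_neg_pos)
    have x: "L2 M (\<lambda>\<omega>. x)" "(\<lambda>\<omega>. x) \<in> borel_measurable (F 0)"
      by (auto intro: L2_const finite_measure_axioms)
    \<comment> \<open>The summand 1 keeps the constant positive when \<open>K = 0\<close>.\<close>
    have "W2 (law M (euler M W b \<sigma> h (\<lambda>\<omega>. x) k)) \<pi> \<le> (sqrt K + 1) * exp (- \<xi> * (real k * h))" for k
    proof -
      have "(W2 (law M (euler M W b \<sigma> h (\<lambda>\<omega>. x) k)) (law M (euler M W b \<sigma> h V k)))\<^sup>2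
          \<le> (\<integral>\<omega>. (norm (euler M W b \<sigma> h (\<lambda>\<omega>. x) k \<omega> - euler M W b \<sigma> h V k \<omega>))\<^sup>2 \<partial>M)"
        by (intro W2_law_le L2_measurable euler_L2 x VL V h)
      also have "\<dots> \<le> q ^ k * K"
        unfolding q_def K_def using q by (intro euler_dist x VL V h) (auto simp: q_def)
      finally have "W2 (law M (euler M W b \<sigma> h (\<lambda>\<omega>. x) k)) \<pi> \<le> sqrt (q ^ k * K)"
        unfolding law_euler_fixpoint[OF VL V(1) h V(2) \<pi>(2)] by (rule real_le_rsqrt)
      also have "sqrt (q ^ k * K) = exp (- \<xi> * (real k * h)) * sqrt K"
      proof -
        have "exp (- \<xi> * (real k * h)) = exp (real k * (ln q / 2))"
          using h by (simp add: \<xi>_def field_simps)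
        also have "\<dots> = exp (ln q / 2) ^ k" by (rule exp_of_nat_mult)
        also have "exp (ln q / 2) = sqrt q"
          using q by (intro real_sqrt_unique[symmetric]) (auto simp: power2_eq_square exp_add[symmetric])
        finally show ?thesis by (simp add: real_sqrt_mult real_sqrt_power)
      qed
      also have "\<dots> \<le> (sqrt K + 1) * exp (- \<xi> * (real k * h))"
        by (simp add: algebra_simps)
      finally show ?thesis .
    qed
    moreover have "sqrt K + 1 > 0" using K by (simp add: add_nonneg_pos)
    ultimately show ?thesis using \<open>\<xi> > 0\<close> by blast
  qed
  show ?thesis using inv uniq conv by blast
qed

end


section \<open>The Ito isometry for step processes\<close>

context brownian_motion
begin

lemma L2_matvec_increment:
  fixes A :: "'w \<Rightarrow> real^'d^'d"
  assumes A: "L2 M A" "A \<in> borel_measurable (F s)" and st: "0 \<le> s" "s \<le> t"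
  shows "L2 M (\<lambda>\<omega>. A \<omega> *v (W t \<omega> - W s \<omega>))"
\<comment> \<open>\<open>gaussian_noise\<close> demands a positive variance, so a time interval of
  length 0 is treated apart.\<close>
proof (cases "s = t")
  case True then show ?thesis by (simp add: L2_const finite_measure_axioms)
next
  case False
  then interpret gaussian_noise M "F s" "\<lambda>\<omega>. W t \<omega> - W s \<omega>" "t - s"
    using st by (intro increment_noise) auto
  show ?thesis by (rule matvec_L2[OF A])
qed

lemma adapted_matvec_increment:
  fixes A :: "'w \<Rightarrow> real^'d^'d"
  assumes A: "A \<in> borel_measurable (F s)" and st: "0 \<le> s" "s \<le> t" "t \<le> u"
  shows "(\<lambda>\<omega>. A \<omega> *v (W t \<omega> - W s \<omega>)) \<in> borel_measurable (F u)"
proof -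
  have "A \<in> borel_measurable (F u)" "W s \<in> borel_measurable (F u)" "W t \<in> borel_measurable (F u)"
    using st by (auto intro: F_measurable_mono[OF _ _ A] F_measurable_mono[OF _ _ adapted])
  then show ?thesis by (intro borel_measurable_matrix_vector_mult borel_measurable_diff)
qed

lemma increment_orthogonal:
  fixes U :: "'w \<Rightarrow> real^'d" and A :: "'w \<Rightarrow> real^'d^'d"
  assumes U: "L2 M U" "U \<in> borel_measurable (F s)" and A: "L2 M A" "A \<in> borel_measurable (F s)"
    and st: "0 \<le> s" "s \<le> t"
  shows "(\<integral>\<omega>. U \<omega> \<bullet> (A \<omega> *v (W t \<omega> - W s \<omega>)) \<partial>M) = 0"
proof (cases "s = t")
  case False
  then interpret gaussian_noise M "F s" "\<lambda>\<omega>. W t \<omega> - W s \<omega>" "t - s"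
    using st by (intro increment_noise) auto
  show ?thesis by (rule noise_orthogonal[OF U A])
qed simp

lemma same_increment_inner:
  fixes A B :: "'w \<Rightarrow> real^'d^'d"
  assumes A: "L2 M A" "A \<in> borel_measurable (F s)" and B: "L2 M B" "B \<in> borel_measurable (F s)"
    and st: "0 \<le> s" "s \<le> t"
  shows "(\<integral>\<omega>. (A \<omega> *v (W t \<omega> - W s \<omega>)) \<bullet> (B \<omega> *v (W t \<omega> - W s \<omega>)) \<partial>M) = (t - s) * (\<integral>\<omega>. A \<omega> \<bullet> B \<omega> \<partial>M)"
proof (cases "s = t")
  case False
  then interpret gaussian_noise M "F s" "\<lambda>\<omega>. W t \<omega> - W s \<omega>" "t - s"
    using st by (intro increment_noise) auto
  show ?thesis by (rule noise_inner[OF A B])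
qed simp

lemma disjoint_increments_inner:
  fixes A B :: "'w \<Rightarrow> real^'d^'d"
  assumes A: "L2 M A" "A \<in> borel_measurable (F s)" and B: "L2 M B" "B \<in> borel_measurable (F u)"
    and st: "0 \<le> s" "s \<le> t" "t \<le> u" "u \<le> v"
  shows "(\<integral>\<omega>. (A \<omega> *v (W t \<omega> - W s \<omega>)) \<bullet> (B \<omega> *v (W v \<omega> - W u \<omega>)) \<partial>M) = 0"
  using st by (intro increment_orthogonal L2_matvec_increment adapted_matvec_increment A B) auto

lemma split_increment:
  fixes A :: "real^'d^'d"
  shows
  "A *v (W t \<omega> - W s \<omega>) = A *v (W m \<omega> - W s \<omega>) + A *v (W t \<omega> - W m \<omega>)"
  by (simp add: matrix_vector_mult_diff_distrib)

text \<open>Both increments are cut at the ends of the common interval \<open>{u<..m}\<close>. An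
  increment is orthogonal to everything square integrable that is known when it starts, so only the
  product over the common interval contributes, with the length of that interval as factor.\<close>

lemma increments_inner_le:
  fixes A B :: "'w \<Rightarrow> real^'d^'d"
  assumes A: "L2 M A" "A \<in> borel_measurable (F s)" and B: "L2 M B" "B \<in> borel_measurable (F u)"
    and st: "0 \<le> s" "s \<le> t" "s \<le> u" "u \<le> v"
  shows "(\<integral>\<omega>. (A \<omega> *v (W t \<omega> - W s \<omega>)) \<bullet> (B \<omega> *v (W v \<omega> - W u \<omega>)) \<partial>M)
      = measure lborel ({s<..t} \<inter> {u<..v}) * (\<integral>\<omega>. A \<omega> \<bullet> B \<omega> \<partial>M)"
proof (cases "t \<le> u")
  case True
  then have e: "{s<..t} \<inter> {u<..v} = {}" by auto
  show ?thesis
    unfolding e using st by (simp add: disjoint_increments_inner[OF A B _ _ True])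
next
  case False
  define m where "m = min t v"
  have m: "u \<le> m" "m \<le> t" "m \<le> v" "m = t \<or> m = v" using False st by (auto simp: m_def)
  have "{s<..t} \<inter> {u<..v} = {u<..m}" using st False by (auto simp: m_def)
  then have meas: "measure lborel ({s<..t} \<inter> {u<..v}) = m - u" using m by simp
  have A': "A \<in> borel_measurable (F u)" "A \<in> borel_measurable (F m)"
    using st m(1-3) by (simp_all add: F_measurable_mono[OF _ _ A(2)])
  have B': "B \<in> borel_measurable (F m)"
    using st m(1-3) by (simp add: F_measurable_mono[OF _ _ B(2)])
  note L = L2_matvec_increment
  have LA: "L2 M (\<lambda>\<omega>. A \<omega> *v (W u \<omega> - W s \<omega>))" "L2 M (\<lambda>\<omega>. A \<omega> *v (W m \<omega> - W u \<omega>))"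
    "L2 M (\<lambda>\<omega>. A \<omega> *v (W t \<omega> - W m \<omega>))"
    and LB: "L2 M (\<lambda>\<omega>. B \<omega> *v (W m \<omega> - W u \<omega>))" "L2 M (\<lambda>\<omega>. B \<omega> *v (W v \<omega> - W m \<omega>))"
    using st m(1-3) by (auto intro!: L A A' B B')
  have z1: "(\<integral>\<omega>. (A \<omega> *v (W u \<omega> - W s \<omega>)) \<bullet> (B \<omega> *v (W m \<omega> - W u \<omega>)) \<partial>M) = 0"
    "(\<integral>\<omega>. (A \<omega> *v (W u \<omega> - W s \<omega>)) \<bullet> (B \<omega> *v (W v \<omega> - W m \<omega>)) \<partial>M) = 0"
    "(\<integral>\<omega>. (A \<omega> *v (W m \<omega> - W u \<omega>)) \<bullet> (B \<omega> *v (W v \<omega> - W m \<omega>)) \<partial>M) = 0"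
    using st m(1-3) by (auto intro!: disjoint_increments_inner A A' B B')
  have z2: "(\<integral>\<omega>. (A \<omega> *v (W t \<omega> - W m \<omega>)) \<bullet> (B \<omega> *v (W m \<omega> - W u \<omega>)) \<partial>M) = 0"
    using st m(1-3) by (subst inner_commute) (auto intro!: disjoint_increments_inner A A' B B')
  \<comment> \<open>Since \<open>m\<close> is \<open>t\<close> or \<open>v\<close>, one of the two
    increments beyond \<open>m\<close> is 0.\<close>
  have z3: "(\<integral>\<omega>. (A \<omega> *v (W t \<omega> - W m \<omega>)) \<bullet> (B \<omega> *v (W v \<omega> - W m \<omega>)) \<partial>M) = 0"
    using m(4) by auto
  have "(\<integral>\<omega>. (A \<omega> *v (W t \<omega> - W s \<omega>)) \<bullet> (B \<omega> *v (W v \<omega> - W u \<omega>)) \<partial>M)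
      = (\<integral>\<omega>. (A \<omega> *v (W u \<omega> - W s \<omega>) + A \<omega> *v (W m \<omega> - W u \<omega>) + A \<omega> *v (W t \<omega> - W m \<omega>))
          \<bullet> (B \<omega> *v (W m \<omega> - W u \<omega>) + B \<omega> *v (W v \<omega> - W m \<omega>)) \<partial>M)"
    by (simp add: split_increment[symmetric])
  also have "\<dots> = (\<integral>\<omega>. (A \<omega> *v (W m \<omega> - W u \<omega>)) \<bullet> (B \<omega> *v (W m \<omega> - W u \<omega>)) \<partial>M)"
    using z1 z2 z3 by (simp add: inner_left_distrib inner_right_distrib L2_inner LA LB)
  also have "\<dots> = (m - u) * (\<integral>\<omega>. A \<omega> \<bullet> B \<omega> \<partial>M)"
    using st m(1-3) by (intro same_increment_inner A A' B) auto
  finally show ?thesis unfolding meas .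
qed

lemma increments_inner:
  fixes A B :: "'w \<Rightarrow> real^'d^'d"
  assumes A: "L2 M A" "A \<in> borel_measurable (F s)" and B: "L2 M B" "B \<in> borel_measurable (F u)"
    and st: "0 \<le> s" "s \<le> t" "0 \<le> u" "u \<le> v"
  shows "(\<integral>\<omega>. (A \<omega> *v (W t \<omega> - W s \<omega>)) \<bullet> (B \<omega> *v (W v \<omega> - W u \<omega>)) \<partial>M)
      = measure lborel ({s<..t} \<inter> {u<..v}) * (\<integral>\<omega>. A \<omega> \<bullet> B \<omega> \<partial>M)"
proof (cases "s \<le> u")
  case True then show ?thesis using increments_inner_le[OF A B] st by simp
next
  case False
  then show ?thesis using increments_inner_le[OF B A, of v t] st
    by (simp add: inner_commute Int_commute)
qed

text \<open>
  The intervals of a step process may overlap.  Sums and differences of step processes are then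
  plain concatenations, and no common refinement of two partitions is ever formed.
\<close>
definition step_integral :: "(real \<times> real \<times> ('w \<Rightarrow> real^'d^'d)) list \<Rightarrow> 'w \<Rightarrow> real^'d" where
  "step_integral L \<omega> = (\<Sum>(l, u, A)\<leftarrow>L. A \<omega> *v (W u \<omega> - W l \<omega>))"

definition step_value :: "(real \<times> real \<times> ('w \<Rightarrow> real^'d^'d)) list \<Rightarrow> real \<Rightarrow> 'w \<Rightarrow> real^'d^'d" where
  "step_value L r \<omega> = (\<Sum>(l, u, A)\<leftarrow>L. indicator {l<..u} r *\<^sub>R A \<omega>)"

text \<open>Coefficients are square integrable rather than bounded because the approximations are
  compared with the diffusion coefficient frozen at time \<open>s\<close>, which may be
  unbounded.\<close>

definition step_process :: "real \<Rightarrow> real \<Rightarrow> (real \<times> real \<times> ('w \<Rightarrow> real^'d^'d)) list \<Rightarrow> bool" where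
  "step_process s t L \<longleftrightarrow>
     (\<forall>(l, u, A)\<in>set L. 0 \<le> l \<and> s \<le> l \<and> l \<le> u \<and> u \<le> t \<and> L2 M A \<and> A \<in> borel_measurable (F l))"

section \<open>Algebra of step processes and their isometry\<close>

lemma step_simps:
  "step_integral [] = (\<lambda>\<omega>. 0)" "step_value [] = (\<lambda>r \<omega>. 0)" "step_process s t []"
  "step_integral ((l, u, A) # L) = (\<lambda>\<omega>. A \<omega> *v (W u \<omega> - W l \<omega>) + step_integral L \<omega>)"
  "step_value ((l, u, A) # L) = (\<lambda>r \<omega>. indicator {l<..u} r *\<^sub>R A \<omega> + step_value L r \<omega>)"
  "step_process s t ((l, u, A) # L) \<longleftrightarrow>
     0 \<le> l \<and> s \<le> l \<and> l \<le> u \<and> u \<le> t \<and> L2 M A \<and> A \<in> borel_measurable (F l) \<and> step_process s t L"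
  by (auto simp: step_integral_def step_value_def step_process_def fun_eq_iff)

lemma step_append:
  "step_integral (L @ L') \<omega> = step_integral L \<omega> + step_integral L' \<omega>"
  "step_value (L @ L') r \<omega> = step_value L r \<omega> + step_value L' r \<omega>"
  "step_process s t (L @ L') \<longleftrightarrow> step_process s t L \<and> step_process s t L'"
  by (simp_all add: step_integral_def step_value_def step_process_def ball_Un)

definition step_uminus :: "(real \<times> real \<times> ('w \<Rightarrow> real^'d^'d)) list \<Rightarrow> (real \<times> real \<times> ('w \<Rightarrow> real^'d^'d)) list" where
  "step_uminus = map (\<lambda>(l, u, A). (l, u, \<lambda>\<omega>. - A \<omega>))"

lemma step_uminus:
  "step_integral (step_uminus L) \<omega> = - step_integral L \<omega>"
  "step_value (step_uminus L) r \<omega> = - step_value L r \<omega>"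
  "step_process s t L \<Longrightarrow> step_process s t (step_uminus L)"
proof -
  have "(- A) *v x = - (A *v x)" for A :: "real^'d^'d" and x
    by (simp add: vec_eq_iff matrix_vector_mult_def sum_negf)
  then show "step_integral (step_uminus L) \<omega> = - step_integral L \<omega>"
    "step_value (step_uminus L) r \<omega> = - step_value L r \<omega>"
    "step_process s t L \<Longrightarrow> step_process s t (step_uminus L)"
    by (induction L) (auto simp: step_uminus_def step_simps L2_uminus)
qed

text \<open>Raising both endpoints to at least \<open>s\<close> restricts the integrand to times
  after \<open>s\<close>; an interval that ends before \<open>s\<close> becomes empty and
  contributes nothing.\<close>

definition step_after :: "real \<Rightarrow> (real \<times> real \<times> ('w \<Rightarrow> real^'d^'d)) list \<Rightarrow> (real \<times> real \<times> ('w \<Rightarrow> real^'d^'d)) list" where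
  "step_after s = map (\<lambda>(l, u, A). (max l s, max u s, A))"

lemma step_value_after: "step_value (step_after s L) r \<omega> = indicator {s<..} r *\<^sub>R step_value L r \<omega>"
proof (induction L)
  case (Cons p L)
  obtain l u A where p: "p = (l, u, A)" by (cases p)
  have "indicator {max l s<..max u s} r = (indicator {s<..} r * indicator {l<..u} r :: real)"
    by (auto simp: indicator_def max_def)
  then show ?case using Cons by (simp add: p step_simps step_after_def algebra_simps)
qed (simp add: step_simps step_after_def)

lemma step_process_after:
  assumes "step_process s' t L" "0 \<le> s" "s \<le> t"
  shows "step_process s t (step_after s L)"
  using assms
proof (induction L)
  case (Cons p L)
  obtain l u A where p: "p = (l, u, A)" by (cases p)
  have "A \<in> borel_measurable (F (max l s))"
    using Cons.prems by (intro F_measurable_mono[of l "max l s" A]) (auto simp: p step_simps)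
  then show ?case using Cons by (auto simp: p step_simps step_after_def)
qed (simp add: step_simps step_after_def)

lemma step_process_mono: "step_process s t L \<Longrightarrow> s' \<le> s \<Longrightarrow> t \<le> t' \<Longrightarrow> step_process s' t' L"
  by (force simp: step_process_def)

lemma step_value_outside: "step_process s t L \<Longrightarrow> r \<notin> {s<..t} \<Longrightarrow> step_value L r \<omega> = 0"
proof (induction L)
  case (Cons p L)
  obtain l u A where p: "p = (l, u, A)" by (cases p)
  show ?case using Cons by (auto simp: p step_simps indicator_def)
qed (simp add: step_simps)

lemma L2_step: 
  assumes "step_process s t L"
  shows "L2 M (step_integral L)" "L2 M (step_value L r)"
  using assms
  by (induction L) (auto simp: step_simps split: prod.splits
      intro!: L2_add L2_scaleR L2_const L2_matvec_increment finite_measure_axioms)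

lemma measurable_step_value:
  assumes "step_process s t L"
  shows "(\<lambda>(r, \<omega>). step_value L r \<omega>) \<in> borel_measurable (lborel \<Otimes>\<^sub>M M)"
  using assms
proof (induction L)
  case (Cons p L)
  obtain l u A where p: "p = (l, u, A)" by (cases p)
  have [measurable]: "A \<in> borel_measurable M" "(\<lambda>p. step_value L (fst p) (snd p)) \<in> borel_measurable (lborel \<Otimes>\<^sub>M M)"
    using Cons by (auto simp: p step_simps L2_def case_prod_beta)
  show ?case unfolding p step_simps case_prod_beta by measurable
qed (simp add: step_simps)

text \<open>The bilinear form splits entry by entry, so two nested inductions reduce it to single
  increments, where \<open>increments_inner\<close> accounts for overlaps. An induction on the
  squared norm alone would leave mixed terms.\<close>

lemma step_integral_inner:
  assumes "step_process s t L" "step_process s' t' L'"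
  shows "has_bochner_integral lborel (\<lambda>r. \<integral>\<omega>. step_value L r \<omega> \<bullet> step_value L' r \<omega> \<partial>M)
      (\<integral>\<omega>. step_integral L \<omega> \<bullet> step_integral L' \<omega> \<partial>M)"
  using assms(1)
proof (induction L)
  case (Cons p L)
  obtain l u A where p: "p = (l, u, A)" by (cases p)
  have A: "0 \<le> l" "l \<le> u" "L2 M A" "A \<in> borel_measurable (F l)" and L: "step_process s t L"
    using Cons.prems by (auto simp: p step_simps)
  have LA: "L2 M (\<lambda>\<omega>. indicator {l<..u} r *\<^sub>R A \<omega>)" for r by (intro L2_scaleR A)
  note IA = L2_matvec_increment[OF A(3,4,1,2)]
  have "has_bochner_integral lborel (\<lambda>r. \<integral>\<omega>. (indicator {l<..u} r *\<^sub>R A \<omega>) \<bullet> step_value L' r \<omega> \<partial>M)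
      (\<integral>\<omega>. (A \<omega> *v (W u \<omega> - W l \<omega>)) \<bullet> step_integral L' \<omega> \<partial>M)"
    using assms(2)
  proof (induction L')
    case (Cons p' L')
    obtain l' u' B where p': "p' = (l', u', B)" by (cases p')
    have B: "0 \<le> l'" "l' \<le> u'" "L2 M B" "B \<in> borel_measurable (F l')" and L': "step_process s' t' L'"
      using Cons.prems by (auto simp: p' step_simps)
    have LB: "L2 M (\<lambda>\<omega>. indicator {l'<..u'} r *\<^sub>R B \<omega>)" for r by (intro L2_scaleR B)
    have "emeasure lborel ({l<..u} \<inter> {l'<..u'}) \<le> emeasure lborel {l<..u}"
      by (intro emeasure_mono) auto
    then have fin: "emeasure lborel ({l<..u} \<inter> {l'<..u'}) < \<infinity>"
      using A(2) by (simp add: le_less_trans)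
    have hb: "has_bochner_integral lborel (\<lambda>r. indicator ({l<..u} \<inter> {l'<..u'}) r * (\<integral>\<omega>. A \<omega> \<bullet> B \<omega> \<partial>M))
        (measure lborel ({l<..u} \<inter> {l'<..u'}) * (\<integral>\<omega>. A \<omega> \<bullet> B \<omega> \<partial>M))"
      using fin by (intro has_bochner_integral_mult_left has_bochner_integral_real_indicator) auto
    have e: "(\<integral>\<omega>. (indicator {l<..u} r *\<^sub>R A \<omega>) \<bullet> (indicator {l'<..u'} r *\<^sub>R B \<omega>) \<partial>M)
        = indicator ({l<..u} \<inter> {l'<..u'}) r * (\<integral>\<omega>. A \<omega> \<bullet> B \<omega> \<partial>M)" for r
      by (cases "r \<in> {l<..u}"; cases "r \<in> {l'<..u'}") simp_all
    have 1: "has_bochner_integral lborel (\<lambda>r. \<integral>\<omega>. (indicator {l<..u} r *\<^sub>R A \<omega>) \<bullet> (indicator {l'<..u'} r *\<^sub>R B \<omega>) \<partial>M)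
        (\<integral>\<omega>. (A \<omega> *v (W u \<omega> - W l \<omega>)) \<bullet> (B \<omega> *v (W u' \<omega> - W l' \<omega>)) \<partial>M)"
      unfolding increments_inner[OF A(3,4) B(3,4) A(1,2) B(1,2)] e by (rule hb)
    have 2: "(\<integral>\<omega>. (indicator {l<..u} r *\<^sub>R A \<omega>) \<bullet> step_value (p' # L') r \<omega> \<partial>M)
        = (\<integral>\<omega>. (indicator {l<..u} r *\<^sub>R A \<omega>) \<bullet> (indicator {l'<..u'} r *\<^sub>R B \<omega>) \<partial>M)
          + (\<integral>\<omega>. (indicator {l<..u} r *\<^sub>R A \<omega>) \<bullet> step_value L' r \<omega> \<partial>M)" for r
      unfolding p' step_simps inner_right_distrib
      by (intro Bochner_Integration.integral_add L2_inner LA LB L2_step[OF L'])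
    have 3: "(\<integral>\<omega>. (A \<omega> *v (W u \<omega> - W l \<omega>)) \<bullet> step_integral (p' # L') \<omega> \<partial>M)
        = (\<integral>\<omega>. (A \<omega> *v (W u \<omega> - W l \<omega>)) \<bullet> (B \<omega> *v (W u' \<omega> - W l' \<omega>)) \<partial>M)
          + (\<integral>\<omega>. (A \<omega> *v (W u \<omega> - W l \<omega>)) \<bullet> step_integral L' \<omega> \<partial>M)"
      unfolding p' step_simps inner_right_distrib
      by (intro Bochner_Integration.integral_add L2_inner IA L2_matvec_increment B L2_step[OF L'])
    show ?case unfolding 2 3 by (rule has_bochner_integral_add[OF 1 Cons.IH[OF L']])
  qed (simp add: step_simps has_bochner_integral_zero)
  note 1 = this
  have 2: "(\<integral>\<omega>. step_value (p # L) r \<omega> \<bullet> step_value L' r \<omega> \<partial>M)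
      = (\<integral>\<omega>. (indicator {l<..u} r *\<^sub>R A \<omega>) \<bullet> step_value L' r \<omega> \<partial>M)
        + (\<integral>\<omega>. step_value L r \<omega> \<bullet> step_value L' r \<omega> \<partial>M)" for r
    unfolding p step_simps inner_left_distrib
    by (intro Bochner_Integration.integral_add L2_inner LA L2_step[OF assms(2)] L2_step[OF L])
  have 3: "(\<integral>\<omega>. step_integral (p # L) \<omega> \<bullet> step_integral L' \<omega> \<partial>M)
      = (\<integral>\<omega>. (A \<omega> *v (W u \<omega> - W l \<omega>)) \<bullet> step_integral L' \<omega> \<partial>M)
        + (\<integral>\<omega>. step_integral L \<omega> \<bullet> step_integral L' \<omega> \<partial>M)"
    unfolding p step_simps inner_left_distrib
    by (intro Bochner_Integration.integral_add L2_inner IA L2_step[OF assms(2)] L2_step[OF L])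
  show ?case unfolding 2 3 by (rule has_bochner_integral_add[OF 1 Cons.IH[OF L]])
qed (simp add: step_simps has_bochner_integral_zero)

text \<open>Nonnegative integrals match the form in which the Ito integral is defined and ask for no
  integrability when limits are taken.\<close>

lemma step_isometry:
  assumes L: "step_process s t L"
  shows "(\<integral>\<^sup>+\<omega>. ennreal ((norm (step_integral L \<omega>))\<^sup>2) \<partial>M)
      = (\<integral>\<^sup>+r. (\<integral>\<^sup>+\<omega>. ennreal ((norm (step_value L r \<omega>))\<^sup>2) \<partial>M) \<partial>lborel)"
proof -
  note hb = step_integral_inner[OF L L]
  have "(\<integral>\<^sup>+r. (\<integral>\<^sup>+\<omega>. ennreal ((norm (step_value L r \<omega>))\<^sup>2) \<partial>M) \<partial>lborel)
      = (\<integral>\<^sup>+r. ennreal (\<integral>\<omega>. step_value L r \<omega> \<bullet> step_value L r \<omega> \<partial>M) \<partial>lborel)"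
    unfolding L2_nn_integral[OF L2_step(2)[OF L]] by (simp only: power2_norm_eq_inner)
  also have "\<dots> = ennreal (\<integral>r. (\<integral>\<omega>. step_value L r \<omega> \<bullet> step_value L r \<omega> \<partial>M) \<partial>lborel)"
    using hb by (intro nn_integral_eq_integral) (auto simp: has_bochner_integral_iff)
  also have "\<dots> = (\<integral>\<^sup>+\<omega>. ennreal ((norm (step_integral L \<omega>))\<^sup>2) \<partial>M)"
    unfolding L2_nn_integral[OF L2_step(1)[OF L]] has_bochner_integral_integral_eq[OF hb]
    by (simp only: power2_norm_eq_inner)
  finally show ?thesis ..
qed

text \<open>Bounded coefficients are square integrable on a probability space, so simple integrands
  become step processes; the partition behind them is forgotten from here on.\<close>

lemma ito_step_approximation:
  assumes "has_ito_integral M F W H T I" "0 \<le> T"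
  obtains L where "\<And>n. step_process 0 T (L n)"
    "(\<lambda>n. \<integral>\<^sup>+s\<in>{0..T}. (\<integral>\<^sup>+\<omega>. ennreal ((norm (H s \<omega> - step_value (L n) s \<omega>))\<^sup>2) \<partial>M) \<partial>lborel) \<longlonglongrightarrow> 0"
    "(\<lambda>n. \<integral>\<^sup>+\<omega>. ennreal ((norm (I \<omega> - step_integral (L n) \<omega>))\<^sup>2) \<partial>M) \<longlonglongrightarrow> 0"
proof -
  obtain m \<tau> A where si: "\<And>n. simple_integrand F T (m n) (\<tau> n) (A n)"
    and lim: "(\<lambda>n. \<integral>\<^sup>+s\<in>{0..T}. (\<integral>\<^sup>+\<omega>. ennreal ((norm (H s \<omega> - simple_value (m n) (\<tau> n) (A n) s \<omega>))\<^sup>2) \<partial>M)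
               \<partial>lborel) \<longlonglongrightarrow> 0"
        "(\<lambda>n. \<integral>\<^sup>+\<omega>. ennreal ((norm (I \<omega> - simple_integral W (m n) (\<tau> n) (A n) \<omega>))\<^sup>2) \<partial>M) \<longlonglongrightarrow> 0"
    using assms by (auto simp: has_ito_integral_def)
  define L where "L n = map (\<lambda>i. (\<tau> n i, \<tau> n (Suc i), A n i)) [0..<m n]" for n
  have "step_process 0 T (L n)" for n
  proof -
    have st: "0 \<le> \<tau> n 0" "\<And>i. i < m n \<Longrightarrow> \<tau> n i \<le> \<tau> n (Suc i)" "\<tau> n (m n) \<le> T"
      "\<And>i. i < m n \<Longrightarrow> A n i \<in> borel_measurable (F (\<tau> n i))"
      "\<And>i. i < m n \<Longrightarrow> \<exists>K. \<forall>\<omega>\<in>space (F (\<tau> n i)). norm (A n i \<omega>) \<le> K"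
      using si[of n] by (auto simp: simple_integrand_def)
    have mono: "i \<le> j \<Longrightarrow> j \<le> m n \<Longrightarrow> \<tau> n i \<le> \<tau> n j" for i j
    proof (induction j rule: dec_induct)
      case (step k) then show ?case using st(2)[of k] by simp
    qed simp
    have nn: "0 \<le> \<tau> n i" "\<tau> n i \<le> T" if "i \<le> m n" for i
      using mono[of 0 i] mono[of i "m n"] st(1,3) that by auto
    have "L2 M (A n i)" if i: "i < m n" for i
    proof -
      have sp: "space (F (\<tau> n i)) = space M"
        using subalg[of "\<tau> n i"] nn(1)[of i] i by (simp add: subalgebra_def)
      obtain K where K: "\<And>\<omega>. \<omega> \<in> space M \<Longrightarrow> norm (A n i \<omega>) \<le> K"
        using st(5)[OF i] unfolding sp by blast
      show ?thesis
      proof (rule L2_bound[where g="\<lambda>_. K\<^sup>2"])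
        show "A n i \<in> borel_measurable M"
          using F_measurable_M[OF _ st(4)[OF i]] nn(1)[of i] i by simp
        show "(norm (A n i \<omega>))\<^sup>2 \<le> K\<^sup>2" if "\<omega> \<in> space M" for \<omega>
          using K[OF that] by (intro power_mono) auto
      qed simp
    qed
    then show ?thesis
      using nn st(2,4) by (auto simp: L_def step_process_def)
  qed
  moreover have "simple_value (m n) (\<tau> n) (A n) = step_value (L n)" for n
    by (intro ext) (simp add: simple_value_def step_value_def L_def comp_def
        interv_sum_list_conv_sum_set_nat atLeast0LessThan)
  moreover have "simple_integral W (m n) (\<tau> n) (A n) = step_integral (L n)" for n
    by (intro ext) (simp add: simple_integral_def step_integral_def L_def comp_def
        interv_sum_list_conv_sum_set_nat atLeast0LessThan)
  ultimately show thesis using lim that[of L] by simp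
qed

lemma ito_integral_L2:
  assumes "has_ito_integral M F W H T I" "0 \<le> T"
  shows "L2 M I"
proof -
  obtain L where L: "\<And>n. step_process 0 T (L n)"
    and "(\<lambda>n. \<integral>\<^sup>+s\<in>{0..T}. (\<integral>\<^sup>+\<omega>. ennreal ((norm (H s \<omega> - step_value (L n) s \<omega>))\<^sup>2) \<partial>M) \<partial>lborel) \<longlonglongrightarrow> 0"
    and lim: "(\<lambda>n. \<integral>\<^sup>+\<omega>. ennreal ((norm (I \<omega> - step_integral (L n) \<omega>))\<^sup>2) \<partial>M) \<longlonglongrightarrow> 0"
    by (rule ito_step_approximation[OF assms]) (rule that)
  have I: "I \<in> borel_measurable M" using assms by (simp add: has_ito_integral_def)
  \<comment> \<open>Some step integral lies at squared distance below 1, and it is itself square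
    integrable.\<close>
  obtain n where n: "(\<integral>\<^sup>+\<omega>. ennreal ((norm (I \<omega> - step_integral (L n) \<omega>))\<^sup>2) \<partial>M) < 1"
    using order_tendstoD(2)[OF lim, of 1] by (auto simp: eventually_sequentially)
  have "L2 M (\<lambda>\<omega>. I \<omega> - step_integral (L n) \<omega>)"
    by (intro L2_of_nn_integral borel_measurable_diff I L2_measurable[OF L2_step(1)[OF L]] less_trans[OF n])
      simp
  from L2_add[OF this L2_step(1)[OF L, of n]] show ?thesis by simp
qed

end


section \<open>Increments of the Ito integral\<close>

lemma nn_integral_norm_add_sq_le:
  fixes f g :: "'a \<Rightarrow> 'b::euclidean_space"
  assumes [measurable]: "f \<in> borel_measurable M" "g \<in> borel_measurable M"
  shows "(\<integral>\<^sup>+x. ennreal ((norm (f x + g x))\<^sup>2) \<partial>M)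
      \<le> 2 * (\<integral>\<^sup>+x. ennreal ((norm (f x))\<^sup>2) \<partial>M) + 2 * (\<integral>\<^sup>+x. ennreal ((norm (g x))\<^sup>2) \<partial>M)"
proof -
  have "ennreal ((norm (f x + g x))\<^sup>2) \<le> 2 * ennreal ((norm (f x))\<^sup>2) + 2 * ennreal ((norm (g x))\<^sup>2)" for x
  proof -
    have "ennreal ((norm (f x + g x))\<^sup>2) \<le> ennreal (2 * (norm (f x))\<^sup>2 + 2 * (norm (g x))\<^sup>2)"
      by (intro ennreal_leI norm_add_sq_le)
    then show ?thesis by (simp add: ennreal_mult')
  qed
  then have "(\<integral>\<^sup>+x. ennreal ((norm (f x + g x))\<^sup>2) \<partial>M)
      \<le> (\<integral>\<^sup>+x. 2 * ennreal ((norm (f x))\<^sup>2) + 2 * ennreal ((norm (g x))\<^sup>2) \<partial>M)"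
    by (intro nn_integral_mono)
  then show ?thesis by (simp add: nn_integral_add nn_integral_cmult)
qed

lemma nn_integral_norm_diff_sq_le:
  fixes f g :: "'a \<Rightarrow> 'b::euclidean_space"
  assumes [measurable]: "f \<in> borel_measurable M" "g \<in> borel_measurable M"
  shows "(\<integral>\<^sup>+x. ennreal ((norm (f x - g x))\<^sup>2) \<partial>M)
      \<le> 2 * (\<integral>\<^sup>+x. ennreal ((norm (f x))\<^sup>2) \<partial>M) + 2 * (\<integral>\<^sup>+x. ennreal ((norm (g x))\<^sup>2) \<partial>M)"
  using nn_integral_norm_add_sq_le[of f M "\<lambda>x. - g x"] by simp

text \<open>Cauchy-Schwarz against the constant 1 on the interval, whence the factor
  \<open>t - s\<close>.\<close>

lemma ennreal_norm_set_integral_sq_le: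
  fixes f :: "real \<Rightarrow> 'b::euclidean_space"
  assumes f: "f \<in> borel_measurable lborel" and st: "s \<le> t"
  shows "ennreal ((norm (LINT r:{s<..t}|lborel. f r))\<^sup>2)
      \<le> ennreal (t - s) * (\<integral>\<^sup>+r\<in>{s<..t}. ennreal ((norm (f r))\<^sup>2) \<partial>lborel)"
\<comment> \<open>Without integrability the Bochner integral is 0 by convention.\<close>
proof (cases "set_integrable lborel {s<..t} f")
  case False
  then show ?thesis by (simp add: set_lebesgue_integral_def set_integrable_def not_integrable_integral_eq)
next
  case True
  note [measurable] = f
  have "ennreal (norm (LINT r:{s<..t}|lborel. f r))
      \<le> (\<integral>\<^sup>+r. ennreal (norm (indicator {s<..t} r *\<^sub>R f r)) \<partial>lborel)"
    using True unfolding set_lebesgue_integral_def set_integrable_def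
    by (rule integral_norm_bound_ennreal)
  also have "\<dots> = (\<integral>\<^sup>+r. ennreal (indicator {s<..t} r * norm (f r)) * indicator {s<..t} r \<partial>lborel)"
    by (intro nn_integral_cong) (auto simp: indicator_def)
  finally have "(ennreal (norm (LINT r:{s<..t}|lborel. f r)))\<^sup>2
      \<le> (\<integral>\<^sup>+r. ennreal (indicator {s<..t} r * norm (f r)) * indicator {s<..t} r \<partial>lborel)\<^sup>2"
    by (intro power_mono) auto
  also have "\<dots> \<le> (\<integral>\<^sup>+r. (ennreal (indicator {s<..t} r * norm (f r)))\<^sup>2 \<partial>lborel)
      * (\<integral>\<^sup>+r. (indicator {s<..t} r)\<^sup>2 \<partial>lborel)"
    by (rule Cauchy_Schwarz_nn_integral) measurable
  also have "(\<integral>\<^sup>+r. (ennreal (indicator {s<..t} r * norm (f r)))\<^sup>2 \<partial>lborel)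
      = (\<integral>\<^sup>+r\<in>{s<..t}. ennreal ((norm (f r))\<^sup>2) \<partial>lborel)"
    by (intro nn_integral_cong) (auto simp: indicator_def ennreal_power)
  also have "(\<integral>\<^sup>+r. (indicator {s<..t} r)\<^sup>2 \<partial>lborel) = (\<integral>\<^sup>+r. indicator {s<..t} r \<partial>(lborel::real measure))"
    by (intro nn_integral_cong) (auto simp: indicator_def)
  also have "\<dots> = ennreal (t - s)"
    using st by simp
  finally show ?thesis by (simp add: ennreal_power mult.commute)
qed

section \<open>Limits of step approximations for increments\<close>

context brownian_motion
begin

text \<open>Clamping the time to \<open>[0, t]\<close> extends the integrand to the whole line with
  the joint measurability that Tonelli's theorem requires, and leaves it unchanged on
  \<open>[0, t]\<close>.\<close>

lemma progressive_joint_measurable: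
  assumes "progressively_measurable F H" "0 \<le> t"
  shows "(\<lambda>(r, \<omega>). H (max 0 (min t r)) \<omega>) \<in> borel_measurable (lborel \<Otimes>\<^sub>M M)"
proof -
  have id: "(\<lambda>\<omega>. \<omega>) \<in> M \<rightarrow>\<^sub>M F t"
    using F_measurable_M[OF assms(2), of "\<lambda>\<omega>. \<omega>" "F t"] by simp
  have "(\<lambda>p. max 0 (min t (fst p))) \<in> lborel \<Otimes>\<^sub>M M \<rightarrow>\<^sub>M restrict_space borel {0..t}"
    using assms(2) by (intro measurable_restrict_space2) auto
  moreover have "snd \<in> lborel \<Otimes>\<^sub>M M \<rightarrow>\<^sub>M F t"
    by (rule measurable_compose[OF measurable_snd id])
  ultimately have "(\<lambda>p. (max 0 (min t (fst p)), snd p)) \<in> lborel \<Otimes>\<^sub>M M \<rightarrow>\<^sub>M restrict_space borel {0..t} \<Otimes>\<^sub>M F t"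
    by (rule measurable_Pair)
  moreover have "(\<lambda>(s, \<omega>). H s \<omega>) \<in> borel_measurable (restrict_space borel {0..t} \<Otimes>\<^sub>M F t)"
    using assms by (simp add: progressively_measurable_def)
  ultimately show ?thesis
    using measurable_compose by (fastforce simp: case_prod_beta)
qed

lemma measurable_second_moment:
  fixes G :: "real \<Rightarrow> 'w \<Rightarrow> 'b::euclidean_space"
  assumes "(\<lambda>(r, \<omega>). G r \<omega>) \<in> borel_measurable (lborel \<Otimes>\<^sub>M M)"
  shows "(\<lambda>r. \<integral>\<^sup>+\<omega>. ennreal ((norm (G r \<omega>))\<^sup>2) \<partial>M) \<in> borel_measurable lborel"
proof -
  have "(\<lambda>(r, \<omega>). ennreal ((norm (G r \<omega>))\<^sup>2)) \<in> borel_measurable (lborel \<Otimes>\<^sub>M M)"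
    using assms by (simp add: case_prod_beta)
  then show ?thesis by (rule borel_measurable_nn_integral)
qed

lemma section_measurable:
  assumes "(\<lambda>(r, \<omega>). G r \<omega>) \<in> borel_measurable (lborel \<Otimes>\<^sub>M M)"
  shows "G r \<in> borel_measurable M"
  using measurable_compose[OF measurable_Pair1' assms, of r] by simp

text \<open>The approximations \<open>L\<close> on \<open>[0, t]\<close> and \<open>L'\<close> on
  \<open>[0, s]\<close> are unrelated. The increment is approximated by the part \<open>J\<close> of
  \<open>L\<close> after \<open>s\<close>. What is left, \<open>L - L' - J\<close>, lives on times
  up to \<open>s\<close>, where \<open>L\<close> and \<open>L'\<close> approximate the same
  integrand, so the isometry makes its integral small.\<close>

lemma ito_increment_approximation:
  fixes G :: "real \<Rightarrow> 'w \<Rightarrow> real^'d^'d"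
  assumes I: "has_ito_integral M F W H s I" and I': "has_ito_integral M F W H t I'"
    and st: "0 \<le> s" "s \<le> t"
    and G: "(\<lambda>(r, \<omega>). G r \<omega>) \<in> borel_measurable (lborel \<Otimes>\<^sub>M M)"
    and GH: "\<And>r \<omega>. r \<in> {0..t} \<Longrightarrow> G r \<omega> = H r \<omega>"
  obtains J where "\<And>n. step_process s t (J n)"
    "(\<lambda>n. \<integral>\<^sup>+r\<in>{s<..t}. (\<integral>\<^sup>+\<omega>. ennreal ((norm (G r \<omega> - step_value (J n) r \<omega>))\<^sup>2) \<partial>M) \<partial>lborel) \<longlonglongrightarrow> 0"
    "(\<lambda>n. \<integral>\<^sup>+\<omega>. ennreal ((norm (I' \<omega> - I \<omega> - step_integral (J n) \<omega>))\<^sup>2) \<partial>M) \<longlonglongrightarrow> 0"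
proof -
  let ?N = "\<lambda>f. \<integral>\<^sup>+\<omega>. ennreal ((norm (f \<omega>))\<^sup>2) \<partial>M"
  obtain L where L: "\<And>n. step_process 0 t (L n)"
    and L1: "(\<lambda>n. \<integral>\<^sup>+r\<in>{0..t}. ?N (\<lambda>\<omega>. H r \<omega> - step_value (L n) r \<omega>) \<partial>lborel) \<longlonglongrightarrow> 0"
    and L2: "(\<lambda>n. ?N (\<lambda>\<omega>. I' \<omega> - step_integral (L n) \<omega>)) \<longlonglongrightarrow> 0"
    by (rule ito_step_approximation[OF I' order_trans[OF st]]) (rule that)
  obtain L' where L': "\<And>n. step_process 0 s (L' n)"
    and L'1: "(\<lambda>n. \<integral>\<^sup>+r\<in>{0..s}. ?N (\<lambda>\<omega>. H r \<omega> - step_value (L' n) r \<omega>) \<partial>lborel) \<longlonglongrightarrow> 0"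
    and L'2: "(\<lambda>n. ?N (\<lambda>\<omega>. I \<omega> - step_integral (L' n) \<omega>)) \<longlonglongrightarrow> 0"
    by (rule ito_step_approximation[OF I st(1)]) (rule that)
  have Im: "I \<in> borel_measurable M" "I' \<in> borel_measurable M"
    using I I' by (auto simp: has_ito_integral_def)
  define J where "J n = step_after s (L n)" for n
  have J: "step_process s t (J n)" for n
    unfolding J_def by (rule step_process_after[OF L st])
  define x where "x n = (\<integral>\<^sup>+r\<in>{0..t}. ?N (\<lambda>\<omega>. G r \<omega> - step_value (L n) r \<omega>) \<partial>lborel)" for n
  define y where "y n = (\<integral>\<^sup>+r\<in>{0..s}. ?N (\<lambda>\<omega>. G r \<omega> - step_value (L' n) r \<omega>) \<partial>lborel)" for n
  have x: "x \<longlonglongrightarrow> 0"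
  proof -
    have "x = (\<lambda>n. \<integral>\<^sup>+r\<in>{0..t}. ?N (\<lambda>\<omega>. H r \<omega> - step_value (L n) r \<omega>) \<partial>lborel)"
      unfolding x_def[abs_def] by (intro ext nn_integral_cong) (auto simp: GH indicator_def)
    then show ?thesis using L1 by simp
  qed
  have y: "y \<longlonglongrightarrow> 0"
  proof -
    have "y = (\<lambda>n. \<integral>\<^sup>+r\<in>{0..s}. ?N (\<lambda>\<omega>. H r \<omega> - step_value (L' n) r \<omega>) \<partial>lborel)"
      unfolding y_def[abs_def] using st by (intro ext nn_integral_cong) (auto simp: GH indicator_def)
    then show ?thesis using L'1 by simp
  qed
  have mG: "(\<lambda>(r, \<omega>). G r \<omega> - step_value K r \<omega>) \<in> borel_measurable (lborel \<Otimes>\<^sub>M M)"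
    if "step_process s' t' K" for K s' t'
    using G measurable_step_value[OF that] by (simp add: case_prod_beta)
  note mN = measurable_second_moment[OF mG]
  have 1: "(\<integral>\<^sup>+r\<in>{s<..t}. ?N (\<lambda>\<omega>. G r \<omega> - step_value (J n) r \<omega>) \<partial>lborel) \<le> x n" for n
    unfolding x_def using st
    by (intro nn_integral_mono) (auto simp: indicator_def J_def step_value_after)
  define K where "K n = L n @ step_uminus (L' n @ J n)" for n
  have K: "step_process 0 t (K n)" for n
    unfolding K_def step_append
    by (intro conjI L step_uminus(3)) (simp add: step_append step_process_mono[OF L'] step_process_mono[OF J] st)
  have K_int: "step_integral (K n) \<omega> = step_integral (L n) \<omega> - step_integral (L' n) \<omega> - step_integral (J n) \<omega>" for n \<omega>
    by (simp add: K_def step_append step_uminus)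
  \<comment> \<open>After \<open>s\<close> the process \<open>L\<close> is cancelled by
    \<open>J\<close>; up to \<open>s\<close>, inserting \<open>G\<close> exhibits two approximation
    errors.\<close>
  have K_val: "step_value (K n) r \<omega> = indicator {0<..s} r *\<^sub>R
      ((G r \<omega> - step_value (L' n) r \<omega>) - (G r \<omega> - step_value (L n) r \<omega>))" for n r \<omega>
  proof -
    have "step_value (L n) r \<omega> = 0" "step_value (J n) r \<omega> = 0" if "r \<le> 0"
      using that st by (auto intro: step_value_outside[OF L] step_value_outside[OF J])
    moreover have "step_value (L' n) r \<omega> = 0" if "r \<le> 0 \<or> r > s"
      using that by (auto intro: step_value_outside[OF L'])
    ultimately show ?thesis
      by (cases "r \<le> 0"; cases "r > s") (auto simp: K_def step_append step_uminus J_def step_value_after)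
  qed
  have 2: "?N (step_integral (K n)) \<le> 2 * y n + 2 * x n" for n
  proof -
    have "?N (step_integral (K n)) = (\<integral>\<^sup>+r. ?N (\<lambda>\<omega>. step_value (K n) r \<omega>) \<partial>lborel)"
      by (rule step_isometry[OF K])
    also have "\<dots> \<le> (\<integral>\<^sup>+r. 2 * (?N (\<lambda>\<omega>. G r \<omega> - step_value (L' n) r \<omega>) * indicator {0..s} r)
        + 2 * (?N (\<lambda>\<omega>. G r \<omega> - step_value (L n) r \<omega>) * indicator {0..t} r) \<partial>lborel)"
    proof (intro nn_integral_mono)
      fix r :: real
      show "?N (\<lambda>\<omega>. step_value (K n) r \<omega>) \<le> 2 * (?N (\<lambda>\<omega>. G r \<omega> - step_value (L' n) r \<omega>) * indicator {0..s} r)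
        + 2 * (?N (\<lambda>\<omega>. G r \<omega> - step_value (L n) r \<omega>) * indicator {0..t} r)"
      proof (cases "r \<in> {0<..s}")
        case True
        then show ?thesis
          using st nn_integral_norm_diff_sq_le[OF section_measurable[OF mG[OF L']] section_measurable[OF mG[OF L]], of r n r n]
          by (simp add: K_val)
      qed (simp add: K_val)
    qed
    also have "\<dots> = 2 * y n + 2 * x n"
      unfolding x_def y_def using mN[OF L'] mN[OF L]
      by (subst nn_integral_add) (auto simp: nn_integral_cmult)
    finally show ?thesis .
  qed
  have 3: "?N (\<lambda>\<omega>. I' \<omega> - I \<omega> - step_integral (J n) \<omega>)
      \<le> 2 * ?N (\<lambda>\<omega>. I' \<omega> - step_integral (L n) \<omega>) + 2 * (2 * (2 * y n + 2 * x n)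
        + 2 * ?N (\<lambda>\<omega>. I \<omega> - step_integral (L' n) \<omega>))" for n
  proof -
    have m: "(\<lambda>\<omega>. I' \<omega> - step_integral (L n) \<omega>) \<in> borel_measurable M"
      "step_integral (K n) \<in> borel_measurable M" "(\<lambda>\<omega>. I \<omega> - step_integral (L' n) \<omega>) \<in> borel_measurable M"
      by (intro borel_measurable_diff Im L2_measurable L2_step(1)[OF L] L2_step(1)[OF K] L2_step(1)[OF L'])+
    have "?N (\<lambda>\<omega>. I' \<omega> - I \<omega> - step_integral (J n) \<omega>)
        = ?N (\<lambda>\<omega>. (I' \<omega> - step_integral (L n) \<omega>) + (step_integral (K n) \<omega> - (I \<omega> - step_integral (L' n) \<omega>)))"
      by (simp add: K_int algebra_simps)
    also have "\<dots> \<le> 2 * ?N (\<lambda>\<omega>. I' \<omega> - step_integral (L n) \<omega>)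
        + 2 * ?N (\<lambda>\<omega>. step_integral (K n) \<omega> - (I \<omega> - step_integral (L' n) \<omega>))"
      by (intro nn_integral_norm_add_sq_le m borel_measurable_diff[OF m(2,3)])
    also have "\<dots> \<le> 2 * ?N (\<lambda>\<omega>. I' \<omega> - step_integral (L n) \<omega>)
        + 2 * (2 * ?N (step_integral (K n)) + 2 * ?N (\<lambda>\<omega>. I \<omega> - step_integral (L' n) \<omega>))"
      by (intro add_left_mono mult_left_mono nn_integral_norm_diff_sq_le m) auto
    also have "\<dots> \<le> 2 * ?N (\<lambda>\<omega>. I' \<omega> - step_integral (L n) \<omega>)
        + 2 * (2 * (2 * y n + 2 * x n) + 2 * ?N (\<lambda>\<omega>. I \<omega> - step_integral (L' n) \<omega>))"
      by (intro add_left_mono mult_left_mono add_right_mono 2) auto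
    finally show ?thesis .
  qed
  have "(\<lambda>n. 2 * ?N (\<lambda>\<omega>. I' \<omega> - step_integral (L n) \<omega>) + 2 * (2 * (2 * y n + 2 * x n)
        + 2 * ?N (\<lambda>\<omega>. I \<omega> - step_integral (L' n) \<omega>))) \<longlonglongrightarrow> 2 * 0 + 2 * (2 * (2 * 0 + 2 * 0) + 2 * 0)"
    by (intro tendsto_add ennreal_tendsto_cmult L2 L'2 x y) auto
  then have lim: "(\<lambda>n. 2 * ?N (\<lambda>\<omega>. I' \<omega> - step_integral (L n) \<omega>) + 2 * (2 * (2 * y n + 2 * x n)
        + 2 * ?N (\<lambda>\<omega>. I \<omega> - step_integral (L' n) \<omega>))) \<longlonglongrightarrow> 0"
    by simp
  show thesis
  proof (rule that[OF J])
    show "(\<lambda>n. \<integral>\<^sup>+r\<in>{s<..t}. ?N (\<lambda>\<omega>. G r \<omega> - step_value (J n) r \<omega>) \<partial>lborel) \<longlonglongrightarrow> 0"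
      by (rule tendsto_sandwich[OF _ _ tendsto_const x]) (auto intro: always_eventually 1)
    show "(\<lambda>n. ?N (\<lambda>\<omega>. I' \<omega> - I \<omega> - step_integral (J n) \<omega>)) \<longlonglongrightarrow> 0"
      by (rule tendsto_sandwich[OF always_eventually[OF allI] always_eventually[OF allI[OF 3]] tendsto_const lim])
        simp
  qed
qed

lemma ito_increment_L2:
  assumes "has_ito_integral M F W H s I" "has_ito_integral M F W H t I'" "0 \<le> s" "s \<le> t"
  shows "L2 M (\<lambda>\<omega>. I' \<omega> - I \<omega>)"
  using L2_diff[OF ito_integral_L2[OF assms(2)] ito_integral_L2[OF assms(1)]] assms(3,4) by simp

text \<open>The integral of \<open>J n\<close> minus the single step \<open>A\<close> is known by
  isometry. The square of a sum is split twice, once for the integral and once for the integrand,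
  each time at the cost of a factor 2; this makes the constant 4.\<close>

lemma ito_increment_bound:
  fixes G :: "real \<Rightarrow> 'w \<Rightarrow> real^'d^'d"
  assumes I: "has_ito_integral M F W H s I" and I': "has_ito_integral M F W H t I'"
    and st: "0 \<le> s" "s \<le> t"
    and G: "(\<lambda>(r, \<omega>). G r \<omega>) \<in> borel_measurable (lborel \<Otimes>\<^sub>M M)"
    and GH: "\<And>r \<omega>. r \<in> {0..t} \<Longrightarrow> G r \<omega> = H r \<omega>"
    and A: "L2 M A" "A \<in> borel_measurable (F s)"
  shows "(\<integral>\<^sup>+\<omega>. ennreal ((norm (I' \<omega> - I \<omega> - A \<omega> *v (W t \<omega> - W s \<omega>)))\<^sup>2) \<partial>M)
      \<le> 4 * (\<integral>\<^sup>+r\<in>{s<..t}. (\<integral>\<^sup>+\<omega>. ennreal ((norm (G r \<omega> - A \<omega>))\<^sup>2) \<partial>M) \<partial>lborel)" (is "?lhs \<le> 4 * ?c")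
proof -
  let ?N = "\<lambda>f. \<integral>\<^sup>+\<omega>. ennreal ((norm (f \<omega>))\<^sup>2) \<partial>M"
  obtain J where J: "\<And>n. step_process s t (J n)"
    and J1: "(\<lambda>n. \<integral>\<^sup>+r\<in>{s<..t}. ?N (\<lambda>\<omega>. G r \<omega> - step_value (J n) r \<omega>) \<partial>lborel) \<longlonglongrightarrow> 0"
    and J2: "(\<lambda>n. ?N (\<lambda>\<omega>. I' \<omega> - I \<omega> - step_integral (J n) \<omega>)) \<longlonglongrightarrow> 0"
    by (rule ito_increment_approximation[OF I I' st G GH]) (assumption, rule that)
  define y where "y n = (\<integral>\<^sup>+r\<in>{s<..t}. ?N (\<lambda>\<omega>. G r \<omega> - step_value (J n) r \<omega>) \<partial>lborel)" for n
  define K where "K n = J n @ step_uminus [(s, t, A)]" for n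
  have K: "step_process s t (K n)" for n
    unfolding K_def step_append by (intro conjI J step_uminus(3)) (use A st in \<open>simp add: step_simps\<close>)
  have K_int: "step_integral (K n) \<omega> = step_integral (J n) \<omega> - A \<omega> *v (W t \<omega> - W s \<omega>)" for n \<omega>
    by (simp add: K_def step_append step_uminus) (simp add: step_simps)
  have K_val: "step_value (K n) r \<omega> = indicator {s<..t} r *\<^sub>R ((G r \<omega> - A \<omega>) - (G r \<omega> - step_value (J n) r \<omega>))" for n r \<omega>
    using step_value_outside[OF J, of r n \<omega>]
    by (cases "r \<in> {s<..t}") (simp_all add: K_def step_append step_uminus, simp_all add: step_simps)
  have Am: "A \<in> borel_measurable M" using A by (simp add: L2_def)
  have mG: "(\<lambda>(r, \<omega>). G r \<omega> - step_value (J n) r \<omega>) \<in> borel_measurable (lborel \<Otimes>\<^sub>M M)" for n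
    using G measurable_step_value[OF J] by (simp add: case_prod_beta)
  have mA: "(\<lambda>(r, \<omega>). G r \<omega> - A \<omega>) \<in> borel_measurable (lborel \<Otimes>\<^sub>M M)"
    using G Am by (simp add: case_prod_beta)
  have 1: "?N (step_integral (K n)) \<le> 2 * ?c + 2 * y n" for n
  proof -
    have "?N (step_integral (K n)) = (\<integral>\<^sup>+r. ?N (\<lambda>\<omega>. step_value (K n) r \<omega>) \<partial>lborel)"
      by (rule step_isometry[OF K])
    also have "\<dots> \<le> (\<integral>\<^sup>+r. 2 * (?N (\<lambda>\<omega>. G r \<omega> - A \<omega>) * indicator {s<..t} r)
        + 2 * (?N (\<lambda>\<omega>. G r \<omega> - step_value (J n) r \<omega>) * indicator {s<..t} r) \<partial>lborel)"
    proof (intro nn_integral_mono)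
      fix r :: real
      show "?N (\<lambda>\<omega>. step_value (K n) r \<omega>) \<le> 2 * (?N (\<lambda>\<omega>. G r \<omega> - A \<omega>) * indicator {s<..t} r)
        + 2 * (?N (\<lambda>\<omega>. G r \<omega> - step_value (J n) r \<omega>) * indicator {s<..t} r)"
      proof (cases "r \<in> {s<..t}")
        case True
        then show ?thesis
          using nn_integral_norm_diff_sq_le[OF section_measurable[OF mA] section_measurable[OF mG], of r r n]
          by (simp add: K_val)
      qed (simp add: K_val)
    qed
    also have "\<dots> = 2 * ?c + 2 * y n"
      unfolding y_def using measurable_second_moment[OF mA] measurable_second_moment[OF mG[of n]]
      by (subst nn_integral_add) (auto simp: nn_integral_cmult)
    finally show ?thesis .
  qed
  have 2: "?lhs \<le> 2 * ?N (\<lambda>\<omega>. I' \<omega> - I \<omega> - step_integral (J n) \<omega>) + 2 * (2 * ?c + 2 * y n)" for n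
  proof -
    have m: "(\<lambda>\<omega>. I' \<omega> - I \<omega> - step_integral (J n) \<omega>) \<in> borel_measurable M"
      "step_integral (K n) \<in> borel_measurable M"
      by (intro L2_measurable L2_diff[OF ito_increment_L2[OF I I' st]] L2_step(1)[OF J] L2_step(1)[OF K])+
    have "?lhs = ?N (\<lambda>\<omega>. (I' \<omega> - I \<omega> - step_integral (J n) \<omega>) + step_integral (K n) \<omega>)"
      by (simp add: K_int algebra_simps)
    also have "\<dots> \<le> 2 * ?N (\<lambda>\<omega>. I' \<omega> - I \<omega> - step_integral (J n) \<omega>) + 2 * ?N (step_integral (K n))"
      by (intro nn_integral_norm_add_sq_le m)
    also have "\<dots> \<le> 2 * ?N (\<lambda>\<omega>. I' \<omega> - I \<omega> - step_integral (J n) \<omega>) + 2 * (2 * ?c + 2 * y n)"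
      by (intro add_left_mono mult_left_mono 1) auto
    finally show ?thesis .
  qed
  have "(\<lambda>n. 2 * ?N (\<lambda>\<omega>. I' \<omega> - I \<omega> - step_integral (J n) \<omega>) + 2 * (2 * ?c + 2 * y n))
      \<longlonglongrightarrow> 2 * 0 + 2 * (2 * ?c + 2 * 0)"
    using J1 unfolding y_def[symmetric] by (intro tendsto_add ennreal_tendsto_cmult J2 tendsto_const) auto
  then have "?lhs \<le> 2 * 0 + 2 * (2 * ?c + 2 * 0)"
    by (rule LIMSEQ_le_const) (use 2 in auto)
  also have "\<dots> = 4 * ?c" by (simp add: mult.assoc[symmetric])
  finally show ?thesis .
qed

text \<open>All increments of the process start at or after \<open>s\<close>, when \<open>U\<close>
  is already known.\<close>

lemma step_integral_orthogonal:
  fixes U :: "'w \<Rightarrow> real^'d"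
  assumes "step_process s t L" and U: "L2 M U" "U \<in> borel_measurable (F s)" and s: "0 \<le> s"
  shows "(\<integral>\<omega>. U \<omega> \<bullet> step_integral L \<omega> \<partial>M) = 0"
  using assms(1)
proof (induction L)
  case (Cons p L)
  obtain l u A where p: "p = (l, u, A)" by (cases p)
  have A: "0 \<le> l" "l \<le> u" "L2 M A" "A \<in> borel_measurable (F l)" "s \<le> l" and L: "step_process s t L"
    using Cons.prems by (auto simp: p step_simps)
  have "(\<integral>\<omega>. U \<omega> \<bullet> (A \<omega> *v (W u \<omega> - W l \<omega>)) \<partial>M) = 0"
    by (rule increment_orthogonal[OF U(1) F_measurable_mono[OF s A(5) U(2)] A(3,4,1,2)])
  then show ?case
    unfolding p step_simps inner_right_distrib using Cons.IH[OF L]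
    by (simp add: L2_inner[OF U(1) L2_matvec_increment[OF A(3,4,1,2)]] L2_inner[OF U(1) L2_step(1)[OF L]])
qed (simp add: step_simps)

text \<open>Orthogonality survives the mean square limit: with weight \<open>\<delta>\<close> twice
  the absolute value is at most \<open>\<delta> * u + R n / \<delta>\<close>, where first
  \<open>n\<close> tends to infinity and then \<open>\<delta>\<close> to 0.\<close>

lemma ito_increment_orthogonal:
  fixes U :: "'w \<Rightarrow> real^'d" and G :: "real \<Rightarrow> 'w \<Rightarrow> real^'d^'d"
  assumes I: "has_ito_integral M F W H s I" and I': "has_ito_integral M F W H t I'"
    and st: "0 \<le> s" "s \<le> t"
    and G: "(\<lambda>(r, \<omega>). G r \<omega>) \<in> borel_measurable (lborel \<Otimes>\<^sub>M M)"
    and GH: "\<And>r \<omega>. r \<in> {0..t} \<Longrightarrow> G r \<omega> = H r \<omega>"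
    and U: "L2 M U" "U \<in> borel_measurable (F s)"
  shows "(\<integral>\<omega>. U \<omega> \<bullet> (I' \<omega> - I \<omega>) \<partial>M) = 0"
proof -
  let ?N = "\<lambda>f. \<integral>\<^sup>+\<omega>. ennreal ((norm (f \<omega>))\<^sup>2) \<partial>M"
  obtain J where J: "\<And>n. step_process s t (J n)"
    and "(\<lambda>n. \<integral>\<^sup>+r\<in>{s<..t}. ?N (\<lambda>\<omega>. G r \<omega> - step_value (J n) r \<omega>) \<partial>lborel) \<longlonglongrightarrow> 0"
    and J2: "(\<lambda>n. ?N (\<lambda>\<omega>. I' \<omega> - I \<omega> - step_integral (J n) \<omega>)) \<longlonglongrightarrow> 0"
    by (rule ito_increment_approximation[OF I I' st G GH]) (assumption, rule that)
  note LJ = L2_step(1)[OF J] and LI = ito_increment_L2[OF I I' st]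
  define R where "R n = (\<integral>\<omega>. (norm (I' \<omega> - I \<omega> - step_integral (J n) \<omega>))\<^sup>2 \<partial>M)" for n
  have R: "R \<longlonglongrightarrow> 0"
    using J2 unfolding L2_nn_integral[OF L2_diff[OF LI LJ]] R_def[symmetric]
    by (subst (asm) ennreal_0[symmetric], subst (asm) tendsto_ennreal_iff) (auto simp: R_def)
  define E where "E = (\<integral>\<omega>. U \<omega> \<bullet> (I' \<omega> - I \<omega>) \<partial>M)"
  define u where "u = (\<integral>\<omega>. (norm (U \<omega>))\<^sup>2 \<partial>M)"
  have *: "2 * \<bar>E\<bar> \<le> \<delta> * u" if \<delta>: "\<delta> > 0" for \<delta>
  proof -
    have "2 * \<bar>E\<bar> \<le> \<delta> * u + R n / \<delta>" for n
    proof -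
      have E: "E = (\<integral>\<omega>. U \<omega> \<bullet> (I' \<omega> - I \<omega> - step_integral (J n) \<omega>) \<partial>M)"
        unfolding E_def inner_diff_right[of _ "_ - _" "step_integral _ _"]
        using step_integral_orthogonal[OF J U st(1), of n] L2_inner[OF U(1) LI] L2_inner[OF U(1) LJ[of n]]
        by simp
      \<comment> \<open>Used for \<open>V = U\<close> and for \<open>V = - U\<close>, which together
        bound the absolute value.\<close>
      have ineq: "(\<integral>\<omega>. 2 * (V \<omega> \<bullet> (I' \<omega> - I \<omega> - step_integral (J n) \<omega>)) \<partial>M) \<le> \<delta> * u + R n / \<delta>"
        if V: "L2 M V" "\<And>\<omega>. norm (V \<omega>) = norm (U \<omega>)" for V
      proof -
        have "(\<integral>\<omega>. 2 * (V \<omega> \<bullet> (I' \<omega> - I \<omega> - step_integral (J n) \<omega>)) \<partial>M)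
            \<le> (\<integral>\<omega>. \<delta> * (norm (U \<omega>))\<^sup>2 + (norm (I' \<omega> - I \<omega> - step_integral (J n) \<omega>))\<^sup>2 / \<delta> \<partial>M)"
          using L2_integrable_norm_sq[OF U(1)] L2_integrable_norm_sq[OF L2_diff[OF LI LJ[of n]]]
            L2_inner[OF V(1) L2_diff[OF LI LJ[of n]]] inner_le_weighted[OF \<delta>, of "V _"]
          by (intro integral_mono) (auto simp: V(2))
        also have "\<dots> = \<delta> * u + R n / \<delta>"
          using L2_integrable_norm_sq[OF U(1)] L2_integrable_norm_sq[OF L2_diff[OF LI LJ[of n]]]
          by (simp add: u_def R_def)
        finally show ?thesis .
      qed
      show ?thesis
        using ineq[OF U(1)] ineq[OF L2_uminus[OF U(1)]] by (simp add: E[symmetric])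
    qed
    moreover have "(\<lambda>n. \<delta> * u + R n / \<delta>) \<longlonglongrightarrow> \<delta> * u + 0 / \<delta>"
      using \<delta> by (intro tendsto_intros R) auto
    ultimately have "2 * \<bar>E\<bar> \<le> \<delta> * u + 0 / \<delta>"
      by (intro LIMSEQ_le_const[of _ "\<delta> * u + 0 / \<delta>"]) auto
    then show ?thesis by simp
  qed
  have "u \<ge> 0" by (simp add: u_def)
  have "2 * \<bar>E\<bar> \<le> 0 + e" if "e > 0" for e
  proof -
    \<comment> \<open>The denominator \<open>u + 1\<close> avoids a division by zero when
      \<open>u = 0\<close>.\<close>
    have "2 * \<bar>E\<bar> \<le> e / (u + 1) * u" using that \<open>u \<ge> 0\<close> by (intro *) auto
    also have "\<dots> \<le> e" using that \<open>u \<ge> 0\<close> by (simp add: field_simps)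
    finally show ?thesis by simp
  qed
  then have "2 * \<bar>E\<bar> \<le> 0" by (rule field_le_epsilon)
  then show ?thesis by (simp add: E_def)
qed

end


section \<open>Distance between the invariant measures\<close>

context mv_brownian
begin

definition stationary_solution :: "(real^'d) measure \<Rightarrow> (real \<Rightarrow> 'w \<Rightarrow> real^'d) \<Rightarrow> bool" where
  "stationary_solution \<pi> X \<longleftrightarrow> mv_solution M F W b \<sigma> X \<and> \<pi> \<in> P2 \<and> (\<forall>t\<ge>0. law M (X t) = \<pi>)"

text \<open>Stationarity makes the growth bound uniform in time: the second moment of
  \<open>X t\<close> is that of \<open>\<pi>\<close>, which thus appears twice.\<close>

lemma stationary_solution_L2:
  assumes "stationary_solution \<pi> X" "0 \<le> t"
  shows "X t \<in> borel_measurable (F t)" "L2 M (X t)" "L2 M (\<lambda>\<omega>. b (X t \<omega>) \<pi>)"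
    "(\<integral>\<omega>. (norm (b (X t \<omega>) \<pi>))\<^sup>2 \<partial>M) \<le> c0 * (1 + 2 * second_moment \<pi>)"
    "L2 M (\<lambda>\<omega>. \<sigma> (X t \<omega>) \<pi>)"
    "(\<integral>\<omega>. (norm (\<sigma> (X t \<omega>) \<pi>))\<^sup>2 \<partial>M) \<le> c0 * (1 + 2 * second_moment \<pi>)"
proof -
  have P: "\<pi> \<in> P2" and l: "law M (X t) = \<pi>" using assms by (auto simp: stationary_solution_def)
  show X: "X t \<in> borel_measurable (F t)"
    using assms by (auto simp: stationary_solution_def mv_solution_def)
  have Xm: "X t \<in> borel_measurable M" by (rule F_measurable_M[OF assms(2) X])
  show L: "L2 M (X t)" using law_P2_L2[OF Xm] l P by simp
  show Lb: "L2 M (\<lambda>\<omega>. b (X t \<omega>) \<pi>)" and Ls: "L2 M (\<lambda>\<omega>. \<sigma> (X t \<omega>) \<pi>)"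
    by (rule L2_coefficients[OF prob_space_axioms L P])+
  have m: "(\<integral>\<omega>. (norm (X t \<omega>))\<^sup>2 \<partial>M) = second_moment \<pi>"
    using second_moment_law[OF Xm] l by simp
  have i: "integrable M (\<lambda>\<omega>. c0 * (1 + (norm (X t \<omega>))\<^sup>2 + second_moment \<pi>))"
    using L by (simp add: L2_def)
  have e: "(\<integral>\<omega>. c0 * (1 + (norm (X t \<omega>))\<^sup>2 + second_moment \<pi>) \<partial>M) = c0 * (1 + 2 * second_moment \<pi>)"
    using L by (simp add: L2_def prob_space m)
  show "(\<integral>\<omega>. (norm (b (X t \<omega>) \<pi>))\<^sup>2 \<partial>M) \<le> c0 * (1 + 2 * second_moment \<pi>)"
    unfolding e[symmetric] by (intro integral_mono L2_integrable_norm_sq Lb i growth P)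
  show "(\<integral>\<omega>. (norm (\<sigma> (X t \<omega>) \<pi>))\<^sup>2 \<partial>M) \<le> c0 * (1 + 2 * second_moment \<pi>)"
    unfolding e[symmetric] by (intro integral_mono L2_integrable_norm_sq Ls i growth P)
qed

lemma nn_integral_L2_le:
  assumes "L2 M f" "(\<integral>\<omega>. (norm (f \<omega>))\<^sup>2 \<partial>M) \<le> K"
  shows "(\<integral>\<^sup>+\<omega>. ennreal ((norm (f \<omega>))\<^sup>2) \<partial>M) \<le> ennreal K"
  unfolding L2_nn_integral[OF assms(1)] by (rule ennreal_leI[OF assms(2)])

lemma L2_le_of_nn_integral:
  assumes "L2 M f" "(\<integral>\<^sup>+\<omega>. ennreal ((norm (f \<omega>))\<^sup>2) \<partial>M) \<le> ennreal K" "0 \<le> K"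
  shows "(\<integral>\<omega>. (norm (f \<omega>))\<^sup>2 \<partial>M) \<le> K"
  using assms(2,3) unfolding L2_nn_integral[OF assms(1)] by (subst (asm) ennreal_le_iff)

lemma set_nn_integral_le_const:
  assumes "\<And>r. r \<in> {s<..t} \<Longrightarrow> f r \<le> ennreal K" "0 \<le> K" "s \<le> t"
  shows "(\<integral>\<^sup>+r\<in>{s<..t}. f r \<partial>lborel) \<le> ennreal (K * (t - s))"
proof -
  have "(\<integral>\<^sup>+r\<in>{s<..t}. f r \<partial>lborel) \<le> (\<integral>\<^sup>+r. ennreal K * indicator {s<..t} r \<partial>lborel)"
    using assms(1) by (intro nn_integral_mono) (auto simp: indicator_def)
  also have "\<dots> = ennreal K * ennreal (t - s)"
    using assms(3) by (simp add: nn_integral_cmult_indicator)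
  finally show ?thesis using assms by (simp add: ennreal_mult)
qed

text \<open>This is all that the error analysis knows of the stochastic integral, whose increment is
  \<open>J\<close>. \<open>A\<close> and \<open>B\<close> are free approximations, constant in time,
  of diffusion and drift: 0 for the time regularity of the solution, the coefficients at
  \<open>X s\<close> for the local error.\<close>

lemma stationary_increment:
  assumes X: "stationary_solution \<pi> X" and st: "0 \<le> s" "s \<le> t"
  obtains J where "L2 M J"
    "\<forall>A K. L2 M A \<longrightarrow> A \<in> borel_measurable (F s) \<longrightarrow> 0 \<le> K \<longrightarrow>
       (\<forall>r\<in>{s<..t}. (\<integral>\<omega>. (norm (\<sigma> (X r \<omega>) \<pi> - A \<omega>))\<^sup>2 \<partial>M) \<le> K) \<longrightarrow>
       (\<integral>\<omega>. (norm (J \<omega> - A \<omega> *v (W t \<omega> - W s \<omega>)))\<^sup>2 \<partial>M) \<le> 4 * K * (t - s)"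
    "\<forall>U. L2 M U \<longrightarrow> U \<in> borel_measurable (F s) \<longrightarrow> (\<integral>\<omega>. U \<omega> \<bullet> J \<omega> \<partial>M) = 0"
    "\<forall>B K. L2 M B \<longrightarrow> 0 \<le> K \<longrightarrow>
       (\<forall>r\<in>{s<..t}. (\<integral>\<omega>. (norm (b (X r \<omega>) \<pi> - B \<omega>))\<^sup>2 \<partial>M) \<le> K) \<longrightarrow>
       (\<integral>\<omega>. (norm (X t \<omega> - X s \<omega> - J \<omega> - (t - s) *\<^sub>R B \<omega>))\<^sup>2 \<partial>M) \<le> K * (t - s)\<^sup>2"
proof -
  let ?N = "\<lambda>f. \<integral>\<^sup>+\<omega>. ennreal ((norm (f \<omega>))\<^sup>2) \<partial>M"
  define Hb where "Hb r \<omega> = b (X r \<omega>) (law M (X r))" for r \<omega>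
  define Hs where "Hs r \<omega> = \<sigma> (X r \<omega>) (law M (X r))" for r \<omega>
  have t0: "0 \<le> t" using st by simp
  have sol: "mv_solution M F W b \<sigma> X" and P: "\<pi> \<in> P2" and l: "\<And>r. 0 \<le> r \<Longrightarrow> law M (X r) = \<pi>"
    using X by (auto simp: stationary_solution_def)
  have prog: "progressively_measurable F Hb" "progressively_measurable F Hs"
    and paths: "\<And>\<omega>. \<omega> \<in> space M \<Longrightarrow> continuous_on {0..} (\<lambda>r. X r \<omega>)"
    and eqn: "\<And>r. 0 \<le> r \<Longrightarrow> \<exists>I. has_ito_integral M F W Hs r I \<and>
        (AE \<omega> in M. X r \<omega> = X 0 \<omega> + (LINT u:{0..r}|lborel. Hb u \<omega>) + I \<omega>)"
    using sol by (auto simp: mv_solution_def Hb_def[abs_def] Hs_def[abs_def])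
  obtain I where I: "has_ito_integral M F W Hs s I"
    and Xs: "AE \<omega> in M. X s \<omega> = X 0 \<omega> + (LINT u:{0..s}|lborel. Hb u \<omega>) + I \<omega>"
    using eqn[OF st(1)] by blast
  obtain I' where I': "has_ito_integral M F W Hs t I'"
    and Xt: "AE \<omega> in M. X t \<omega> = X 0 \<omega> + (LINT u:{0..t}|lborel. Hb u \<omega>) + I' \<omega>"
    using eqn[OF t0] by blast
  define Gb where "Gb r \<omega> = Hb (max 0 (min t r)) \<omega>" for r \<omega>
  define Gs where "Gs r \<omega> = Hs (max 0 (min t r)) \<omega>" for r \<omega>
  have mGb: "(\<lambda>(r, \<omega>). Gb r \<omega>) \<in> borel_measurable (lborel \<Otimes>\<^sub>M M)"
    and mGs: "(\<lambda>(r, \<omega>). Gs r \<omega>) \<in> borel_measurable (lborel \<Otimes>\<^sub>M M)"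
    unfolding Gb_def Gs_def by (rule progressive_joint_measurable[OF _ t0], rule prog)+
  have Gb: "Gb r \<omega> = Hb r \<omega>" "Gb r \<omega> = b (X r \<omega>) \<pi>" if "r \<in> {0..t}" for r \<omega>
    using that l by (auto simp: Gb_def Hb_def)
  have Gs: "Gs r \<omega> = Hs r \<omega>" "Gs r \<omega> = \<sigma> (X r \<omega>) \<pi>" if "r \<in> {0..t}" for r \<omega>
    using that l by (auto simp: Gs_def Hs_def)
  define J where "J \<omega> = I' \<omega> - I \<omega>" for \<omega>
  have LJ: "L2 M J" unfolding J_def by (rule ito_increment_L2[OF I I' st])
  show thesis
  proof (rule that[OF LJ]; intro allI impI)
    fix A :: "'w \<Rightarrow> real^'d^'d" and K :: real
    assume A: "L2 M A" "A \<in> borel_measurable (F s)" and K: "0 \<le> K"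
      "\<forall>r\<in>{s<..t}. (\<integral>\<omega>. (norm (\<sigma> (X r \<omega>) \<pi> - A \<omega>))\<^sup>2 \<partial>M) \<le> K"
    have "?N (\<lambda>\<omega>. J \<omega> - A \<omega> *v (W t \<omega> - W s \<omega>)) \<le> 4 * (\<integral>\<^sup>+r\<in>{s<..t}. ?N (\<lambda>\<omega>. Gs r \<omega> - A \<omega>) \<partial>lborel)"
      unfolding J_def by (rule ito_increment_bound[OF I I' st mGs Gs(1) A])
    also have "\<dots> \<le> 4 * ennreal (K * (t - s))"
    proof (intro mult_left_mono set_nn_integral_le_const K(1) st(2))
      fix r assume r: "r \<in> {s<..t}"
      then have "L2 M (\<lambda>\<omega>. \<sigma> (X r \<omega>) \<pi> - A \<omega>)"
        using st by (intro L2_diff stationary_solution_L2(5)[OF X] A(1)) auto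
      from nn_integral_L2_le[OF this bspec[OF K(2) r]] show "?N (\<lambda>\<omega>. Gs r \<omega> - A \<omega>) \<le> ennreal K"
        using r st by (simp add: Gs(2))
    qed simp
    also have "\<dots> = ennreal (4 * K * (t - s))"
      using K(1) st by (simp add: ennreal_mult' mult.assoc)
    finally show "(\<integral>\<omega>. (norm (J \<omega> - A \<omega> *v (W t \<omega> - W s \<omega>)))\<^sup>2 \<partial>M) \<le> 4 * K * (t - s)"
      using K(1) st by (intro L2_le_of_nn_integral L2_diff LJ L2_matvec_increment A) auto
  next
    fix U :: "'w \<Rightarrow> real^'d" assume U: "L2 M U" "U \<in> borel_measurable (F s)"
    show "(\<integral>\<omega>. U \<omega> \<bullet> J \<omega> \<partial>M) = 0"
      unfolding J_def by (rule ito_increment_orthogonal[OF I I' st mGs Gs(1) U])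
  next
    fix B :: "'w \<Rightarrow> real^'d" and K :: real
    assume B: "L2 M B" and K: "0 \<le> K"
      "\<forall>r\<in>{s<..t}. (\<integral>\<omega>. (norm (b (X r \<omega>) \<pi> - B \<omega>))\<^sup>2 \<partial>M) \<le> K"
    define R where "R \<omega> = X t \<omega> - X s \<omega> - J \<omega> - (t - s) *\<^sub>R B \<omega>" for \<omega>
    have LR: "L2 M R"
      unfolding R_def by (intro L2_diff L2_scaleR stationary_solution_L2(2)[OF X] LJ B st t0)
    have Bm: "B \<in> borel_measurable M" using B by (simp add: L2_def)
    have mD: "(\<lambda>(r, \<omega>). Gb r \<omega> - B \<omega>) \<in> borel_measurable (lborel \<Otimes>\<^sub>M M)"
      using mGb Bm by (simp add: case_prod_beta)
    have "AE \<omega> in M. R \<omega> = (LINT r:{s<..t}|lborel. Gb r \<omega> - B \<omega>)"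
      using Xs Xt AE_space
    proof eventually_elim
      case (elim \<omega>)
      \<comment> \<open>The law is constantly \<open>\<pi>\<close>, so continuous paths make the
        drift continuous in time; it is then integrable along the path, and its integral may be
        split at \<open>s\<close>.\<close>
      have "continuous_on {0..t} (\<lambda>r. b (X r \<omega>) \<pi>)"
        by (rule continuous_on_compose2[OF continuous_coefficients(1)[OF P] continuous_on_subset[OF paths[OF elim(3)]]])
          auto
      then have "continuous_on {0..t} (\<lambda>r. Gb r \<omega>)"
        by (rule continuous_on_cong[THEN iffD1, rotated 2]) (auto simp: Gb(2))
      then have i: "set_integrable lborel {0..t} (\<lambda>r. Gb r \<omega>)"
        by (rule borel_integrable_atLeastAtMost')
      have i1: "set_integrable lborel {0..s} (\<lambda>r. Gb r \<omega>)" "set_integrable lborel {s<..t} (\<lambda>r. Gb r \<omega>)"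
        using st by (auto intro: set_integrable_subset[OF i])
      have "{0..t} = {0..s} \<union> {s<..t}" using st by auto
      then have "(LINT r:{0..t}|lborel. Gb r \<omega>) = (LINT r:{0..s}|lborel. Gb r \<omega>) + (LINT r:{s<..t}|lborel. Gb r \<omega>)"
        by (simp only:) (intro set_integral_Un i1, auto)
      moreover have "(LINT r:{0..u}|lborel. Hb r \<omega>) = (LINT r:{0..u}|lborel. Gb r \<omega>)" if "u \<le> t" for u
        using that by (intro set_lebesgue_integral_cong) (auto simp: Gb(1))
      moreover have "(LINT r:{s<..t}|lborel. Gb r \<omega> - B \<omega>) = (LINT r:{s<..t}|lborel. Gb r \<omega>) - (t - s) *\<^sub>R B \<omega>"
        using i1(2) st by (subst set_integral_diff) (auto simp: set_integrable_def set_lebesgue_integral_def)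
      ultimately show ?case
        using elim(1,2) st by (simp add: R_def J_def)
    qed
    then have "?N R = (\<integral>\<^sup>+\<omega>. ennreal ((norm (LINT r:{s<..t}|lborel. Gb r \<omega> - B \<omega>))\<^sup>2) \<partial>M)"
      by (intro nn_integral_cong_AE) auto
    \<comment> \<open>Cauchy-Schwarz in time gives one factor \<open>t - s\<close>; Tonelli's
      theorem and the bound \<open>K\<close> at each time give the other.\<close>
    also have "\<dots> \<le> (\<integral>\<^sup>+\<omega>. ennreal (t - s) * (\<integral>\<^sup>+r. ennreal ((norm (Gb r \<omega> - B \<omega>))\<^sup>2) * indicator {s<..t} r \<partial>lborel) \<partial>M)"
    proof (intro nn_integral_mono ennreal_norm_set_integral_sq_le st(2))
      fix \<omega> assume "\<omega> \<in> space M"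
      then show "(\<lambda>r. Gb r \<omega> - B \<omega>) \<in> borel_measurable lborel"
        using measurable_compose[OF measurable_Pair2' mD, of \<omega>] by simp
    qed
    also have "\<dots> = ennreal (t - s) * (\<integral>\<^sup>+\<omega>. (\<integral>\<^sup>+r. ennreal ((norm (Gb r \<omega> - B \<omega>))\<^sup>2) * indicator {s<..t} r \<partial>lborel) \<partial>M)"
    proof (intro nn_integral_cmult)
      interpret pair_sigma_finite M lborel ..
      have "(\<lambda>(\<omega>, r). ennreal ((norm (Gb r \<omega> - B \<omega>))\<^sup>2) * indicator {s<..t} r) \<in> borel_measurable (M \<Otimes>\<^sub>M lborel)"
        using measurable_compose[OF measurable_pair_swap' mD] by (simp add: case_prod_beta)
      then show "(\<lambda>\<omega>. \<integral>\<^sup>+r. ennreal ((norm (Gb r \<omega> - B \<omega>))\<^sup>2) * indicator {s<..t} r \<partial>lborel) \<in> borel_measurable M"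
        by (rule lborel.borel_measurable_nn_integral)
    qed
    also have "(\<integral>\<^sup>+\<omega>. (\<integral>\<^sup>+r. ennreal ((norm (Gb r \<omega> - B \<omega>))\<^sup>2) * indicator {s<..t} r \<partial>lborel) \<partial>M)
        = (\<integral>\<^sup>+r. (\<integral>\<^sup>+\<omega>. ennreal ((norm (Gb r \<omega> - B \<omega>))\<^sup>2) * indicator {s<..t} r \<partial>M) \<partial>lborel)"
    proof -
      interpret pair_sigma_finite lborel M ..
      show ?thesis
        by (rule Fubini') (use mD in \<open>simp add: case_prod_beta\<close>)
    qed
    also have "\<dots> = (\<integral>\<^sup>+r\<in>{s<..t}. ?N (\<lambda>\<omega>. Gb r \<omega> - B \<omega>) \<partial>lborel)"
      using section_measurable[OF mD] by (simp add: nn_integral_multc)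
    also have "ennreal (t - s) * \<dots> \<le> ennreal (t - s) * ennreal (K * (t - s))"
    proof (intro mult_left_mono set_nn_integral_le_const K(1) st(2))
      fix r assume r: "r \<in> {s<..t}"
      then have "L2 M (\<lambda>\<omega>. b (X r \<omega>) \<pi> - B \<omega>)"
        using st by (intro L2_diff stationary_solution_L2(3)[OF X] B) auto
      from nn_integral_L2_le[OF this bspec[OF K(2) r]] show "?N (\<lambda>\<omega>. Gb r \<omega> - B \<omega>) \<le> ennreal K"
        using r st by (simp add: Gb(2))
    qed simp
    also have "\<dots> = ennreal (K * (t - s)\<^sup>2)"
      using K(1) st by (simp add: ennreal_mult[symmetric] power2_eq_square mult_ac)
    finally show "(\<integral>\<omega>. (norm (X t \<omega> - X s \<omega> - J \<omega> - (t - s) *\<^sub>R B \<omega>))\<^sup>2 \<partial>M) \<le> K * (t - s)\<^sup>2"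
      using L2_le_of_nn_integral[OF LR] K(1) by (simp add: R_def)
  qed
qed

text \<open>With \<open>A = 0\<close> and \<open>B = 0\<close> the noise contributes
  \<open>4 * K * (t - s)\<close> and the drift \<open>K * (t - s)\<^sup>2\<close>, which is at most
  \<open>K * (t - s)\<close> for \<open>t - s \<le> 1\<close>, \<open>K\<close> being the growth
  bound. Splitting the square doubles both, hence the 10.\<close>

lemma stationary_solution_increment_moment:
  assumes X: "stationary_solution \<pi> X" and st: "0 \<le> s" "s \<le> t" "t - s \<le> 1"
  shows "(\<integral>\<omega>. (norm (X t \<omega> - X s \<omega>))\<^sup>2 \<partial>M) \<le> 10 * (c0 * (1 + 2 * second_moment \<pi>)) * (t - s)"
    (is "_ \<le> 10 * ?K * _")
proof -
  note XL = stationary_solution_L2[OF X]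
  have K: "0 \<le> ?K" using parameters by (simp add: second_moment_def)
  obtain J where J: "L2 M J"
    and J1: "\<forall>A K. L2 M A \<longrightarrow> A \<in> borel_measurable (F s) \<longrightarrow> 0 \<le> K \<longrightarrow>
       (\<forall>r\<in>{s<..t}. (\<integral>\<omega>. (norm (\<sigma> (X r \<omega>) \<pi> - A \<omega>))\<^sup>2 \<partial>M) \<le> K) \<longrightarrow>
       (\<integral>\<omega>. (norm (J \<omega> - A \<omega> *v (W t \<omega> - W s \<omega>)))\<^sup>2 \<partial>M) \<le> 4 * K * (t - s)"
    and "\<forall>U. L2 M U \<longrightarrow> U \<in> borel_measurable (F s) \<longrightarrow> (\<integral>\<omega>. U \<omega> \<bullet> J \<omega> \<partial>M) = 0"
    and J2: "\<forall>B K. L2 M B \<longrightarrow> 0 \<le> K \<longrightarrow>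
       (\<forall>r\<in>{s<..t}. (\<integral>\<omega>. (norm (b (X r \<omega>) \<pi> - B \<omega>))\<^sup>2 \<partial>M) \<le> K) \<longrightarrow>
       (\<integral>\<omega>. (norm (X t \<omega> - X s \<omega> - J \<omega> - (t - s) *\<^sub>R B \<omega>))\<^sup>2 \<partial>M) \<le> K * (t - s)\<^sup>2"
    by (rule stationary_increment[OF X st(1,2)]) (rule that)
  note J1 = J1[rule_format] and J2 = J2[rule_format]
  have z: "L2 M (\<lambda>\<omega>. 0 :: 'e::euclidean_space)" by (intro L2_const finite_measure_axioms)
  have 1: "(\<integral>\<omega>. (norm (J \<omega>))\<^sup>2 \<partial>M) \<le> 4 * ?K * (t - s)"
    using J1[OF z _ K] XL(6) st by simp
  have 2: "(\<integral>\<omega>. (norm (X t \<omega> - X s \<omega> - J \<omega>))\<^sup>2 \<partial>M) \<le> ?K * (t - s)\<^sup>2"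
    using J2[OF z K] XL(4) st by simp
  have D: "L2 M (\<lambda>\<omega>. X t \<omega> - X s \<omega>)" using st by (intro L2_diff XL(2)) auto
  have pt: "(norm (X t \<omega> - X s \<omega>))\<^sup>2 \<le> 2 * (norm (X t \<omega> - X s \<omega> - J \<omega>))\<^sup>2 + 2 * (norm (J \<omega>))\<^sup>2" for \<omega>
    using norm_add_sq_le[of "X t \<omega> - X s \<omega> - J \<omega>" "J \<omega>"] by simp
  have "(\<integral>\<omega>. (norm (X t \<omega> - X s \<omega>))\<^sup>2 \<partial>M)
      \<le> (\<integral>\<omega>. 2 * (norm (X t \<omega> - X s \<omega> - J \<omega>))\<^sup>2 + 2 * (norm (J \<omega>))\<^sup>2 \<partial>M)"
    using L2_integrable_norm_sq[OF D] L2_integrable_norm_sq[OF L2_diff[OF D J]] L2_integrable_norm_sq[OF J]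
    by (intro integral_mono pt) auto
  also have "\<dots> = 2 * (\<integral>\<omega>. (norm (X t \<omega> - X s \<omega> - J \<omega>))\<^sup>2 \<partial>M) + 2 * (\<integral>\<omega>. (norm (J \<omega>))\<^sup>2 \<partial>M)"
    using L2_integrable_norm_sq[OF L2_diff[OF D J]] L2_integrable_norm_sq[OF J] by simp
  also have "\<dots> \<le> 2 * (?K * (t - s)\<^sup>2) + 2 * (4 * ?K * (t - s))"
    using 1 2 by simp
  also have "\<dots> \<le> 2 * (?K * (t - s)) + 2 * (4 * ?K * (t - s))"
  proof -
    have "(t - s)\<^sup>2 \<le> t - s"
      using st mult_right_mono[of "t - s" 1 "t - s"] by (simp add: power2_eq_square)
    from mult_left_mono[OF this K] show ?thesis by linarith
  qed
  finally show ?thesis by (simp add: algebra_simps)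
qed

text \<open>
  The error of one Euler step against the stationary solution is \<open>U + N + Rb + Rs\<close>: \<open>U\<close> and \<open>N\<close>
  are the drift and the noise part of the difference of two Euler steps, which contract in mean
  square; \<open>Rb\<close> is the local error of the drift, of mean square order \<open>h\<^sup>3\<close>; \<open>Rs\<close>, of order only
  \<open>h\<^sup>2\<close>, is the local error of the noise, but it is orthogonal to \<open>U\<close>.
\<close>
lemma euler_local_error:
  fixes h :: real and k :: nat and V :: "'w \<Rightarrow> real^'d"
  defines "s \<equiv> real k * h" and "t \<equiv> real (Suc k) * h"
  assumes X: "stationary_solution \<pi> X" and h: "0 < h" "h < 1"
    and V: "L2 M V" "V \<in> borel_measurable (F s)" "law M V = \<nu>"
    and a4: "a + bbar < \<alpha> - \<beta>"
    and \<delta>: "\<delta> > 0" "\<delta> * (1 + a + bbar) \<le> (\<alpha> - \<beta> - (a + bbar)) / 2"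
  shows "(\<integral>\<omega>. (norm (X t \<omega> - euler_step b \<sigma> h \<nu> (V \<omega>) (W t \<omega> - W s \<omega>)))\<^sup>2 \<partial>M)
      \<le> (1 - (\<alpha> - \<beta> - (a + bbar)) / 2 * h) * (\<integral>\<omega>. (norm (X s \<omega> - V \<omega>))\<^sup>2 \<partial>M)
        + 10 * a * (c0 * (1 + 2 * second_moment \<pi>)) * (1 / \<delta> + 10 * (1 / \<delta> + 1)) * h\<^sup>2"
    (is "_ \<le> _ * ?e + 10 * a * ?K * _ * _")
proof -
  define c where "c = \<alpha> - \<beta> - (a + bbar)"
  \<comment> \<open>Over one step the mean square change of either coefficient along the solution is
    at most \<open>L * h\<close>.\<close>
  define L where "L = 10 * a * ?K"
  have s: "0 \<le> s" "s \<le> t" "t - s = h" using h by (auto simp: s_def t_def algebra_simps)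
  have K: "0 \<le> ?K" using parameters by (simp add: second_moment_def)
  then have L: "0 \<le> L" using parameters by (simp add: L_def)
  note XL = stationary_solution_L2[OF X]
  have P: "\<pi> \<in> P2" and lX: "law M (X s) = \<pi>" using X s by (auto simp: stationary_solution_def)
  have P': "\<nu> \<in> P2" using law_in_P2[OF V(1)] V(3) by simp
  interpret N: mv_noise b \<sigma> \<alpha> \<beta> \<gamma> \<kappa> \<rho> c0 a bbar M "F s" "\<lambda>\<omega>. W t \<omega> - W s \<omega>" h
    unfolding s_def t_def by (rule mv_noise_increment[OF h(1)])
  note Xs = XL(2)[OF s(1)] XL(1)[OF s(1)]
  obtain J where J: "L2 M J"
    and J1: "\<forall>A K. L2 M A \<longrightarrow> A \<in> borel_measurable (F s) \<longrightarrow> 0 \<le> K \<longrightarrow>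
       (\<forall>r\<in>{s<..t}. (\<integral>\<omega>. (norm (\<sigma> (X r \<omega>) \<pi> - A \<omega>))\<^sup>2 \<partial>M) \<le> K) \<longrightarrow>
       (\<integral>\<omega>. (norm (J \<omega> - A \<omega> *v (W t \<omega> - W s \<omega>)))\<^sup>2 \<partial>M) \<le> 4 * K * (t - s)"
    and J2: "\<forall>U. L2 M U \<longrightarrow> U \<in> borel_measurable (F s) \<longrightarrow> (\<integral>\<omega>. U \<omega> \<bullet> J \<omega> \<partial>M) = 0"
    and J3: "\<forall>B K. L2 M B \<longrightarrow> 0 \<le> K \<longrightarrow>
       (\<forall>r\<in>{s<..t}. (\<integral>\<omega>. (norm (b (X r \<omega>) \<pi> - B \<omega>))\<^sup>2 \<partial>M) \<le> K) \<longrightarrow>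
       (\<integral>\<omega>. (norm (X t \<omega> - X s \<omega> - J \<omega> - (t - s) *\<^sub>R B \<omega>))\<^sup>2 \<partial>M) \<le> K * (t - s)\<^sup>2"
    by (rule stationary_increment[OF X s(1,2)]) (rule that)
  note J1 = J1[rule_format] and J2 = J2[rule_format] and J3 = J3[rule_format]
  define Rb where "Rb \<omega> = X t \<omega> - X s \<omega> - J \<omega> - h *\<^sub>R b (X s \<omega>) \<pi>" for \<omega>
  define Rs where "Rs \<omega> = J \<omega> - \<sigma> (X s \<omega>) \<pi> *v (W t \<omega> - W s \<omega>)" for \<omega>
  define U where "U \<omega> = (X s \<omega> + h *\<^sub>R b (X s \<omega>) \<pi>) - (V \<omega> + h *\<^sub>R b (V \<omega>) \<nu>)" for \<omega>
  define A where "A \<omega> = \<sigma> (X s \<omega>) \<pi> - \<sigma> (V \<omega>) \<nu>" for \<omega>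
  define N where "N \<omega> = A \<omega> *v (W t \<omega> - W s \<omega>)" for \<omega>
  have U: "L2 M U" "U \<in> borel_measurable (F s)"
    unfolding U_def by (intro L2_diff borel_measurable_diff N.drift_step_L2 N.drift_step_G Xs V P P')+
  have A: "L2 M A" "A \<in> borel_measurable (F s)"
    unfolding A_def
    by (intro L2_diff borel_measurable_diff L2_coefficients[OF prob_space_axioms] N.coefficients_G Xs V P P')+
  have N: "L2 M N" unfolding N_def by (rule N.matvec_L2[OF A])
  have S: "L2 M (\<lambda>\<omega>. \<sigma> (X s \<omega>) \<pi>)" "(\<lambda>\<omega>. \<sigma> (X s \<omega>) \<pi>) \<in> borel_measurable (F s)"
    by (intro L2_coefficients[OF prob_space_axioms] N.coefficients_G Xs P)+
  have Rs: "L2 M Rs" unfolding Rs_def by (intro L2_diff J N.matvec_L2 S)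
  have t0: "0 \<le> t" using s by simp
  have Rb: "L2 M Rb" unfolding Rb_def by (intro L2_diff L2_scaleR XL(2,3) J s t0)
  have lip: "(\<integral>\<omega>. (norm (f (X r \<omega>) \<pi> - f (X s \<omega>) \<pi>))\<^sup>2 \<partial>M) \<le> L * h"
    if f: "\<And>x y. (norm (f x \<pi> - f y \<pi>))\<^sup>2 \<le> a * (norm (x - y))\<^sup>2 + bbar * (W2 \<pi> \<pi>)\<^sup>2"
      and fL: "\<And>r. 0 \<le> r \<Longrightarrow> L2 M (\<lambda>\<omega>. f (X r \<omega>) \<pi>)" and r: "r \<in> {s<..t}"
    for f :: "real^'d \<Rightarrow> (real^'d) measure \<Rightarrow> 'e::euclidean_space" and r
  proof -
    have r0: "0 \<le> r" "s \<le> r" "r - s \<le> h" using r s by auto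
    have D: "L2 M (\<lambda>\<omega>. X r \<omega> - X s \<omega>)" by (intro L2_diff XL(2) r0 s)
    have "(\<integral>\<omega>. (norm (f (X r \<omega>) \<pi> - f (X s \<omega>) \<pi>))\<^sup>2 \<partial>M) \<le> (\<integral>\<omega>. a * (norm (X r \<omega> - X s \<omega>))\<^sup>2 \<partial>M)"
      using f L2_integrable_norm_sq[OF D] L2_integrable_norm_sq[OF L2_diff[OF fL[OF r0(1)] fL[OF s(1)]]]
      by (intro integral_mono) (auto simp: W2_same[OF P])
    also have "\<dots> \<le> a * (10 * ?K * (r - s))"
      using stationary_solution_increment_moment[OF X s(1) r0(2)] r0 h parameters
      by (simp add: mult_left_mono)
    also have "\<dots> \<le> a * (10 * ?K * h)"
      using r0 K parameters by (intro mult_left_mono) auto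
    finally show ?thesis by (simp add: L_def mult_ac)
  qed
  have eRs: "(\<integral>\<omega>. (norm (Rs \<omega>))\<^sup>2 \<partial>M) \<le> 4 * L * h\<^sup>2"
    using J1[OF S, of "L * h"] lip[of \<sigma>, OF lipschitz(2)[OF P P] XL(5)] L h
    by (simp add: Rs_def s(3) power2_eq_square mult.assoc)
  have eRb: "(\<integral>\<omega>. (norm (Rb \<omega>))\<^sup>2 \<partial>M) \<le> L * h ^ 3"
    using J3[OF XL(3)[OF s(1)], of "L * h"] lip[of b, OF lipschitz(1)[OF P P] XL(3)] L h
    by (simp add: Rb_def s(3) power2_eq_square power3_eq_cube mult.assoc)
  have eUN: "(\<integral>\<omega>. (norm (U \<omega> + N \<omega>))\<^sup>2 \<partial>M) \<le> (1 - c * h) * ?e"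
  proof -
    have "(\<integral>\<omega>. (norm (U \<omega> + N \<omega>))\<^sup>2 \<partial>M) \<le> (1 - (\<alpha> - \<beta>) * h + (a + bbar) * h\<^sup>2) * ?e"
      using N.euler_step_contraction[OF Xs V(1,2)] unfolding lX V(3) U_def N_def A_def .
    \<comment> \<open>As \<open>h < 1\<close>, the \<open>h\<^sup>2\<close> term is absorbed by the
      term of order \<open>h\<close>, and the margin of Assumption 4 becomes the contraction
      rate.\<close>
    also have "\<dots> \<le> (1 - c * h) * ?e"
    proof (intro mult_right_mono)
      have "(a + bbar) * h\<^sup>2 \<le> (a + bbar) * h"
        unfolding power2_eq_square using h parameters by (intro mult_left_mono) auto
      then show "1 - (\<alpha> - \<beta>) * h + (a + bbar) * h\<^sup>2 \<le> 1 - c * h" by (simp add: c_def algebra_simps)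
    qed simp
    finally show ?thesis .
  qed
  have UN: "(\<integral>\<omega>. (norm (U \<omega> + N \<omega>))\<^sup>2 \<partial>M) = (\<integral>\<omega>. (norm (U \<omega>))\<^sup>2 \<partial>M) + h * (\<integral>\<omega>. (norm (A \<omega>))\<^sup>2 \<partial>M)"
    unfolding N_def by (rule N.norm_sq_add_noise[OF U A])
  have e0: "0 \<le> ?e" by simp
  have c0: "0 < c" using a4 by (simp add: c_def)
  have "(1 - c * h) * ?e \<le> 1 * ?e" using h c0 by (intro mult_right_mono) auto
  moreover have "0 \<le> h * (\<integral>\<omega>. (norm (A \<omega>))\<^sup>2 \<partial>M)" using h by simp
  \<comment> \<open>\<open>U\<close> alone inherits the bound because \<open>U\<close> and
    \<open>N\<close> are orthogonal.\<close>
  ultimately have eU: "(\<integral>\<omega>. (norm (U \<omega>))\<^sup>2 \<partial>M) \<le> ?e"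
    using eUN UN by linarith
  have eN: "(\<integral>\<omega>. (norm (N \<omega>))\<^sup>2 \<partial>M) \<le> h * ((a + bbar) * ?e)"
  proof -
    have D: "L2 M (\<lambda>\<omega>. X s \<omega> - V \<omega>)" by (intro L2_diff Xs V)
    have "(W2 \<pi> \<nu>)\<^sup>2 \<le> ?e"
      unfolding lX[symmetric] V(3)[symmetric] by (intro W2_law_le L2_measurable Xs V)
    then have W: "bbar * (W2 \<pi> \<nu>)\<^sup>2 \<le> bbar * ?e" using parameters by (intro mult_left_mono) auto
    have "(\<integral>\<omega>. (norm (A \<omega>))\<^sup>2 \<partial>M) \<le> (\<integral>\<omega>. a * (norm (X s \<omega> - V \<omega>))\<^sup>2 + bbar * (W2 \<pi> \<nu>)\<^sup>2 \<partial>M)"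
      using L2_integrable_norm_sq[OF D] L2_integrable_norm_sq[OF A(1)] unfolding A_def
      by (intro integral_mono lipschitz P P') auto
    also have "\<dots> = a * ?e + bbar * (W2 \<pi> \<nu>)\<^sup>2"
      using L2_integrable_norm_sq[OF D] by (simp add: prob_space)
    also have "\<dots> \<le> (a + bbar) * ?e" using W by (simp add: algebra_simps)
    finally have "h * (\<integral>\<omega>. (norm (A \<omega>))\<^sup>2 \<partial>M) \<le> h * ((a + bbar) * ?e)"
      using h by (intro mult_left_mono) auto
    moreover have "(\<integral>\<omega>. (norm (N \<omega>))\<^sup>2 \<partial>M) = h * (\<integral>\<omega>. (norm (A \<omega>))\<^sup>2 \<partial>M)"
      unfolding N_def using N.noise_inner[OF A A] by (simp add: power2_norm_eq_inner)
    ultimately show ?thesis by simp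
  qed
  have URs: "(\<integral>\<omega>. U \<omega> \<bullet> Rs \<omega> \<partial>M) = 0"
    unfolding Rs_def inner_diff_right
    using J2[OF U] N.noise_orthogonal[OF U S] L2_inner[OF U(1) J] L2_inner[OF U(1) N.matvec_L2[OF S]]
    by simp
  have split: "X t \<omega> - euler_step b \<sigma> h \<nu> (V \<omega>) (W t \<omega> - W s \<omega>) = (U \<omega> + N \<omega>) + (Rb \<omega> + Rs \<omega>)" for \<omega>
    by (simp add: euler_step_def U_def N_def A_def Rb_def Rs_def matrix_vector_mult_diff_rdistrib)
  \<comment> \<open>The product of \<open>U\<close> and \<open>Rs\<close> stays exact, to vanish
    upon integration. For \<open>Rb\<close> the weight \<open>\<delta> * h\<close> turns the order
    \<open>h ^ 3\<close> into \<open>h\<^sup>2\<close>. The squared norm of \<open>N\<close> already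
    carries a factor \<open>h\<close> in mean (\<open>eN\<close>), so the weight
    \<open>\<delta>\<close> is enough there.\<close>
  have pointwise: "(norm ((U \<omega> + N \<omega>) + (Rb \<omega> + Rs \<omega>)))\<^sup>2
      \<le> (norm (U \<omega> + N \<omega>))\<^sup>2 + 2 * (U \<omega> \<bullet> Rs \<omega>) + \<delta> * h * (norm (U \<omega>))\<^sup>2 + (norm (Rb \<omega>))\<^sup>2 / (\<delta> * h)
        + \<delta> * (norm (N \<omega>))\<^sup>2 + (1 / \<delta> + 1) * (2 * (norm (Rb \<omega>))\<^sup>2 + 2 * (norm (Rs \<omega>))\<^sup>2)" for \<omega>
  proof -
    have "(norm ((U \<omega> + N \<omega>) + (Rb \<omega> + Rs \<omega>)))\<^sup>2
      = (norm (U \<omega> + N \<omega>))\<^sup>2 + 2 * (U \<omega> \<bullet> Rs \<omega>) + 2 * (U \<omega> \<bullet> Rb \<omega>)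
        + 2 * (N \<omega> \<bullet> (Rb \<omega> + Rs \<omega>)) + (norm (Rb \<omega> + Rs \<omega>))\<^sup>2"
      unfolding power2_norm_eq_inner by (simp add: inner_left_distrib inner_right_distrib inner_commute)
    moreover have "2 * (U \<omega> \<bullet> Rb \<omega>) \<le> \<delta> * h * (norm (U \<omega>))\<^sup>2 + (norm (Rb \<omega>))\<^sup>2 / (\<delta> * h)"
      using h \<delta> by (intro inner_le_weighted) auto
    moreover have "2 * (N \<omega> \<bullet> (Rb \<omega> + Rs \<omega>)) \<le> \<delta> * (norm (N \<omega>))\<^sup>2 + (norm (Rb \<omega> + Rs \<omega>))\<^sup>2 / \<delta>"
      by (rule inner_le_weighted[OF \<delta>(1)])
    moreover have "(1 / \<delta> + 1) * (norm (Rb \<omega> + Rs \<omega>))\<^sup>2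
        \<le> (1 / \<delta> + 1) * (2 * (norm (Rb \<omega>))\<^sup>2 + 2 * (norm (Rs \<omega>))\<^sup>2)"
      using \<delta> by (intro mult_left_mono norm_add_sq_le) auto
    ultimately show ?thesis by (simp add: distrib_right)
  qed
  note ints = L2_integrable_norm_sq[OF U(1)] L2_integrable_norm_sq[OF N] L2_integrable_norm_sq[OF Rb]
    L2_integrable_norm_sq[OF Rs] L2_integrable_norm_sq[OF L2_add[OF U(1) N]] L2_inner[OF U(1) Rs]
  have "(\<integral>\<omega>. (norm ((U \<omega> + N \<omega>) + (Rb \<omega> + Rs \<omega>)))\<^sup>2 \<partial>M)
      \<le> (\<integral>\<omega>. (norm (U \<omega> + N \<omega>))\<^sup>2 + 2 * (U \<omega> \<bullet> Rs \<omega>) + \<delta> * h * (norm (U \<omega>))\<^sup>2 + (norm (Rb \<omega>))\<^sup>2 / (\<delta> * h)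
        + \<delta> * (norm (N \<omega>))\<^sup>2 + (1 / \<delta> + 1) * (2 * (norm (Rb \<omega>))\<^sup>2 + 2 * (norm (Rs \<omega>))\<^sup>2) \<partial>M)"
    using L2_integrable_norm_sq[OF L2_add[OF L2_add[OF U(1) N] L2_add[OF Rb Rs]]] ints pointwise
    by (intro integral_mono) auto
  also have "\<dots> = (\<integral>\<omega>. (norm (U \<omega> + N \<omega>))\<^sup>2 \<partial>M) + \<delta> * h * (\<integral>\<omega>. (norm (U \<omega>))\<^sup>2 \<partial>M)
        + (\<integral>\<omega>. (norm (Rb \<omega>))\<^sup>2 \<partial>M) / (\<delta> * h) + \<delta> * (\<integral>\<omega>. (norm (N \<omega>))\<^sup>2 \<partial>M)
        + (1 / \<delta> + 1) * (2 * (\<integral>\<omega>. (norm (Rb \<omega>))\<^sup>2 \<partial>M) + 2 * (\<integral>\<omega>. (norm (Rs \<omega>))\<^sup>2 \<partial>M))"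
    using ints URs by simp
  also have "\<dots> \<le> (1 - c * h) * ?e + \<delta> * h * ?e + L * h ^ 3 / (\<delta> * h) + \<delta> * (h * ((a + bbar) * ?e))
        + (1 / \<delta> + 1) * (2 * (L * h ^ 3) + 2 * (4 * L * h\<^sup>2))"
    using h \<delta> by (intro add_mono mult_left_mono divide_right_mono eUN eU eN eRb eRs) auto
  \<comment> \<open>The weighted terms cost \<open>\<delta> * (1 + a + bbar) * h * ?e\<close>, at
    most half of the contraction by the condition on \<open>\<delta>\<close>. The 10 is
    \<open>2 + 8\<close>, from \<open>Rb\<close> and \<open>Rs\<close>.\<close>
  also have "\<dots> \<le> (1 - c / 2 * h) * ?e + L * (1 / \<delta> + 10 * (1 / \<delta> + 1)) * h\<^sup>2"
  proof -
    have "h ^ 3 \<le> h\<^sup>2" using h by (intro power_decreasing) auto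
    then have "L * h ^ 3 \<le> L * h\<^sup>2" using L by (intro mult_left_mono)
    then have "(1 / \<delta> + 1) * (2 * (L * h ^ 3) + 2 * (4 * L * h\<^sup>2)) \<le> (1 / \<delta> + 1) * (10 * L * h\<^sup>2)"
      using \<delta> by (intro mult_left_mono) auto
    moreover have "L * h ^ 3 / (\<delta> * h) = L * h\<^sup>2 / \<delta>"
      using h \<delta> by (simp add: power2_eq_square power3_eq_cube)
    moreover have "\<delta> * (1 + a + bbar) * (h * ?e) \<le> c / 2 * (h * ?e)"
      using \<delta> h unfolding c_def by (intro mult_right_mono) auto
    ultimately show ?thesis by (simp add: algebra_simps)
  qed
  finally show ?thesis unfolding split L_def c_def .
qed

text \<open>One stationary solution, chosen before \<open>h\<close>, is compared with a stationary
  scheme. Their joint law at time 0 is arbitrary: both marginals stay fixed, so every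
  \<open>e k\<close> bounds the same squared distance, and the initial error dies out as
  \<open>k\<close> grows.\<close>

lemma W2_euler_invariant_mv_invariant:
  assumes \<pi>: "mv_invariant M F W b \<sigma> \<pi>" and a4: "a + bbar < \<alpha> - \<beta>"
  shows "\<exists>C>0. \<forall>h\<in>{0<..<1}. 0 < 1 - (\<alpha> - \<beta>) * h + (a + bbar) * h\<^sup>2 \<longrightarrow>
      (\<forall>\<pi>h. euler_invariant M F W b \<sigma> h \<pi>h \<longrightarrow> W2 \<pi>h \<pi> \<le> C * h powr (1/2))"
proof -
  define c where "c = (\<alpha> - \<beta> - (a + bbar)) / 2"
  \<comment> \<open>The largest weight that \<open>euler_local_error\<close> admits.\<close>
  define \<delta> where "\<delta> = c / (1 + a + bbar)"
  define K where "K = 10 * a * (c0 * (1 + 2 * second_moment \<pi>)) * (1 / \<delta> + 10 * (1 / \<delta> + 1))"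
  have c: "c > 0" using a4 by (simp add: c_def)
  have \<delta>: "\<delta> > 0" "\<delta> * (1 + a + bbar) \<le> (\<alpha> - \<beta> - (a + bbar)) / 2"
    using c parameters by (simp_all add: \<delta>_def c_def[symmetric])
  have K: "K \<ge> 0" using \<delta> parameters by (simp add: K_def second_moment_def)
  obtain X where "mv_solution M F W b \<sigma> X" "law M (X 0) = \<pi>" "\<pi> \<in> P2"
    and "\<forall>X. mv_solution M F W b \<sigma> X \<longrightarrow> law M (X 0) = \<pi> \<longrightarrow> (\<forall>t\<ge>0. law M (X t) = \<pi>)"
    using \<pi> unfolding mv_invariant_def by blast
  then have X: "stationary_solution \<pi> X" by (auto simp: stationary_solution_def)
  have "W2 \<pi>h \<pi> \<le> (sqrt (K / c) + 1) * h powr (1/2)"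
    if h: "0 < h" "h < 1" and q: "0 < 1 - (\<alpha> - \<beta>) * h + (a + bbar) * h\<^sup>2"
      and inv: "euler_invariant M F W b \<sigma> h \<pi>h" for h \<pi>h
  proof -
    obtain V where V: "V \<in> borel_measurable (F 0)" and "law M V = \<pi>h" "\<pi>h \<in> P2"
      and lE: "\<And>k. law M (euler M W b \<sigma> h V k) = \<pi>h"
      using inv by (auto simp: euler_invariant_def)
    then have VL: "L2 M V" by (intro law_P2_L2 F_measurable_M[of 0]) auto
    define e where "e k = (\<integral>\<omega>. (norm (X (real k * h) \<omega> - euler M W b \<sigma> h V k \<omega>))\<^sup>2 \<partial>M)" for k
    have step: "e (Suc k) \<le> (1 - c * h) * e k + K * h\<^sup>2" for k
      using euler_local_error[OF X h euler_L2[OF VL V h(1)] euler_adapted[OF VL V h(1)] lE a4 \<delta>]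
      unfolding e_def euler_Suc lE K_def c_def .
    \<comment> \<open>Positivity of the one-step factor gives \<open>0 < 1 - 2 * c * h\<close>, so
      the induction below may multiply by \<open>1 - c * h\<close>.\<close>
    have r: "0 \<le> 1 - c * h" "1 - c * h < 1"
    proof -
      have "(a + bbar) * h\<^sup>2 \<le> (a + bbar) * h"
        unfolding power2_eq_square using h parameters by (intro mult_left_mono) auto
      then have "0 < 1 - 2 * c * h" using q by (simp add: c_def algebra_simps)
      then show "0 \<le> 1 - c * h" using mult_pos_pos[OF c h(1)] by simp
    qed (use c h in simp)
    \<comment> \<open>\<open>K * h / c\<close> is the fixed point of the error recursion; being of
      order \<open>h\<close>, it yields the exponent 1/2 after the root.\<close>
    have bound: "e k \<le> (1 - c * h) ^ k * e 0 + K * h / c" for k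
    proof (induction k)
      case (Suc k)
      have "e (Suc k) \<le> (1 - c * h) * ((1 - c * h) ^ k * e 0 + K * h / c) + K * h\<^sup>2"
        using step[of k] mult_left_mono[OF Suc r(1)] by linarith
      also have "\<dots> = (1 - c * h) ^ Suc k * e 0 + K * h / c"
        using c by (simp add: field_simps power2_eq_square)
      finally show ?case .
    qed (use K c h in simp)
    have "(W2 \<pi>h \<pi>)\<^sup>2 \<le> e k" for k
    proof -
      have k: "0 \<le> real k * h" using h by simp
      have "law M (X (real k * h)) = \<pi>" using X k by (simp add: stationary_solution_def)
      then have "(W2 \<pi>h \<pi>)\<^sup>2 \<le> (\<integral>\<omega>. (norm (euler M W b \<sigma> h V k \<omega> - X (real k * h) \<omega>))\<^sup>2 \<partial>M)"
        using W2_law_le[OF L2_measurable[OF euler_L2[OF VL V h(1)]]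
            L2_measurable[OF stationary_solution_L2(2)[OF X k]], of k] by (simp add: lE)
      then show ?thesis by (simp add: e_def norm_minus_commute)
    qed
    then have "(W2 \<pi>h \<pi>)\<^sup>2 \<le> (1 - c * h) ^ k * e 0 + K * h / c" for k
      using bound order_trans by blast
    moreover have "(\<lambda>k. (1 - c * h) ^ k * e 0 + K * h / c) \<longlonglongrightarrow> 0 * e 0 + K * h / c"
      using r by (intro tendsto_intros LIMSEQ_realpow_zero) auto
    ultimately have "(W2 \<pi>h \<pi>)\<^sup>2 \<le> K / c * h"
      using LIMSEQ_le_const[of _ "0 * e 0 + K * h / c"] by fastforce
    then have "W2 \<pi>h \<pi> \<le> sqrt (K / c * h)" by (rule real_le_rsqrt)
    also have "\<dots> = sqrt (K / c) * h powr (1/2)" using h by (simp only: real_sqrt_mult powr_half_sqrt)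
    also have "\<dots> \<le> (sqrt (K / c) + 1) * h powr (1/2)" by (simp add: distrib_right)
    finally show ?thesis .
  qed
  moreover have "sqrt (K / c) + 1 > 0" using K c by (simp add: add_nonneg_pos)
  ultimately show ?thesis by (intro exI[of _ "sqrt (K / c) + 1"]) auto
qed

end

theorem theorem2p2:
  fixes M :: "'w measure"
    and F :: "real \<Rightarrow> 'w measure"
    and W :: "real \<Rightarrow> 'w \<Rightarrow> real^'d"
    and b :: "real^'d \<Rightarrow> (real^'d) measure \<Rightarrow> real^'d"
    and \<sigma> :: "real^'d \<Rightarrow> (real^'d) measure \<Rightarrow> real^'d^'d"
    and \<alpha> \<beta> \<gamma> \<kappa> \<rho> c0 a bbar hs hss :: real
  assumes "brownian_motion M F W"
    and "supports_initial_laws M F TYPE(real^'d)"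
    and "assumption1 b \<sigma>"
    and "assumption2 b \<sigma> \<alpha> \<beta> \<gamma> \<kappa> \<rho>"
    and "assumption3 b \<sigma> c0 a bbar"
    and "assumption4 \<alpha> \<beta> a bbar"
    and "admissible_hstar \<gamma> \<kappa> c0 hs"
    and "admissible_hstarstar \<alpha> \<beta> a bbar hss"
  shows "(\<forall>h\<in>{0<..<min hs hss}. \<exists>\<pi>h.
            euler_invariant M F W b \<sigma> h \<pi>h \<and>
            (\<forall>\<nu>. euler_invariant M F W b \<sigma> h \<nu> \<longrightarrow> \<nu> = \<pi>h) \<and>
            (\<forall>x. \<exists>C>0. \<exists>\<xi>>0. \<forall>k::nat.
               W2 (law M (euler M W b \<sigma> h (\<lambda>\<omega>. x) k)) \<pi>h \<le> C * exp (- \<xi> * (real k * h)))) \<and>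
         (\<forall>\<pi>. mv_invariant M F W b \<sigma> \<pi> \<longrightarrow>
            (\<exists>C>0. \<forall>h\<in>{0<..<min hs hss}. \<forall>\<pi>h. euler_invariant M F W b \<sigma> h \<pi>h \<longrightarrow>
               W2 \<pi>h \<pi> \<le> C * h powr (1/2)))"
proof -
  interpret mv_brownian b \<sigma> \<alpha> \<beta> \<gamma> \<kappa> \<rho> c0 a bbar M F W
    by (intro mv_brownian.intro mv_coefficients.intro assms)
  have h: "0 < h" "h < 1" "0 < 1 - (\<alpha> - \<beta>) * h + (a + bbar) * h\<^sup>2" "1 - (\<alpha> - \<beta>) * h + (a + bbar) * h\<^sup>2 < 1"
    "0 < 1 - (\<gamma> - \<kappa>) * h + 2 * c0 * h\<^sup>2" "1 - (\<gamma> - \<kappa>) * h + 2 * c0 * h\<^sup>2 < 1"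
    if "h \<in> {0<..<min hs hss}" for h
    using that assms(7,8) by (auto simp: admissible_hstar_def admissible_hstarstar_def)
  have a4: "a + bbar < \<alpha> - \<beta>" using assms(6) by (simp add: assumption4_def)
  show ?thesis
  proof (intro conjI ballI allI impI)
    fix h assume "h \<in> {0<..<min hs hss}"
    note h = h[OF this]
    show "\<exists>\<pi>h. euler_invariant M F W b \<sigma> h \<pi>h \<and>
            (\<forall>\<nu>. euler_invariant M F W b \<sigma> h \<nu> \<longrightarrow> \<nu> = \<pi>h) \<and>
            (\<forall>x. \<exists>C>0. \<exists>\<xi>>0. \<forall>k::nat.
               W2 (law M (euler M W b \<sigma> h (\<lambda>\<omega>. x) k)) \<pi>h \<le> C * exp (- \<xi> * (real k * h)))"
      by (rule ex1_euler_invariant[OF assms(2) h(1,3-6)])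
  next
    fix \<pi> assume "mv_invariant M F W b \<sigma> \<pi>"
    from W2_euler_invariant_mv_invariant[OF this a4]
    obtain C where C: "C > 0" "\<forall>h\<in>{0<..<1}. 0 < 1 - (\<alpha> - \<beta>) * h + (a + bbar) * h\<^sup>2 \<longrightarrow>
      (\<forall>\<pi>h. euler_invariant M F W b \<sigma> h \<pi>h \<longrightarrow> W2 \<pi>h \<pi> \<le> C * h powr (1/2))"
      by blast
    have "W2 \<pi>h \<pi> \<le> C * h powr (1/2)"
      if "h \<in> {0<..<min hs hss}" "euler_invariant M F W b \<sigma> h \<pi>h" for h \<pi>h
      using C(2) h(1-3)[OF that(1)] that(2) by auto
    with C(1) show "\<exists>C>0. \<forall>h\<in>{0<..<min hs hss}. \<forall>\<pi>h. euler_invariant M F W b \<sigma> h \<pi>h \<longrightarrow>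
               W2 \<pi>h \<pi> \<le> C * h powr (1/2)"
      by blast
  qed
qed

end
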